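(* Let $1<k<n$, let $\Omega\subset\mathbb R^n$ be a bounded domain, and let $\gamma$ be the unit outer normal of $\partial\Omega$. Suppose $u,v\in C^\infty(\overline\Omega)$ are $H_k$-subharmonic functions. If $u=v$ and $u_\gamma>v_\gamma$ on $\partial\Omega$, then $$\int_{\Omega}H_k[u]\,dx\ \ge\ \int_{\Omega}H_k[v]\,dx .$$
   Context: For a $C^2$ function $u$ put $w=\sqrt{1+|Du|^2}$ and $H_k[u]=\sigma_k\big(D(\tfrac{Du}{w})\big)$, where $\sigma_k$ of a matrix is the sum of its principal minors of order $k$ (so $H_k[u]$ is the $k$-th elementary symmetric polynomial of the principal curvatures of the graph of $u$). A $C^2$ function $u$ is $H_k$-subharmonic if $H_j[u]\ge0$ for $j=1,\dots,k$. $u_\gamma$ denotes the derivative of $u$ in direction $\gamma$. It is not assumed that $\partial\Omega$ is $(k-1)$-convex. *)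

theory Defs
  imports "HOL-Analysis.Analysis"
begin

definition partial :: "'n::finite \<Rightarrow> (real^'n \<Rightarrow> real) \<Rightarrow> real^'n \<Rightarrow> real" where
  "partial i f x = frechet_derivative f (at x) (axis i 1)"

primrec partials :: "'n::finite list \<Rightarrow> (real^'n \<Rightarrow> real) \<Rightarrow> real^'n \<Rightarrow> real" where
  "partials [] f = f"
| "partials (i # is) f = partial i (partials is f)"

definition grad :: "(real^'n::finite \<Rightarrow> real) \<Rightarrow> real^'n \<Rightarrow> real^'n" where
  "grad f x = (\<chi> i. partial i f x)"

text \<open>The class \<open>C\<^sup>m(S)\<close>, meant for open \<open>S\<close>.\<close>

definition Ck_on :: "nat \<Rightarrow> (real^'n::finite) set \<Rightarrow> (real^'n \<Rightarrow> real) \<Rightarrow> bool" where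
  "Ck_on m S f \<longleftrightarrow>
     (\<forall>is. length is < m \<longrightarrow> partials is f differentiable_on S) \<and>
     (\<forall>is. length is \<le> m \<longrightarrow> continuous_on S (partials is f))"

text \<open>
  \<open>C\<^sup>\<infinity>\<close> up to the boundary: \<open>f\<close> is smooth in the open set \<open>S\<close>, and \<open>f\<close> and all its
  partial derivatives extend continuously to the closure. The values of \<open>f\<close> on the frontier are
  those of its extension; the values of the functions \<open>partials is f\<close> there are irrelevant.
\<close>

definition smooth_on_closure :: "(real^'n::finite) set \<Rightarrow> (real^'n \<Rightarrow> real) \<Rightarrow> bool" where
  "smooth_on_closure S f \<longleftrightarrow>
     (\<forall>m. Ck_on m S f) \<and>
     continuous_on (closure S) f \<and>
     (\<forall>is. \<exists>g. continuous_on (closure S) g \<and> (\<forall>x\<in>S. g x = partials is f x))"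

definition domain :: "(real^'n::finite) set \<Rightarrow> bool" where
  "domain S \<longleftrightarrow> open S \<and> connected S \<and> S \<noteq> {}"

text \<open>
  \<open>\<rho>\<close> is a \<open>C\<^sup>1\<close> defining function of \<open>S\<close> in the neighbourhood \<open>U\<close> of the point \<open>x\<close>,
  negative inside \<open>S\<close>, so that its gradient points outwards.
\<close>

definition defining_function ::
    "(real^'n::finite) set \<Rightarrow> real^'n \<Rightarrow> (real^'n) set \<Rightarrow> (real^'n \<Rightarrow> real) \<Rightarrow> bool" where
  "defining_function S x U \<rho> \<longleftrightarrow>
     open U \<and> x \<in> U \<and> Ck_on 1 U \<rho> \<and> (\<forall>y\<in>U. grad \<rho> y \<noteq> 0) \<and>
     S \<inter> U = {y\<in>U. \<rho> y < 0} \<and> frontier S \<inter> U = {y\<in>U. \<rho> y = 0}"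

definition C1_boundary :: "(real^'n::finite) set \<Rightarrow> bool" where
  "C1_boundary S \<longleftrightarrow> (\<forall>x\<in>frontier S. \<exists>U \<rho>. defining_function S x U \<rho>)"

definition unit_outer_normal :: "(real^'n::finite) set \<Rightarrow> (real^'n \<Rightarrow> real^'n) \<Rightarrow> bool" where
  "unit_outer_normal S \<gamma> \<longleftrightarrow>
     (\<forall>x\<in>frontier S. \<forall>U \<rho>. defining_function S x U \<rho> \<longrightarrow> \<gamma> x = grad \<rho> x /\<^sub>R norm (grad \<rho> x))"

text \<open>
  The derivative at a frontier point \<open>x\<close> in the outward direction \<open>\<nu>\<close>. It is taken from the left
  because the function is only meaningful at the points \<open>x + t *\<^sub>R \<nu>\<close> with \<open>t \<le> 0\<close>.
\<close>

definition outward_deriv :: "(real^'n::finite \<Rightarrow> real) \<Rightarrow> real^'n \<Rightarrow> real^'n \<Rightarrow> real" where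
  "outward_deriv f \<nu> x = vector_derivative (\<lambda>t. f (x + t *\<^sub>R \<nu>)) (at_left 0)"

text \<open>
  The principal minor with index set \<open>I\<close>, by the Leibniz formula as in \<open>det\<close>; the
  permutations range over those of \<open>I\<close> only.
\<close>

definition principal_minor :: "'n::finite set \<Rightarrow> real^'n^'n \<Rightarrow> real" where
  "principal_minor I A = (\<Sum>p | p permutes I. of_int (sign p) * (\<Prod>i\<in>I. A $ i $ p i))"

definition sigma_mat :: "nat \<Rightarrow> real^'n::finite^'n \<Rightarrow> real" where
  "sigma_mat k A = (\<Sum>I | card I = k. principal_minor I A)"

definition graph_grad :: "(real^'n::finite \<Rightarrow> real) \<Rightarrow> real^'n \<Rightarrow> real^'n" where
  "graph_grad u x = grad u x /\<^sub>R sqrt (1 + (norm (grad u x))\<^sup>2)"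

definition H_curv :: "nat \<Rightarrow> (real^'n::finite \<Rightarrow> real) \<Rightarrow> real^'n \<Rightarrow> real" where
  "H_curv k u x = sigma_mat k (jacobian (graph_grad u) (at x))"

definition H_subharmonic_on :: "nat \<Rightarrow> (real^'n::finite) set \<Rightarrow> (real^'n \<Rightarrow> real) \<Rightarrow> bool" where
  "H_subharmonic_on k S u \<longleftrightarrow> Ck_on 2 S u \<and> (\<forall>j\<in>{1..k}. \<forall>x\<in>S. H_curv j u x \<ge> 0)"

end

(*
  Put psi = v - u, u_t = v + t (u - v), p = Du / w. The derivative d/dt H_k[u_t] is the divergence of
  the field X_t with components X^j = S^ij dp_i/dt, because the cofactors S^ij of D(p[u_t]) are
  divergence-free. Let zeta be a cutoff function that equals 1 away from the boundary and an increasing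
  function of psi near it, where psi > 0. Integration by parts turns the t-derivative of the integral
  of zeta H_k[u_t] into the integral of a nonnegative multiple of
    Q = d/ds H_k(Du_t, D^2 u_t + s Dpsi Dpsi^T) at s = 0,
  so no integral over the boundary is needed; at the end zeta tends to 1.

  That Q is nonnegative is a pointwise fact. The gradients Du_t lie on a line with direction
  xi = Dpsi, so their projection to the hyperplane orthogonal to xi is fixed, and up to a positive
  factor Q is sigma_(k-1) of the restriction of D^2 u_t to this hyperplane relative to a scalar product
  independent of t. At t = 0 and t = 1 the restriction lies in the Garding cone of order k - 1, because
  u and v are H_k-subharmonic. The restriction is affine in t and the cone is convex.
*)

theory Submission
  imports Defs "HOL-Computational_Algebra.Fundamental_Theorem_Algebra"
begin

section \<open>Elementary symmetric functions of a matrix\<close>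

text \<open>The obstacle is that u_t need not be H_k-subharmonic. The matrix \<open>gmat\<close>
  that multiplies the Hessian moves with t, so the hypotheses at t = 0 and t = 1 put the two
  Hessians in cones normalised by different scalar products, and convexity cannot be applied to them
  directly. The part of the Hessian that Q tests is the part where the normalisation does not move.
  Moreover \<open>gmat\<close> times a Hessian is not symmetric. Writing \<open>gmat\<close> as M
  M^T and using sigma_j(M M^T r) = sigma_j(M^T r M) replaces it by a symmetric matrix, to which the
  theory of the cone applies. Convexity of the cone is a fact about hyperbolic polynomials:
  sigma_k(z I + X) has only real zeros in z for symmetric X, and the zeros of a deformed pencil
  cannot cross the real axis. The strict inequality of the normal derivatives yields psi > 0 inside
  the domain near the boundary. Superlevel sets of psi then provide cutoffs of compact support, and
  integration by parts reduces to translation invariance of Lebesgue measure.\<close>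

definition pminor :: "'n::finite set \<Rightarrow> 'a::comm_ring_1^'n^'n \<Rightarrow> 'a" where
  "pminor I A = (\<Sum>p | p permutes I. of_int (sign p) * (\<Prod>i\<in>I. A $ i $ p i))"

text \<open>Over an arbitrary commutative ring, because hyperbolicity evaluates the same expression
  on complex matrices.\<close>

definition esigma :: "nat \<Rightarrow> 'a::comm_ring_1^'n::finite^'n \<Rightarrow> 'a" where
  "esigma k A = (\<Sum>I | card I = k. pminor I A)"

lemma sigma_mat_eq_esigma: "sigma_mat k A = esigma k A"
  by (simp add: sigma_mat_def esigma_def principal_minor_def pminor_def)

lemma pminor_UNIV: "pminor UNIV A = det A"
  by (simp add: pminor_def det_def)

lemma pminor_empty [simp]: "pminor {} A = 1"
  by (simp add: pminor_def)

lemma esigma_0 [simp]: "esigma 0 (A :: 'a::comm_ring_1^'n::finite^'n) = 1"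
proof -
  have "{I :: 'n set. card I = 0} = {{}}" by auto
  then show ?thesis by (simp add: esigma_def)
qed

lemma esigma_CARD: "esigma CARD('n) (A :: 'a::comm_ring_1^'n::finite^'n) = det A"
proof -
  have "{I :: 'n set. card I = CARD('n)} = {UNIV}"
    by  (auto intro: card_eq_UNIV_imp_eq_UNIV[THEN equalityD2, THEN subsetD])
  then show ?thesis by (simp add: esigma_def pminor_UNIV)
qed

lemma pminor_cong: "(\<And>i j. i \<in> I \<Longrightarrow> j \<in> I \<Longrightarrow> A $ i $ j = B $ i $ j) \<Longrightarrow> pminor I A = pminor I B"
  unfolding pminor_def
  by (intro sum.cong refl arg_cong2[of _ _ _ _ "(*)"] prod.cong) (auto simp: permutes_in_image)

lemma pminor_scale: "pminor I (\<chi> i j. c * A $ i $ j) = c ^ card I * pminor I A"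
  by (simp add: pminor_def prod.distrib sum_distrib_left mult_ac)

lemma esigma_scale: "esigma k (\<chi> i j. c * A $ i $ j) = c ^ k * esigma k A"
  unfolding esigma_def sum_distrib_left by (intro sum.cong) (auto simp: pminor_scale)

lemma pminor_of_real: "pminor I (\<chi> i j. of_real (A $ i $ j)) = of_real (pminor I A)"
  by (simp add: pminor_def)

lemma esigma_of_real: "esigma k (\<chi> i j. of_real (A $ i $ j)) = of_real (esigma k A)"
  by (simp add: esigma_def pminor_of_real)

text \<open>Multiply out each Leibniz product, choosing the entry of \<open>A\<close> on a subset
  \<open>K\<close> and the entry of \<open>mat z\<close> on the rest. The rest contributes only if
  \<open>p\<close> fixes every point of \<open>I - K\<close>, that is, if \<open>p\<close> permutes
  \<open>K\<close>.\<close>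

lemma pminor_mat_plus:
  fixes A :: "'a::comm_ring_1^'n::finite^'n"
  shows "pminor I (mat z + A) = (\<Sum>K\<in>Pow I. z ^ (card I - card K) * pminor K A)"
proof -
  have fin: "finite {p :: 'n \<Rightarrow> 'n. p permutes I}" "finite (Pow I)"
    using finite_permutations[of I] by auto
  have diag: "(\<Prod>i\<in>I - K. mat z $ i $ p i) = (if p permutes K then z ^ (card I - card K) else 0)"
    if Kp: "K \<subseteq> I" "p permutes I" for K p
  proof (cases "p permutes K")
    case True
    then have "(\<Prod>i\<in>I - K. mat z $ i $ p i) = (\<Prod>i\<in>I - K. z)"
      by (intro prod.cong) (auto simp: mat_def permutes_def)
    then show ?thesis using True Kp by (simp add: card_Diff_subset)
  next
    case False
    then obtain i where "i \<in> I - K" "p i \<noteq> i"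
      using permutes_superset[OF Kp(2), of K] by blast
    then have "(\<Prod>i\<in>I - K. mat z $ i $ p i) = 0"
      by (intro prod_zero bexI[of _ i]) (auto simp: mat_def)
    then show ?thesis using False by simp
  qed
  have "pminor I (mat z + A) =
      (\<Sum>p | p permutes I. \<Sum>K\<in>Pow I. of_int (sign p) * ((\<Prod>i\<in>K. A $ i $ p i) * (\<Prod>i\<in>I - K. mat z $ i $ p i)))"
    unfolding pminor_def
    by (simp add: add.commute[of "mat z"] prod_add sum_distrib_left)
  also have "\<dots> = (\<Sum>K\<in>Pow I. \<Sum>p | p permutes I. of_int (sign p) * ((\<Prod>i\<in>K. A $ i $ p i) * (\<Prod>i\<in>I - K. mat z $ i $ p i)))"
    by (rule sum.swap)
  also have "\<dots> = (\<Sum>K\<in>Pow I. z ^ (card I - card K) * pminor K A)"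
  proof (intro sum.cong refl)
    fix K assume K: "K \<in> Pow I"
    then have perm: "p permutes I" if "p permutes K" for p
      using that by (auto intro: permutes_subset)
    have "(\<Sum>p | p permutes I. of_int (sign p) * ((\<Prod>i\<in>K. A $ i $ p i) * (\<Prod>i\<in>I - K. mat z $ i $ p i)))
        = (\<Sum>p | p permutes K. of_int (sign p) * ((\<Prod>i\<in>K. A $ i $ p i) * z ^ (card I - card K)))"
      by (rule sum.mono_neutral_cong_right)
         (use K fin perm in \<open>auto simp: diag\<close>)
    then show "(\<Sum>p | p permutes I. of_int (sign p) * ((\<Prod>i\<in>K. A $ i $ p i) * (\<Prod>i\<in>I - K. mat z $ i $ p i)))
        = z ^ (card I - card K) * pminor K A"
      by (simp add: pminor_def sum_distrib_left mult_ac)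
  qed
  finally show ?thesis .
qed

lemma card_supersets:
  fixes K :: "'n::finite set"
  assumes "card K \<le> k"
  shows "card {I. K \<subseteq> I \<and> card I = k} = (CARD('n) - card K) choose (k - card K)"
proof -
  have "bij_betw (\<lambda>L. K \<union> L) {L. L \<subseteq> - K \<and> card L = k - card K} {I. K \<subseteq> I \<and> card I = k}"
  proof (rule bij_betw_byWitness[where f' = "\<lambda>I. I - K"])
    show "(\<union>) K ` {L. L \<subseteq> - K \<and> card L = k - card K} \<subseteq> {I. K \<subseteq> I \<and> card I = k}"
      using assms by (auto simp: card_Un_disjoint disjoint_eq_subset_Compl Int_commute)
  qed (auto simp: card_Diff_subset)
  then have "card {I. K \<subseteq> I \<and> card I = k} = card {L. L \<subseteq> - K \<and> card L = k - card K}"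
    by (simp add: bij_betw_same_card)
  also have "\<dots> = (CARD('n) - card K) choose (k - card K)"
    by (subst n_subsets) (auto simp: Compl_eq_Diff_UNIV card_Diff_subset)
  finally show ?thesis .
qed

text \<open>Each minor of size \<open>j\<close> occurs once for every index set of size
  \<open>k\<close> above it, whence the binomial coefficient. Up to a constant this is a derivative
  of the polynomial in \<open>det_mat_plus\<close>.\<close>

lemma esigma_mat_plus:
  fixes A :: "'a::comm_ring_1^'n::finite^'n"
  shows "esigma k (mat z + A) = (\<Sum>j\<le>k. of_nat ((CARD('n) - j) choose (k - j)) * z ^ (k - j) * esigma j A)"
proof -
  have "esigma k (mat z + A) = (\<Sum>I | card I = k. \<Sum>K | K \<in> UNIV \<and> K \<subseteq> I. z ^ (k - card K) * pminor K A)"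
    unfolding esigma_def by (intro sum.cong) (auto simp: pminor_mat_plus Pow_def)
  also have "\<dots> = (\<Sum>K\<in>UNIV. \<Sum>I | I \<in> {I. card I = k} \<and> K \<subseteq> I. z ^ (k - card K) * pminor K A)"
    by (subst sum.swap_restrict) auto
  also have "\<dots> = (\<Sum>K | card K \<le> k. of_nat ((CARD('n) - card K) choose (k - card K)) * (z ^ (k - card K) * pminor K A))"
  proof (rule sum.mono_neutral_cong_right)
    show "\<forall>K\<in>UNIV - {K. card K \<le> k}. (\<Sum>I | I \<in> {I. card I = k} \<and> K \<subseteq> I. z ^ (k - card K) * pminor K A) = 0"
    proof
      fix K :: "'n set" assume "K \<in> UNIV - {K. card K \<le> k}"
      then have "{I. I \<in> {I. card I = k} \<and> K \<subseteq> I} = {}"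
        by (auto dest: card_mono[rotated])
      then show "(\<Sum>I | I \<in> {I. card I = k} \<and> K \<subseteq> I. z ^ (k - card K) * pminor K A) = 0"
        by (simp only: sum.empty)
    qed
    fix K :: "'n set" assume K: "K \<in> {K. card K \<le> k}"
    have "{I. I \<in> {I. card I = k} \<and> K \<subseteq> I} = {I. K \<subseteq> I \<and> card I = k}" by auto
    then show "(\<Sum>I | I \<in> {I. card I = k} \<and> K \<subseteq> I. z ^ (k - card K) * pminor K A)
        = of_nat ((CARD('n) - card K) choose (k - card K)) * (z ^ (k - card K) * pminor K A)"
      using K card_supersets[of K k] by simp
  qed auto
  also have "\<dots> = (\<Sum>j\<le>k. \<Sum>K | K \<in> {K. card K \<le> k} \<and> card K = j.
      of_nat ((CARD('n) - card K) choose (k - card K)) * (z ^ (k - card K) * pminor K A))"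
    by (rule sum.group[symmetric]) auto
  also have "\<dots> = (\<Sum>j\<le>k. of_nat ((CARD('n) - j) choose (k - j)) * z ^ (k - j) * esigma j A)"
    unfolding esigma_def sum_distrib_left by (intro sum.cong) (auto simp: mult_ac)
  finally show ?thesis .
qed

lemma det_mat_plus:
  fixes A :: "'a::comm_ring_1^'n::finite^'n"
  shows "det (mat z + A) = (\<Sum>j\<le>CARD('n). z ^ (CARD('n) - j) * esigma j A)"
  unfolding esigma_CARD[symmetric] esigma_mat_plus by (intro sum.cong) auto

text \<open>Affine in \<open>s\<close>, since a Leibniz product has only one factor from row
  \<open>a\<close>, and this factor is perturbed only if the permutation fixes
  \<open>a\<close>.\<close>

lemma pminor_rank_one:
  fixes A :: "'a::comm_ring_1^'n::finite^'n"
  shows "pminor I (A + (\<chi> i j. if i = a \<and> j = a then s else 0)) =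
    pminor I A + (if a \<in> I then s * pminor (I - {a}) A else 0)"
proof (cases "a \<in> I")
  case False
  then show ?thesis
    by (auto intro!: pminor_cong)
next
  case True
  let ?E = "(\<chi> i j. if i = a \<and> j = a then s else 0) :: 'a^'n^'n"
  have split: "(\<Prod>i\<in>I. (A + ?E) $ i $ p i) =
      (\<Prod>i\<in>I. A $ i $ p i) + (if p a = a then s * (\<Prod>i\<in>I - {a}. A $ i $ p i) else 0)" for p
  proof -
    have "(\<Prod>i\<in>I. (A + ?E) $ i $ p i) = (A + ?E) $ a $ p a * (\<Prod>i\<in>I - {a}. (A + ?E) $ i $ p i)"
      using True by (simp add: prod.remove)
    also have "(\<Prod>i\<in>I - {a}. (A + ?E) $ i $ p i) = (\<Prod>i\<in>I - {a}. A $ i $ p i)"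
      by (intro prod.cong) auto
    finally show ?thesis
      using True by (simp add: prod.remove[of I a "\<lambda>i. A $ i $ p i"] algebra_simps)
  qed
  have "pminor I (A + ?E) = pminor I A +
      (\<Sum>p | p permutes I. of_int (sign p) * (if p a = a then s * (\<Prod>i\<in>I - {a}. A $ i $ p i) else 0))"
    unfolding pminor_def split by (simp add: distrib_left sum.distrib)
  also have "(\<Sum>p | p permutes I. of_int (sign p) * (if p a = a then s * (\<Prod>i\<in>I - {a}. A $ i $ p i) else 0))
     = (\<Sum>p | p permutes I - {a}. of_int (sign p) * (s * (\<Prod>i\<in>I - {a}. A $ i $ p i)))"
  proof (rule sum.mono_neutral_cong_right)
    show "finite {p. p permutes I}" by (simp add: finite_permutations)
    show "{p. p permutes I - {a}} \<subseteq> {p. p permutes I}" by (auto intro: permutes_subset)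
    have "p permutes I - {a}" if "p permutes I" "p a = a" for p
      by (rule permutes_superset[OF that(1)]) (use that in auto)
    then show "\<forall>p\<in>{p. p permutes I} - {p. p permutes I - {a}}.
        of_int (sign p) * (if p a = a then s * (\<Prod>i\<in>I - {a}. A $ i $ p i) else 0) = 0"
      by auto
  qed (auto simp: permutes_def)
  also have "\<dots> = s * pminor (I - {a}) A"
    by (simp add: pminor_def sum_distrib_left mult_ac)
  finally show ?thesis using True by simp
qed

text \<open>The k-th symmetric function of the submatrix without row and column \<open>a\<close>.
  Restricting the index sets instead of the matrix avoids a change of index type.\<close>

definition esigma_del :: "'n::finite \<Rightarrow> nat \<Rightarrow> 'a::comm_ring_1^'n^'n \<Rightarrow> 'a" where
  "esigma_del a k A = (\<Sum>I | card I = k \<and> a \<notin> I. pminor I A)"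

lemma esigma_rank_one:
  fixes A :: "'a::comm_ring_1^'n::finite^'n"
  shows "esigma (Suc k) (A + (\<chi> i j. if i = a \<and> j = a then s else 0)) =
    esigma (Suc k) A + s * esigma_del a k A"
proof -
  have "(\<Sum>I | card I = Suc k. if a \<in> I then s * pminor (I - {a}) A else 0) =
      (\<Sum>I | card I = Suc k \<and> a \<in> I. s * pminor (I - {a}) A)"
    by (rule sum.mono_neutral_cong_right) auto
  also have "\<dots> = (\<Sum>I | card I = k \<and> a \<notin> I. s * pminor I A)"
    by (rule sum.reindex_bij_witness[where i = "insert a" and j = "\<lambda>I. I - {a}"]) auto
  finally show ?thesis
    unfolding esigma_def esigma_del_def by (simp add: pminor_rank_one sum.distrib sum_distrib_left)
qed

text \<open>The two products are similar through \<open>M\<close>, so they have the same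
  characteristic polynomial, and \<open>esigma k\<close> is one of its coefficients.\<close>

lemma esigma_mult_commute:
  fixes M X :: "real^'n::finite^'n"
  assumes "invertible M"
  shows "esigma k (M ** X) = esigma k (X ** M)"
proof (cases "k \<le> CARD('n)")
  case False
  have "{I :: 'n set. card I = k} = {}"
    using False card_mono[of "UNIV :: 'n set"] by auto
  then show ?thesis by (simp add: esigma_def)
next
  case True
  let ?n = "CARD('n)"
  define P where "P A = (\<Sum>j\<le>?n. monom (esigma j A) (?n - j))" for A :: "real^'n^'n"
  have poly_P: "poly (P A) z = det (mat z + A)" for A z
    by (simp add: P_def det_mat_plus poly_sum poly_monom mult.commute)
  have coeff_P: "coeff (P A) (?n - k) = esigma k A" for A
  proof -
    have "coeff (P A) (?n - k) = (\<Sum>j\<le>?n. if j = k then esigma j A else 0)"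
      unfolding P_def coeff_sum by (rule sum.cong) (use True in auto)
    then show ?thesis using True by simp
  qed
  have "det (mat z + M ** X) = det (mat z + X ** M)" for z
  proof -
    have "M ** mat z = mat z ** M"
      by (simp add: matrix_matrix_mult_def mat_def vec_eq_iff if_distrib[where f = "\<lambda>x. _ * x"]
          if_distrib[where f = "\<lambda>x. x * _"] mult.commute cong: if_cong)
    then have "M ** (mat z + X ** M) = (mat z + M ** X) ** M"
      proof -
      have "(mat z + M ** X) ** M = mat z ** M + M ** X ** M"
        by (simp add: matrix_matrix_mult_def vec_eq_iff distrib_right sum.distrib)
      then show ?thesis
        using \<open>M ** mat z = mat z ** M\<close> by (simp add: matrix_add_ldistrib matrix_mul_assoc)
    qed
    then have "det M * det (mat z + X ** M) = det (mat z + M ** X) * det M"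
      by (simp add: det_mul[symmetric])
    then show ?thesis using assms by (simp add: invertible_det_nz)
  qed
  then have "poly (P (M ** X)) = poly (P (X ** M))" by (auto simp: poly_P)
  then have "P (M ** X) = P (X ** M)" by (simp add: poly_eq_poly_eq_iff)
  then show ?thesis by (metis coeff_P)
qed

section \<open>Hyperbolicity and the Garding cone\<close>

definition mscale :: "'a::comm_ring_1 \<Rightarrow> 'a^'n^'n \<Rightarrow> 'a^'n::finite^'n" where
  "mscale c A = (\<chi> i j. c * A $ i $ j)"

definition cmat :: "real^'n^'n \<Rightarrow> complex^'n::finite^'n" where
  "cmat A = (\<chi> i j. complex_of_real (A $ i $ j))"

lemma mscale_nth [simp]: "mscale c A $ i $ j = c * A $ i $ j"
  by (simp add: mscale_def)

lemma cmat_nth [simp]: "cmat A $ i $ j = complex_of_real (A $ i $ j)"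
  by (simp add: cmat_def)

lemma mat_nth: "mat z $ i $ j = (if i = j then z else 0)"
  by (simp add: mat_def)

lemma esigma_mscale: "esigma k (mscale c A) = c ^ k * esigma k A"
  unfolding mscale_def by (rule esigma_scale)

lemma esigma_cmat: "esigma k (cmat A) = of_real (esigma k A)"
  unfolding cmat_def by (rule esigma_of_real)

text \<open>For a kernel vector v, pairing with its conjugate gives z |v|^2 + S = 0. Here S is real
  by symmetry of \<open>X\<close>, so the imaginary part is Im z |v|^2, which is nonzero.\<close>

lemma det_mat_plus_symmetric_nonzero:
  fixes X :: "real^'n::finite^'n"
  assumes sym: "transpose X = X" and z: "Im z \<noteq> 0"
  shows "det (mat z + cmat X) \<noteq> 0"
proof
  assume "det (mat z + cmat X) = 0"
  then obtain v where v: "v \<noteq> 0" and ker: "(mat z + cmat X) *v v = 0"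
    by (metis invertible_det_nz invertible_left_inverse matrix_left_invertible_ker)
  have symX: "X $ i $ j = X $ j $ i" for i j
    using sym by (metis transpose_def vec_lambda_beta)
  define S where "S = (\<Sum>i\<in>UNIV. \<Sum>j\<in>UNIV. cnj (v $ i) * of_real (X $ i $ j) * v $ j)"
  define N where "N = (\<Sum>i\<in>UNIV. (cmod (v $ i))\<^sup>2)"
  have "cnj S = (\<Sum>i\<in>UNIV. \<Sum>j\<in>UNIV. v $ i * of_real (X $ i $ j) * cnj (v $ j))"
    by (simp add: S_def)
  also have "\<dots> = (\<Sum>j\<in>UNIV. \<Sum>i\<in>UNIV. v $ i * of_real (X $ i $ j) * cnj (v $ j))"
    by (rule sum.swap)
  also have "\<dots> = S"
    unfolding S_def
  proof (intro sum.cong refl)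
    fix i j
    show "v $ i * of_real (X $ i $ j) * cnj (v $ j) = cnj (v $ j) * of_real (X $ j $ i) * v $ i"
      by (simp add: symX[of j i])
  qed
  finally have "Im S = 0" by (simp add: Reals_cnj_iff flip: complex_is_Real_iff)
  have N: "of_real N = (\<Sum>i\<in>UNIV. cnj (v $ i) * v $ i)"
    by (simp add: N_def complex_norm_square mult.commute del: of_real_power)
  have "((mat z + cmat X) *v v) $ i = z * v $ i + (\<Sum>j\<in>UNIV. of_real (X $ i $ j) * v $ j)" for i
    by (simp add: matrix_vector_mult_def mat_nth distrib_right sum.distrib if_distrib[where f = "\<lambda>x. x * _"] cong: if_cong)
  then have "0 = (\<Sum>i\<in>UNIV. cnj (v $ i) * (z * v $ i + (\<Sum>j\<in>UNIV. of_real (X $ i $ j) * v $ j)))"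
    using ker by simp
  also have "\<dots> = z * of_real N + S"
    by (simp add: S_def N distrib_left sum.distrib sum_distrib_left mult_ac)
  finally have "Im (z * of_real N + S) = 0" by simp
  then have "Im z * N = 0" using \<open>Im S = 0\<close> by simp
  moreover have "N > 0"
  proof -
    obtain i where "v $ i \<noteq> 0" using v by (auto simp: vec_eq_iff)
    then show ?thesis unfolding N_def
      by (intro sum_pos2[where i = i]) auto
  qed
  ultimately show False using z by auto
qed

section \<open>Polynomials with only real zeros\<close>

lemma pderiv_prod_linear:
  fixes z :: complex
  assumes "z \<notin># A"
  shows "poly (pderiv (\<Prod>x\<in>#A. [:-x, 1:])) z = poly (\<Prod>x\<in>#A. [:-x, 1:]) z * (\<Sum>x\<in>#A. 1 / (z - x))"
  using assms
proof (induction A)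
  case (add x A)
  define P where "P = (\<Prod>x\<in>#A. [:-x, 1:])"
  have "z - x \<noteq> 0" using add.prems by auto
  moreover have "poly (pderiv P) z = poly P z * (\<Sum>x\<in>#A. 1 / (z - x))"
    using add unfolding P_def by simp
  ultimately have "poly (pderiv ([:- x, 1:] * P)) z = poly ([:- x, 1:] * P) z * (1 / (z - x) + (\<Sum>x\<in>#A. 1 / (z - x)))"
    unfolding pderiv_mult poly_add poly_mult by (simp add: pderiv_pCons distrib_left)
  then show ?case by (simp only: P_def image_mset_add_mset prod_mset.add_mset sum_mset.add_mset)
qed auto

text \<open>
  For nonreal \<open>z\<close> and real roots \<open>x\<close>, the imaginary parts of the terms \<open>1 / (z - x)\<close> of the
  logarithmic derivative all have the same sign.
\<close>
lemma pderiv_real_rooted: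
  fixes p :: "complex poly"
  assumes rr: "\<And>z. poly p z = 0 \<Longrightarrow> Im z = 0" and deg: "degree p > 0"
    and z: "poly (pderiv p) z = 0"
  shows "Im z = 0"
proof (rule ccontr)
  assume nz: "Im z \<noteq> 0"
  have "p \<noteq> 0" using deg by auto
  then obtain A where A: "size A = degree p" "p = smult (lead_coeff p) (\<Prod>x\<in>#A. [:-x, 1:])"
    using alg_closed_imp_factorization by blast
  have root: "poly p x = 0" if "x \<in># A" for x
    by (subst A) (use that in \<open>auto simp: poly_prod_mset\<close>)
  then have real: "Im x = 0" if "x \<in># A" for x using rr that by blast
  have "z \<notin># A" using nz real by auto
  define P where "P = (\<Prod>x\<in>#A. [:-x, 1:])"
  have p: "p = smult (lead_coeff p) P" using A P_def by simp
  have "poly P z \<noteq> 0" using rr[of z] nz p by (metis mult_zero_right poly_smult)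
  have "poly (pderiv p) z = lead_coeff p * (poly P z * (\<Sum>x\<in>#A. 1 / (z - x)))"
    by (subst p) (simp add: pderiv_smult pderiv_prod_linear[OF \<open>z \<notin># A\<close>] P_def)
  then have "(\<Sum>x\<in>#A. 1 / (z - x)) = 0"
    using z \<open>poly P z \<noteq> 0\<close> \<open>p \<noteq> 0\<close> by simp
  moreover have "Im (\<Sum>x\<in>#B. 1 / (z - x)) / Im z < 0" if "B \<noteq> {#}" "B \<subseteq># A" for B
    using that
  proof (induction B)
    case (add x B)
    have "Im x = 0" using add.prems real by (simp add: insert_subset_eq_iff)
    then have "Im (1 / (z - x)) = - Im z / (cmod (z - x))\<^sup>2"
      by (simp add: Im_divide cmod_power2)
    moreover have "cmod (z - x) > 0" using \<open>Im x = 0\<close> nz by auto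
    ultimately have "Im (1 / (z - x)) / Im z < 0"
      using nz by simp
    moreover have "Im (\<Sum>x\<in>#B. 1 / (z - x)) / Im z \<le> 0"
    proof (cases "B = {#}")
      case False
      have "B \<subseteq># A"
        using mset_subset_eq_insertD[OF add.prems(2)] by (auto simp: subset_mset.less_le)
      then show ?thesis using add.IH False by (simp add: less_imp_le)
    qed simp
    ultimately show ?case by (simp add: add_divide_distrib)
  qed auto
  ultimately show False
    using deg A(1) by (metis divide_eq_0_iff less_irrefl size_empty subset_mset.order_refl zero_complex.simps(2))
qed

lemma higher_pderiv_real_rooted:
  fixes p :: "complex poly"
  assumes "\<And>z. poly p z = 0 \<Longrightarrow> Im z = 0" and "m \<le> degree p"
    and "poly ((pderiv ^^ m) p) z = 0"
  shows "Im z = 0"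
  using assms(2,3)
proof (induction m arbitrary: z)
  case 0
  then show ?case using assms(1) by simp
next
  case (Suc m)
  show ?case
    by (rule pderiv_real_rooted[of "(pderiv ^^ m) p"])
       (use Suc in \<open>auto simp: degree_higher_pderiv\<close>)
qed

text \<open>As a polynomial in z, \<open>esigma k (mat z + cmat X)\<close> is, up to the factor (n -
  k)!, the derivative of order n - k of \<open>det (mat z + cmat X)\<close>. The latter has only
  real zeros, and differentiation preserves this.\<close>

lemma esigma_symmetric_hyperbolic:
  fixes X :: "real^'n::finite^'n"
  assumes sym: "transpose X = X" and z: "Im z \<noteq> 0" and k: "k \<le> CARD('n)"
  shows "esigma k (mat z + cmat X) \<noteq> 0"
proof
  assume 0: "esigma k (mat z + cmat X) = 0"
  let ?n = "CARD('n)"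
  define P where "P = (\<Sum>j\<le>?n. monom (esigma j (cmat X)) (?n - j))"
  define Q where "Q = (\<Sum>j\<le>k. monom (of_nat ((?n - j) choose (k - j)) * esigma j (cmat X)) (k - j))"
  have poly_P: "poly P z = det (mat z + cmat X)" for z
    by (simp add: P_def det_mat_plus poly_sum poly_monom mult.commute)
  have poly_Q: "poly Q z = esigma k (mat z + cmat X)" for z
    by (simp add: Q_def esigma_mat_plus poly_sum poly_monom mult_ac)
  have coeff_P: "coeff P i = (if i \<le> ?n then esigma (?n - i) (cmat X) else 0)" for i
  proof -
    have "coeff P i = (\<Sum>j\<le>?n. if j = ?n - i \<and> i \<le> ?n then esigma j (cmat X) else 0)"
      unfolding P_def coeff_sum by (rule sum.cong) auto
    then show ?thesis by (cases "i \<le> ?n") auto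
  qed
  have coeff_Q: "coeff Q i = (if i \<le> k then of_nat ((?n - (k - i)) choose i) * esigma (k - i) (cmat X) else 0)" for i
  proof -
    have "coeff Q i = (\<Sum>j\<le>k. if j = k - i \<and> i \<le> k then of_nat ((?n - j) choose (k - j)) * esigma j (cmat X) else 0)"
      unfolding Q_def coeff_sum by (rule sum.cong) auto
    then show ?thesis by (cases "i \<le> k") auto
  qed
  have "coeff ((pderiv ^^ (?n - k)) P) i = coeff (smult (fact (?n - k)) Q) i" for i
  proof (cases "i \<le> k")
    case True
    \<comment> \<open>The Pochhammer symbol is the factor produced by differentiating z^(i + n - k)
      exactly n - k times. It equals (n - k)! times the binomial coefficient in
      \<open>Q\<close>.\<close>
    have "(fact (i + (?n - k)) :: complex) = fact i * pochhammer (of_nat (Suc i)) (?n - k)"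
      by (simp add: pochhammer_fact pochhammer_product' add.commute)
    then have "(pochhammer (of_nat (Suc i)) (?n - k) :: complex) = fact (i + (?n - k)) / fact i"
      by (simp add: field_simps)
    also have "\<dots> = fact (?n - k) * of_nat ((i + (?n - k)) choose i)"
      by (simp add: binomial_fact)
    finally have "(pochhammer (of_nat (Suc i)) (?n - k) :: complex) = fact (?n - k) * of_nat ((i + (?n - k)) choose i)" .
    moreover have "?n - (i + (?n - k)) = k - i" "?n - (k - i) = i + (?n - k)" "i + (?n - k) \<le> ?n" using True k by auto
    ultimately show ?thesis
      unfolding coeff_higher_pderiv coeff_smult coeff_P coeff_Q using True by (simp only: if_True mult.assoc)
  qed (use k in \<open>auto simp: coeff_higher_pderiv coeff_P coeff_Q\<close>)
  then have "(pderiv ^^ (?n - k)) P = smult (fact (?n - k)) Q" by (simp add: poly_eq_iff)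
  then have root: "poly ((pderiv ^^ (?n - k)) P) z = 0" using 0 poly_Q by simp
  have "coeff P ?n \<noteq> 0" by (simp add: coeff_P)
  then have "?n \<le> degree P" by (rule le_degree)
  then have "Im z = 0"
    by (intro higher_pderiv_real_rooted[OF _ _ root])
       (use det_mat_plus_symmetric_nonzero[OF sym] poly_P in \<open>auto\<close>)
  then show False using z by simp
qed

section \<open>Zeros of matrix pencils in the upper half-plane\<close>

lemma linear_pencil_prod_poly:
  fixes a b :: "'i \<Rightarrow> 'a::comm_ring_1"
  assumes "finite I"
  shows "degree (\<Prod>i\<in>I. [:b i, a i:]) \<le> card I \<and> coeff (\<Prod>i\<in>I. [:b i, a i:]) (card I) = (\<Prod>i\<in>I. a i)"
  using assms
proof (induction I rule: finite_induct)
  case (insert x I)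
  let ?P = "\<Prod>i\<in>I. [:b i, a i:]"
  have "degree ([:b x, a x:] * ?P) \<le> degree [:b x, a x:] + degree ?P"
    by (rule degree_mult_le)
  also have "\<dots> \<le> Suc (card I)"
    using insert.IH by (auto intro: add_mono[of _ 1, simplified])
  finally show ?case using insert by (simp add: coeff_eq_0)
qed auto

text \<open>The leading coefficient does not involve \<open>M\<close>, so if
  \<open>esigma k A\<close> is nonzero the degree stays \<open>k\<close> while \<open>M\<close> is
  deformed.\<close>

lemma esigma_pencil_poly:
  fixes A M :: "'a::comm_ring_1^'n::finite^'n"
  obtains q where "degree q \<le> k" "coeff q k = esigma k A"
    "\<And>t. poly q t = esigma k (mscale t A + M)"
proof
  define q where "q = (\<Sum>I | card I = k. \<Sum>p | p permutes I.
      smult (of_int (sign p)) (\<Prod>i\<in>I. [:M $ i $ p i, A $ i $ p i:]))"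
  have deg: "degree (smult c (\<Prod>i\<in>I. [:M $ i $ p i, A $ i $ p i:])) \<le> card I" for c I p
    by (rule order_trans[OF degree_smult_le]) (use linear_pencil_prod_poly[of I "\<lambda>i. M $ i $ p i" "\<lambda>i. A $ i $ p i"] in auto)
  show "degree q \<le> k"
    unfolding q_def by (intro degree_sum_le) (use deg in \<open>auto simp: finite_permutations\<close>)
  show "coeff q k = esigma k A"
    unfolding q_def esigma_def pminor_def coeff_sum coeff_smult
    by (intro sum.cong refl) (auto simp: linear_pencil_prod_poly[THEN conjunct2])
  show "poly q t = esigma k (mscale t A + M)" for t
    by (simp add: q_def esigma_def pminor_def poly_sum poly_prod algebra_simps)
qed

lemma continuous_on_esigma [continuous_intros]:
  fixes F :: "'b::topological_space \<Rightarrow> 'a::real_normed_field^'n::finite^'n"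
  assumes "\<And>i j. continuous_on S (\<lambda>x. F x $ i $ j)"
  shows "continuous_on S (\<lambda>x. esigma k (F x))"
  unfolding esigma_def pminor_def by (intro continuous_intros assms)

lemma continuous_on_mat_nth:
  "continuous_on S f \<Longrightarrow> continuous_on S (\<lambda>x. mat (f x) $ i $ j)"
  by (cases "i = j") (simp_all add: mat_nth)

lemma tendsto_at_right_of_continuous:
  fixes f :: "real \<Rightarrow> 'a::topological_space"
  assumes "continuous_on UNIV f"
  shows "(f \<longlongrightarrow> f a) (at_right a)"
proof -
  have "isCont f a" using assms by (simp add: continuous_on_eq_continuous_at)
  then show ?thesis
    using tendsto_within_subset[OF _ subset_UNIV] unfolding isCont_def by blast
qed

text \<open>A root x in the closed lower half-plane has distance at least Im (t - x), hence at least
  Im t, from t. Multiply over the roots.\<close>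

lemma poly_lower_bound_upper_half_plane:
  fixes q :: "complex poly"
  assumes "q \<noteq> 0" and roots: "\<And>z. poly q z = 0 \<Longrightarrow> Im z \<le> 0" and t: "Im t > 0"
  shows "cmod (lead_coeff q) * Im t ^ degree q \<le> cmod (poly q t)"
proof -
  obtain A where A: "size A = degree q" "q = smult (lead_coeff q) (\<Prod>x\<in>#A. [:-x, 1:])"
    using alg_closed_imp_factorization[OF \<open>q \<noteq> 0\<close>] by blast
  have "poly q x = 0" if "x \<in># A" for x
    by (subst A) (use that in \<open>auto simp: poly_prod_mset\<close>)
  then have "Im x \<le> 0" if "x \<in># A" for x using roots that by blast
  then have "Im t ^ size A \<le> cmod (poly (\<Prod>x\<in>#A. [:-x, 1:]) t)"
  proof (induction A)
    case (add x A)
    have "Im t \<le> Im (t - x)" using add.prems[of x] by simp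
    also have "\<dots> \<le> cmod (t - x)" using abs_Im_le_cmod[of "t - x"] by linarith
    finally have "Im t * Im t ^ size A \<le> cmod (t - x) * cmod (poly (\<Prod>x\<in>#A. [:-x, 1:]) t)"
      using add t by (intro mult_mono) auto
    also have "\<dots> = cmod (poly (\<Prod>x\<in>#add_mset x A. [:-x, 1:]) t)"
      by (simp add: norm_mult[symmetric] algebra_simps)
    finally show ?case by simp
  qed auto
  then have "cmod (lead_coeff q) * Im t ^ size A \<le> cmod (lead_coeff q) * cmod (poly (\<Prod>x\<in>#A. [:-x, 1:]) t)"
    by (intro mult_left_mono) auto
  also have "\<dots> = cmod (poly q t)" by (subst (3) A) (simp add: norm_mult)
  finally show ?thesis using A by simp
qed

text \<open>Turns the absence of zeros into an inequality with a bound independent of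
  \<open>M\<close>, hence into a condition that survives limits in \<open>M\<close>.\<close>

lemma esigma_pencil_lower_bound:
  fixes A M :: "complex^'n::finite^'n"
  assumes "esigma k A \<noteq> 0"
    and zf: "\<And>t. Im t > 0 \<Longrightarrow> esigma k (mscale t A + M) \<noteq> 0" and t: "Im t > 0"
  shows "cmod (esigma k A) * Im t ^ k \<le> cmod (esigma k (mscale t A + M))"
proof -
  obtain q where q: "degree q \<le> k" "coeff q k = esigma k A"
    "\<And>t. poly q t = esigma k (mscale t A + M)"
    using esigma_pencil_poly by blast
  have "degree q = k" using q assms(1) by (metis le_antisym le_degree)
  then have "cmod (lead_coeff q) * Im t ^ degree q \<le> cmod (poly q t)"
    using q assms by (intro poly_lower_bound_upper_half_plane) (auto simp: not_less[symmetric])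
  then show ?thesis using q \<open>degree q = k\<close> by simp
qed

text \<open>
  Roots depend continuously on the parameter and never cross the real axis, so they stay in the
  lower half-plane. Instead of tracking roots, both the set of parameters with a root in the
  upper half-plane and its complement are shown to be closed.
\<close>
lemma esigma_pencil_deformation:
  fixes A :: "complex^'n::finite^'n" and M :: "real \<Rightarrow> complex^'n^'n"
  assumes A: "esigma k A \<noteq> 0"
    and cont: "\<And>i j. continuous_on {0..1} (\<lambda>\<mu>. M \<mu> $ i $ j)"
    and real: "\<And>\<mu> t. \<mu> \<in> {0..1} \<Longrightarrow> Im t = 0 \<Longrightarrow> esigma k (mscale t A + M \<mu>) \<noteq> 0"
    and start: "\<And>t. Im t > 0 \<Longrightarrow> esigma k (mscale t A + M 0) \<noteq> 0"
    and t: "Im t > 0"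
  shows "esigma k (mscale t A + M 1) \<noteq> 0"
proof -
  define B where "B = {\<mu>\<in>{0..1}. \<exists>t. Im t > 0 \<and> esigma k (mscale t A + M \<mu>) = 0}"
  define G where "G = {0..1} - B"
  have cont_g: "continuous_on {0..1} (\<lambda>\<mu>. cmod (esigma k (mscale t A + M \<mu>)))" for t
    by (rule continuous_on_norm, rule continuous_on_esigma)
      (auto intro!: continuous_on_add continuous_on_const cont)
  \<comment> \<open>By the lower bound, \<open>G\<close> is cut out by nonstrict inequalities
    between continuous functions, hence closed.\<close>
  have "G = (\<Inter>t\<in>{t. Im t > 0}. {\<mu>\<in>{0..1}. cmod (esigma k A) * Im t ^ k \<le> cmod (esigma k (mscale t A + M \<mu>))})"
    (is "_ = ?R")
  proof (intro equalityI subsetI)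
    fix \<mu> assume "\<mu> \<in> G"
    then show "\<mu> \<in> ?R"
      using esigma_pencil_lower_bound[OF A, of "M \<mu>"] by (auto simp: G_def B_def)
  next
    fix \<mu> assume R: "\<mu> \<in> ?R"
    have pos: "0 < cmod (esigma k A) * Im t ^ k" if "Im t > 0" for t
      using A that by simp
    have "Im \<i> > 0" by simp
    then have "\<mu> \<in> {0..1}" using R by blast
    moreover have "esigma k (mscale t A + M \<mu>) \<noteq> 0" if "Im t > 0" for t
      using R pos[OF that] that by fastforce
    ultimately show "\<mu> \<in> G" by (auto simp: G_def B_def)
  qed
  moreover have "closed {\<mu>\<in>{0..1}. cmod (esigma k A) * Im t ^ k \<le> cmod (esigma k (mscale t A + M \<mu>))}" for t
    using continuous_closed_preimage[OF cont_g[of t], of "{cmod (esigma k A) * Im t ^ k..}"]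
    by (simp add: vimage_def Int_def)
  ultimately have "closed G" by auto

  \<comment> \<open>Closedness of \<open>B\<close> needs compactness, but t ranges over an unbounded
    half-plane. Homogenising the pencil to t A + s M and normalising (s, t) to the unit sphere makes
    the parameter space compact, with s = 0 as the points at infinity.\<close>
  define S where "S = {p :: real \<times> complex. 0 \<le> fst p \<and> 0 \<le> Im (snd p) \<and> norm p = 1}"
  define Z where "Z = {p \<in> {0..1} \<times> S. esigma k (mscale (snd (snd p)) A + mscale (of_real (fst (snd p))) (M (fst p))) = 0}"
  have "compact S"
  proof -
    have "closed {p :: real \<times> complex. 0 \<le> fst p \<and> 0 \<le> Im (snd p)}"
      by (intro closed_Collect_conj closed_Collect_le continuous_intros)
    then have "compact (sphere 0 1 \<inter> {p :: real \<times> complex. 0 \<le> fst p \<and> 0 \<le> Im (snd p)})"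
      by (intro compact_Int_closed) auto
    moreover have "S = sphere 0 1 \<inter> {p. 0 \<le> fst p \<and> 0 \<le> Im (snd p)}"
      by (auto simp: S_def)
    ultimately show ?thesis by simp
  qed
  have contM: "continuous_on ({0..1} \<times> S) (\<lambda>p. M (fst p) $ i $ j)" for i j
    by (rule continuous_on_compose2[OF cont]) (auto intro!: continuous_intros)
  have "continuous_on ({0..1} \<times> S) (\<lambda>p. esigma k (mscale (snd (snd p)) A + mscale (of_real (fst (snd p))) (M (fst p))))"
    by (rule continuous_on_esigma)
      (auto intro!: continuous_on_add continuous_on_mult continuous_on_of_real continuous_on_snd
        continuous_on_fst continuous_on_const continuous_on_id contM)
  then have "closedin (top_of_set ({0..1} \<times> S)) Z"
    unfolding Z_def by (rule continuous_closedin_preimage_constant)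
  then have "compact Z"
    using \<open>compact S\<close> by (metis closedin_compact compact_Times compact_Icc)
  moreover have "B = fst ` Z"
  proof (intro equalityI subsetI)
    fix \<mu> assume "\<mu> \<in> B"
    then obtain t where t: "\<mu> \<in> {0..1}" "Im t > 0" "esigma k (mscale t A + M \<mu>) = 0"
      by (auto simp: B_def)
    define r where "r = 1 / norm (1 :: real, t)"
    have "r > 0" by (simp add: r_def norm_Pair add_pos_nonneg)
    have "norm (r *\<^sub>R (1 :: real, t)) = 1"
      unfolding norm_scaleR using \<open>r > 0\<close> by (simp add: r_def)
    then have "(r, of_real r * t) \<in> S"
      using \<open>r > 0\<close> t by (simp add: S_def scaleR_conv_of_real)
    moreover have "mscale (of_real r * t) A + mscale (of_real r) (M \<mu>) = mscale (of_real r) (mscale t A + M \<mu>)"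
      by (simp add: vec_eq_iff algebra_simps)
    ultimately have "(\<mu>, r, of_real r * t) \<in> Z"
      using t by (simp add: Z_def esigma_mscale)
    then show "\<mu> \<in> fst ` Z" by force
  next
    fix \<mu> assume "\<mu> \<in> fst ` Z"
    then obtain s t where st: "\<mu> \<in> {0..1}" "0 \<le> s" "0 \<le> Im t" "norm (s, t) = 1"
      and 0: "esigma k (mscale t A + mscale (of_real s) (M \<mu>)) = 0"
      by (auto simp: Z_def S_def)
    \<comment> \<open>A zero at infinity would be a zero of t^k times the nonzero leading
      coefficient.\<close>
    have "s \<noteq> 0"
    proof
      assume "s = 0"
      then have "mscale t A + mscale (of_real s) (M \<mu>) = mscale t A" by (simp add: vec_eq_iff)
      then have "t ^ k * esigma k A = 0" using 0 by (simp add: esigma_mscale)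
      then have "t = 0" using A by simp
      then show False using st \<open>s = 0\<close> by simp
    qed
    then have "mscale t A + mscale (of_real s) (M \<mu>) = mscale (of_real s) (mscale (t / of_real s) A + M \<mu>)"
      by (simp add: vec_eq_iff algebra_simps)
    then have "esigma k (mscale (t / of_real s) A + M \<mu>) = 0"
      using 0 \<open>s \<noteq> 0\<close> by (simp add: esigma_mscale)
    moreover have "Im (t / of_real s) \<ge> 0" using st \<open>s \<noteq> 0\<close> by simp
    \<comment> \<open>The closed half-plane adds only real parameters to the open one, and these are
      excluded by the hypothesis \<open>real\<close>.\<close>
    moreover have "Im (t / of_real s) \<noteq> 0" using real[OF st(1)] calculation(1) by blast
    ultimately have "Im (t / of_real s) > 0" by linarith
    then show "\<mu> \<in> B"
      using st(1) \<open>esigma k (mscale (t / of_real s) A + M \<mu>) = 0\<close> unfolding B_def by blast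
  qed
  ultimately have "closed B"
    using compact_imp_closed[OF compact_continuous_image[of Z fst]] by (simp add: continuous_on_fst)
  have "B = {}"
  proof (rule ccontr)
    assume "B \<noteq> {}"
    then have "B \<inter> {0..1} \<noteq> {}" by (auto simp: B_def)
    moreover have "0 \<in> G" using start by (auto simp: G_def B_def)
    then have "G \<inter> {0..1} \<noteq> {}" by force
    moreover have "{0..1} \<subseteq> B \<union> G" "B \<inter> G \<inter> {0..1} = {}"
      unfolding G_def by blast+
    moreover have "connected {0..1::real}" by simp
    ultimately show False
      using \<open>closed B\<close> \<open>closed G\<close> unfolding connected_closed by blast
  qed
  then show ?thesis using t by (auto simp: B_def)
qed


text \<open>For real t this is hyperbolicity, as the remaining matrix i s I has nonreal diagonal.
  For Im t > 0 shrink \<open>X\<close> to 0. What is left is t (A + z I) with z = i s / t; it is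
  nonzero by hyperbolicity if z is nonreal, and otherwise z > 0 and the expansion in powers of z has
  positive terms.\<close>

lemma symmetric_pencil_nonzero:
  fixes A X :: "real^'n::finite^'n"
  assumes k: "0 < k" "k \<le> CARD('n)" and symA: "transpose A = A" and symX: "transpose X = X"
    and pos: "\<And>j. j \<le> k \<Longrightarrow> esigma j A > 0"
    and s: "s > 0" and t: "Im t \<ge> 0"
  shows "esigma k (mscale t (cmat A) + (cmat X + mat (\<i> * of_real s))) \<noteq> 0"
proof (cases "Im t = 0")
  case True
  then have "t = of_real (Re t)" by (simp add: complex_eq_iff)
  then have eq: "mscale t (cmat A) + (cmat X + mat (\<i> * of_real s)) = mat (\<i> * of_real s) + cmat (Re t *\<^sub>R A + X)"
    by (simp add: vec_eq_iff)
  have "transpose (Re t *\<^sub>R A + X) = Re t *\<^sub>R A + X"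
    using symA symX by (simp add: transpose_def vec_eq_iff)
  then show ?thesis
    unfolding eq using k s by (intro esigma_symmetric_hyperbolic) auto
next
  case False
  define M where "M \<mu> = mscale (of_real \<mu>) (cmat X) + mat (\<i> * of_real s)" for \<mu>
  have "esigma k (mscale t (cmat A) + M 1) \<noteq> 0"
  proof (rule esigma_pencil_deformation)
    show "esigma k (cmat A) \<noteq> 0" using pos[of k] by (simp add: esigma_cmat)
    show "continuous_on {0..1} (\<lambda>\<mu>. M \<mu> $ i $ j)" for i j
      by (auto simp: M_def mat_nth intro!: continuous_intros)
    show "Im t > 0" using False t by simp
  next
    fix \<mu> :: real and t :: complex assume "Im t = 0"
    then have "t = of_real (Re t)" by (simp add: complex_eq_iff)
    then have "mscale t (cmat A) + M \<mu> = mat (\<i> * of_real s) + cmat (Re t *\<^sub>R A + \<mu> *\<^sub>R X)"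
      by (simp add: vec_eq_iff M_def)
    moreover have "transpose (Re t *\<^sub>R A + \<mu> *\<^sub>R X) = Re t *\<^sub>R A + \<mu> *\<^sub>R X"
      using symA symX by (simp add: transpose_def vec_eq_iff)
    ultimately show "esigma k (mscale t (cmat A) + M \<mu>) \<noteq> 0"
      using esigma_symmetric_hyperbolic[of "Re t *\<^sub>R A + \<mu> *\<^sub>R X" "\<i> * of_real s" k] k s by simp
  next
    fix t :: complex assume t: "Im t > 0"
    then have "t \<noteq> 0" by auto
    define z where "z = \<i> * of_real s / t"
    have "mscale t (cmat A) + M 0 = mscale t (mat z + cmat A)"
      using \<open>t \<noteq> 0\<close> by (simp add: vec_eq_iff M_def z_def mat_nth algebra_simps)
    moreover have "esigma k (mat z + cmat A) \<noteq> 0"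
    proof (cases "Im z = 0")
      case False
      then show ?thesis using esigma_symmetric_hyperbolic[OF symA] k by simp
    next
      case True
      define x where "x = Re z"
      have z: "z = of_real x" using True by (simp add: x_def complex_eq_iff)
      have "\<i> * of_real s = of_real x * t" using \<open>t \<noteq> 0\<close> z by (simp add: z_def field_simps)
      then have "Im (\<i> * of_real s) = Im (of_real x * t)" by simp
      then have "s = x * Im t" by simp
      then have "x > 0" using s t by (simp add: zero_less_mult_iff)
      have "mat z + cmat A = cmat (mat x + A)" by (simp add: vec_eq_iff z mat_nth)
      moreover have "esigma k (mat x + A) > 0"
        unfolding esigma_mat_plus
        by (rule sum_pos) (use \<open>x > 0\<close> pos k in auto)
      ultimately show ?thesis by (simp add: esigma_cmat)
    qed
    ultimately show "esigma k (mscale t (cmat A) + M 0) \<noteq> 0"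
      using \<open>t \<noteq> 0\<close> by (simp add: esigma_mscale)
  qed
  moreover have "M 1 = cmat X + mat (\<i> * of_real s)" by (simp add: M_def vec_eq_iff)
  ultimately show ?thesis by simp
qed

text \<open>Deform t A + i \<mu> B + i s I from \<mu> = 0 to \<mu> = 1. For real t the previous
  lemma applies with \<open>B\<close> in the role of \<open>A\<close> and t A in the role of
  \<open>X\<close>. At t = i and \<mu> = 1 the matrix is i (A + B + s I).\<close>

lemma esigma_add_nonzero:
  fixes A B :: "real^'n::finite^'n"
  assumes k: "0 < k" "k \<le> CARD('n)" and symA: "transpose A = A" and symB: "transpose B = B"
    and posA: "\<And>j. j \<le> k \<Longrightarrow> esigma j A > 0" and posB: "\<And>j. j \<le> k \<Longrightarrow> esigma j B > 0"
    and s: "s > 0"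
  shows "esigma k (A + B + mat s) \<noteq> 0"
proof -
  define M where "M \<mu> = mscale (\<i> * of_real \<mu>) (cmat B) + mat (\<i> * of_real s)" for \<mu>
  have "esigma k (mscale \<i> (cmat A) + M 1) \<noteq> 0"
  proof (rule esigma_pencil_deformation)
    show "esigma k (cmat A) \<noteq> 0" using posA[of k] by (simp add: esigma_cmat)
    show "continuous_on {0..1} (\<lambda>\<mu>. M \<mu> $ i $ j)" for i j
      by (auto simp: M_def mat_nth intro!: continuous_intros)
  next
    fix \<mu> :: real and t :: complex assume "\<mu> \<in> {0..1}" "Im t = 0"
    then have t: "t = of_real (Re t)" and "\<mu> \<ge> 0" by (auto simp: complex_eq_iff)
    have "mscale t (cmat A) + M \<mu> =
        mscale (\<i> * of_real \<mu>) (cmat B) + (cmat (Re t *\<^sub>R A) + mat (\<i> * of_real s))"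
      by (subst t) (simp add: vec_eq_iff M_def)
    moreover have "transpose (Re t *\<^sub>R A) = Re t *\<^sub>R A"
      using symA by (simp add: transpose_def vec_eq_iff)
    ultimately show "esigma k (mscale t (cmat A) + M \<mu>) \<noteq> 0"
      using symmetric_pencil_nonzero[OF k symB _ posB s, of "Re t *\<^sub>R A" "\<i> * of_real \<mu>"] \<open>\<mu> \<ge> 0\<close> by simp
  next
    fix t :: complex assume "Im t > 0"
    moreover have "M 0 = cmat 0 + mat (\<i> * of_real s)" by (simp add: M_def vec_eq_iff)
    moreover have "transpose (0 :: real^'n^'n) = 0" by (simp add: transpose_def vec_eq_iff)
    ultimately show "esigma k (mscale t (cmat A) + M 0) \<noteq> 0"
      using symmetric_pencil_nonzero[OF k symA _ posA s, of 0 t] by simp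
  qed simp
  moreover have "mscale \<i> (cmat A) + M 1 = mscale \<i> (cmat (A + B + mat s))"
    by (simp add: vec_eq_iff M_def mat_nth algebra_simps)
  ultimately show ?thesis by (simp add: esigma_mscale esigma_cmat)
qed

section \<open>Convexity of the Garding cone\<close>

text \<open>The cone in its closed form, matching the nonstrict inequalities of H_k-subharmonicity.
  For \<open>k = 0\<close> it consists of all symmetric matrices.\<close>

definition garding_cone :: "nat \<Rightarrow> (real^'n::finite^'n) set" where
  "garding_cone k = {A. transpose A = A \<and> (\<forall>j\<in>{1..k}. esigma j A \<ge> 0)}"

text \<open>As a function of the shift, the value has no zero on [s, \<infinity>) by
  \<open>esigma_add_nonzero\<close> and is positive for large shifts, so it is positive at
  \<open>s\<close> by the intermediate value theorem.\<close>

lemma esigma_add_nonneg_open: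
  fixes A B :: "real^'n::finite^'n"
  assumes k: "0 < k" "k \<le> CARD('n)" and symA: "transpose A = A" and symB: "transpose B = B"
    and posA: "\<And>j. j \<le> k \<Longrightarrow> esigma j A > 0" and posB: "\<And>j. j \<le> k \<Longrightarrow> esigma j B > 0"
    and s: "s > 0"
  shows "esigma k (A + B + mat s) > 0"
proof (rule ccontr)
  assume neg: "\<not> esigma k (A + B + mat s) > 0"
  define f where "f x = esigma k (A + B + mat x)" for x
  have cont: "continuous_on UNIV f"
    unfolding f_def by (rule continuous_on_esigma)
      (auto intro!: continuous_on_add continuous_on_mult continuous_on_const continuous_on_id continuous_on_mat_nth)
  \<comment> \<open>Large shifts are reached through e = 1 / x, because the rescaled value tends to
    \<open>esigma k (mat 1)\<close> as e tends to 0.\<close>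
  have scaled: "f (1 / e) * e ^ k = esigma k (mat 1 + e *\<^sub>R (A + B))" if "e > 0" for e
  proof -
    have "mat 1 + e *\<^sub>R (A + B) = mscale e (A + B + mat (1 / e))"
      using that by (simp add: vec_eq_iff mat_nth algebra_simps)
    then show ?thesis by (simp add: f_def esigma_mscale mult.commute)
  qed
  have "continuous_on UNIV (\<lambda>e. esigma k (mat 1 + e *\<^sub>R (A + B)))"
    by (rule continuous_on_esigma)
      (auto intro!: continuous_on_add continuous_on_mult continuous_on_const continuous_on_id continuous_on_mat_nth)
  then have "((\<lambda>e. esigma k (mat 1 + e *\<^sub>R (A + B))) \<longlongrightarrow> esigma k (mat 1 + 0 *\<^sub>R (A + B))) (at_right 0)"
    by (rule tendsto_at_right_of_continuous)
  moreover have "esigma k (mat 1 + 0 *\<^sub>R (A + B)) > 0"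
  proof -
    have "esigma j (0 :: real^'n^'n) = 0" if "j > 0" for j
    proof -
      have "esigma j (0 :: real^'n^'n) = esigma j (mscale 0 (0 :: real^'n^'n))" by (rule arg_cong[of _ _ "esigma j"]) (simp add: vec_eq_iff)
      also have "\<dots> = 0" using that by (simp add: esigma_mscale power_0_left)
      finally show ?thesis .
    qed
    then have "esigma k (mat 1 + (0 :: real^'n^'n)) = (\<Sum>j\<le>k. if j = 0 then of_nat (CARD('n) choose k) else 0)"
      unfolding esigma_mat_plus by (intro sum.cong) auto
    then show ?thesis using k by simp
  qed
  ultimately have "eventually (\<lambda>e. esigma k (mat 1 + e *\<^sub>R (A + B)) > 0) (at_right 0)"
    by (rule order_tendstoD)
  moreover have "eventually (\<lambda>e. e < 1 / s) (at_right 0)"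
    using s by (intro eventually_at_rightI[of 0 "1 / s"]) auto
  ultimately have "eventually (\<lambda>e. e > 0 \<and> e < 1 / s \<and> esigma k (mat 1 + e *\<^sub>R (A + B)) > 0) (at_right 0)"
    using eventually_at_right_less[of 0] by eventually_elim auto
  then obtain e where e: "e > 0" "e < 1 / s" "esigma k (mat 1 + e *\<^sub>R (A + B)) > 0"
    using eventually_happens trivial_limit_at_right_real by blast
  then have "f (1 / e) > 0" using scaled[of e] by (metis zero_less_mult_pos2 zero_less_power)
  moreover have "s \<le> 1 / e" using e s by (simp add: field_simps)
  ultimately obtain x where "s \<le> x" "f x = 0"
    using IVT'[of f s 0 "1 / e"] neg cont by (auto simp: f_def not_less intro: continuous_on_subset)
  then show False using esigma_add_nonzero[OF k symA symB posA posB, of x] s by (simp add: f_def)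
qed

text \<open>Shift by multiples of the identity to obtain strict inequalities, add, and let the shift
  tend to 0.\<close>

lemma garding_cone_add:
  fixes A B :: "real^'n::finite^'n"
  assumes k: "k \<le> CARD('n)" and A: "A \<in> garding_cone k" and B: "B \<in> garding_cone k"
  shows "A + B \<in> garding_cone k"
proof -
  have sym: "transpose A = A" "transpose B = B" using A B by (auto simp: garding_cone_def)
  \<comment> \<open>In the expansion in powers of \<open>e\<close> the term of index 0 is positive
    and the other terms are nonnegative.\<close>
  have pos: "esigma j (mat e + C) > 0" if "C \<in> garding_cone k" "e > 0" "j \<le> k" for C :: "real^'n^'n" and e j
  proof -
    have "0 < of_nat ((CARD('n) - 0) choose (j - 0)) * e ^ (j - 0) * esigma 0 C"
      using that k by simp
    also have "\<dots> \<le> esigma j (mat e + C)"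
      unfolding esigma_mat_plus
    proof (rule member_le_sum)
      fix i assume "i \<in> {..j} - {0}"
      then show "0 \<le> of_nat ((CARD('n) - i) choose (j - i)) * e ^ (j - i) * esigma i C"
        using that by (auto simp: garding_cone_def)
    qed auto
    finally show ?thesis .
  qed
  have sym': "transpose (mat e + C) = mat e + C" if "transpose C = C" for C :: "real^'n^'n" and e
    using that by (auto simp: transpose_def vec_eq_iff mat_nth)
  have "esigma j (A + B) \<ge> 0" if j: "j \<in> {1..k}" for j
  proof -
    \<comment> \<open>One \<open>e\<close> makes \<open>A\<close> strict, one makes \<open>B\<close>
      strict, and the third is the shift that \<open>esigma_add_nonneg_open\<close>
      requires.\<close>
    have *: "esigma j (A + B + mat (3 * e)) > 0" if "e > 0" for e
    proof -
      have "esigma j ((mat e + A) + (mat e + B) + mat e) > 0"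
        by (rule esigma_add_nonneg_open) (use j k sym sym' pos A B that in auto)
      moreover have eq: "(mat e + A) + (mat e + B) + mat e = A + B + mat (3 * e)"
        by (simp add: vec_eq_iff mat_nth)
      ultimately show ?thesis by (simp only: eq)
    qed
    have "continuous_on UNIV (\<lambda>e. esigma j (A + B + mat (3 * e)))"
      by (rule continuous_on_esigma)
      (auto intro!: continuous_on_add continuous_on_mult continuous_on_const continuous_on_id continuous_on_mat_nth)
    then have "((\<lambda>e. esigma j (A + B + mat (3 * e))) \<longlongrightarrow> esigma j (A + B + mat (3 * 0))) (at_right 0)"
      by (rule tendsto_at_right_of_continuous)
    moreover have "eventually (\<lambda>e. esigma j (A + B + mat (3 * e)) \<ge> 0) (at_right 0)"
      using eventually_at_right_less[of 0] by eventually_elim (use * in \<open>auto intro: less_imp_le\<close>)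
    ultimately have "esigma j (A + B + mat (3 * 0)) \<ge> 0"
      by (rule tendsto_lowerbound) auto
    moreover have "A + B + mat (3 * 0) = A + B" by (simp add: vec_eq_iff mat_nth)
    ultimately show ?thesis by simp
  qed
  then show ?thesis using sym by (auto simp: garding_cone_def transpose_def vec_eq_iff)
qed

section \<open>The curvature operator along a line of gradients\<close>

declare transpose_matrix_vector [simp del]

definition slope :: "real^'n::finite \<Rightarrow> real" where
  "slope q = sqrt (1 + (norm q)\<^sup>2)"

text \<open>The Jacobian of \<open>q \<mapsto> q / slope q\<close>.\<close>
definition gmat :: "real^'n::finite \<Rightarrow> real^'n^'n" where
  "gmat q = (\<chi> i j. (if i = j then 1 / slope q else 0) - q $ i * q $ j / slope q ^ 3)"

lemma slope_pos [simp]: "slope q > 0"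
  by (simp add: slope_def add_pos_nonneg)

lemma slope_power2: "(slope q)\<^sup>2 = 1 + (norm q)\<^sup>2"
  by (simp add: slope_def)

lemma gmat_mult_vec: "gmat q *v x = (1 / slope q) *\<^sub>R x - ((q \<bullet> x) / slope q ^ 3) *\<^sub>R q"
proof -
  have "(gmat q *v x) $ i = (\<Sum>j\<in>UNIV. (if i = j then x $ j / slope q else 0) - q $ i / slope q ^ 3 * (q $ j * x $ j))" for i
    unfolding gmat_def matrix_vector_mult_def by (simp, intro sum.cong) (auto simp: algebra_simps)
  then show ?thesis
    by (simp add: vec_eq_iff sum_subtractf inner_vec_def sum_distrib_left[symmetric] sum_divide_distrib[symmetric])
qed

lemma gmat_invertible: "invertible (gmat q)"
proof -
  have "x = 0" if "gmat q *v x = 0" for x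
  proof -
    have x: "x = ((q \<bullet> x) / (slope q)\<^sup>2) *\<^sub>R q"
    proof -
      have "slope q *\<^sub>R ((1 / slope q) *\<^sub>R x) = slope q *\<^sub>R (((q \<bullet> x) / slope q ^ 3) *\<^sub>R q)"
        using that by (simp add: gmat_mult_vec)
      then show ?thesis by (simp add: power3_eq_cube power2_eq_square less_imp_neq[OF slope_pos, symmetric])
    qed
    then have "q \<bullet> x = (q \<bullet> x) / (slope q)\<^sup>2 * (norm q)\<^sup>2"
      by (metis inner_scaleR_right power2_norm_eq_inner)
    then have "(q \<bullet> x) * (slope q)\<^sup>2 = (q \<bullet> x) * (norm q)\<^sup>2"
      by (simp add: field_simps less_imp_neq[OF slope_pos, symmetric])
    then have "q \<bullet> x = 0" by (simp add: slope_power2)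
    then show ?thesis using x by simp
  qed
  then show ?thesis
    by (metis invertible_left_inverse matrix_left_invertible_ker)
qed

text \<open>
  Along a line with direction \<open>\<xi>\<close>, the factor \<open>N\<close> of \<open>gmat\<close> on the hyperplane orthogonal to
  \<open>\<xi>\<close> does not depend on the point, up to the scalar slope.
\<close>
lemma gmat_factor_along_line:
  fixes \<xi> p :: "real^'n::finite" and a :: 'n
  assumes "\<xi> \<noteq> 0"
  obtains N :: "real^'n^'n" where "\<And>i. N $ i $ a = 0" "transpose N *v \<xi> = 0"
    "\<And>q t. q = p + t *\<^sub>R \<xi> \<Longrightarrow>
       \<exists>m. \<forall>x. gmat q *v x = (1 / slope q) *\<^sub>R ((N ** transpose N) *v x) + (m \<bullet> x) *\<^sub>R m"
proof -
  define e where "e = \<xi> /\<^sub>R norm \<xi>"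
  have norm_e: "norm e = 1" using assms by (simp add: e_def)
  then have ee: "e \<bullet> e = 1" by (simp add: norm_eq_1)
  have \<xi>: "\<xi> = norm \<xi> *\<^sub>R e" using assms by (simp add: e_def)
  \<comment> \<open>The component orthogonal to \<open>\<xi>\<close>, common to all points of the
    line; these differ only in their component along \<open>e\<close>.\<close>
  define b where "b = p - (p \<bullet> e) *\<^sub>R e"
  have be: "b \<bullet> e = 0" by (simp add: b_def inner_diff_left ee)
  define \<rho> where "\<rho> = sqrt (1 + b \<bullet> b)"
  have \<rho>: "\<rho> > 0" "\<rho>\<^sup>2 = 1 + b \<bullet> b" by (simp_all add: \<rho>_def add_pos_nonneg)
  \<comment> \<open>With this choice \<open>f\<close> is the square root of the form I - b b^T /
    \<rho>^2 - e e^T: in the direction of \<open>b\<close> its eigenvalue 1 - \<beta> |b|^2 equals 1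
    / \<rho>, and the square of this is 1 - |b|^2 / \<rho>^2.\<close>
  define \<beta> where "\<beta> = 1 / (\<rho> * (1 + \<rho>))"
  define f where "f x = x - (\<beta> * (b \<bullet> x)) *\<^sub>R b - (e \<bullet> x) *\<^sub>R e" for x
  have lin: "linear f"
    by (rule linearI) (simp_all add: f_def inner_add_right algebra_simps)
  have sym: "f x \<bullet> y = x \<bullet> f y" for x y
    by (simp add: f_def inner_diff_left inner_diff_right inner_commute)
  have beta: "2 * \<beta> - \<beta>\<^sup>2 * (b \<bullet> b) = 1 / \<rho>\<^sup>2"
  proof -
    have bb: "b \<bullet> b = (\<rho> - 1) * (1 + \<rho>)" using \<rho> by (simp add: algebra_simps power2_eq_square)
    have "1 + \<rho> > 0" using \<rho> by simp
    have "\<beta>\<^sup>2 * (b \<bullet> b) = (\<rho> - 1) / (\<rho>\<^sup>2 * (1 + \<rho>))"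
      unfolding bb \<beta>_def using \<rho>(1) \<open>1 + \<rho> > 0\<close> by (simp add: divide_simps) (simp add: algebra_simps power2_eq_square)
    moreover have "2 * \<beta> = 2 * \<rho> / (\<rho>\<^sup>2 * (1 + \<rho>))"
      unfolding \<beta>_def using \<rho>(1) by (simp add: power2_eq_square)
    ultimately have "2 * \<beta> - \<beta>\<^sup>2 * (b \<bullet> b) = (1 + \<rho>) / (\<rho>\<^sup>2 * (1 + \<rho>))"
      by (simp only: diff_divide_distrib[symmetric]) (simp add: algebra_simps)
    also have "\<dots> = 1 / \<rho>\<^sup>2" using \<open>1 + \<rho> > 0\<close> by simp
    finally show ?thesis .
  qed
  have ff: "f (f x) = x - ((b \<bullet> x) / \<rho>\<^sup>2) *\<^sub>R b - (e \<bullet> x) *\<^sub>R e" for x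
  proof -
    have "f (f x) = x - ((b \<bullet> x) * (2 * \<beta> - \<beta>\<^sup>2 * (b \<bullet> b))) *\<^sub>R b - (e \<bullet> x) *\<^sub>R e"
      using be by (simp add: f_def inner_diff_right inner_commute[of e b] ee vec_eq_iff algebra_simps power2_eq_square)
    then show ?thesis by (simp add: beta)
  qed
  \<comment> \<open>\<open>f\<close> annihilates \<open>e\<close>. Precomposing it with an
    orthogonal map that takes the \<open>a\<close>-th basis vector to \<open>e\<close> turns this
    into a vanishing column \<open>a\<close>.\<close>
  have "\<exists>U :: real^'n \<Rightarrow> real^'n. orthogonal_transformation U \<and> U (axis a 1) = e"
  proof (rule orthogonal_transformation_exists_1[OF norm_axis_1[of a] norm_e])
    fix V :: "real^'n \<Rightarrow> real^'n" assume V: "orthogonal_transformation V" "V (axis a 1) = e"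
    show "\<exists>U :: real^'n \<Rightarrow> real^'n. orthogonal_transformation U \<and> U (axis a 1) = e"
      by (rule exI[of _ V], rule conjI[OF V])
  qed
  then obtain U :: "real^'n \<Rightarrow> real^'n" where U: "orthogonal_transformation U" "U (axis a 1) = e"
    by (elim exE conjE)
  have linU: "linear U" using U by (simp add: orthogonal_transformation_linear)
  define N where "N = matrix f ** matrix U"
  have fe: "f e = 0" by (simp add: f_def ee be)
  have Nv: "N *v x = f (U x)" for x
    by (simp add: N_def matrix_vector_mul_assoc[symmetric] lin linU matrix_works)
  have trf: "transpose (matrix f) = matrix f"
  proof -
    have "matrix f $ i $ j = matrix f $ j $ i" for i j
      using sym[of "axis j 1" "axis i 1"]
      by (simp add: matrix_def inner_axis inner_axis' )
    then show ?thesis by (simp add: transpose_def vec_eq_iff)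
  qed
  have NN: "(N ** transpose N) *v x = f (f x)" for x
  proof -
    have "matrix U ** transpose (matrix U) = mat 1"
      using U(1) by (simp add: orthogonal_transformation_matrix orthogonal_matrix_def)
    then have "N ** transpose N = matrix f ** matrix f"
      by (simp add: N_def matrix_transpose_mul trf matrix_mul_assoc[symmetric])
        (simp add: matrix_mul_assoc)
    then show ?thesis by (simp add: matrix_vector_mul_assoc[symmetric] lin matrix_works)
  qed
  show ?thesis
  proof
    show "N $ i $ a = 0" for i
    proof -
      have "N $ i $ a = (N *v axis a 1) $ i" by (simp add: matrix_vector_mul_component inner_axis)
      then show ?thesis by (simp add: Nv U fe)
    qed
    have "f \<xi> = 0" by (subst \<xi>) (simp add: linear_scale[OF lin] fe)
    have "transpose N = transpose (matrix U) ** matrix f"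
      by (simp add: N_def matrix_transpose_mul trf)
    then show "transpose N *v \<xi> = 0"
      using \<open>f \<xi> = 0\<close> by (simp add: matrix_vector_mul_assoc[symmetric] lin matrix_works)
  next
    fix q t assume q: "q = p + t *\<^sub>R \<xi>"
    define \<tau> where "\<tau> = p \<bullet> e + t * norm \<xi>"
    have q: "q = b + \<tau> *\<^sub>R e" unfolding q by (subst \<xi>) (simp add: b_def \<tau>_def algebra_simps)
    define w where "w = slope q"
    have w: "w > 0" by (simp add: w_def)
    have w2: "w\<^sup>2 = \<rho>\<^sup>2 + \<tau>\<^sup>2"
      unfolding w_def slope_power2 \<rho> power2_norm_eq_inner q
      by (simp add: inner_add_left inner_add_right be ee inner_commute[of e b] power2_eq_square)
    \<comment> \<open>\<open>gmat q\<close> minus f^2 / w is (1 / w) (b b^T / \<rho>^2 + e e^T - q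
      q^T / w^2). Since w^2 = \<rho>^2 + \<tau>^2 this has rank one, and \<open>m\<close> is the
      vector whose tensor square it is.\<close>
    define m where "m = (1 / (w * sqrt w * \<rho>)) *\<^sub>R (\<rho>\<^sup>2 *\<^sub>R e - \<tau> *\<^sub>R b)"
    have "gmat q *v x = (1 / w) *\<^sub>R f (f x) + (m \<bullet> x) *\<^sub>R m" for x
    proof -
      define \<alpha> where "\<alpha> = b \<bullet> x"
      define \<eta> where "\<eta> = e \<bullet> x"
      have "(m \<bullet> x) *\<^sub>R m = (1 / (w * sqrt w * \<rho>) * (1 / (w * sqrt w * \<rho>)) * (\<rho>\<^sup>2 * \<eta> - \<tau> * \<alpha>)) *\<^sub>R (\<rho>\<^sup>2 *\<^sub>R e - \<tau> *\<^sub>R b)"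
        by (simp add: m_def inner_diff_left \<alpha>_def \<eta>_def mult_ac)
      also have "1 / (w * sqrt w * \<rho>) * (1 / (w * sqrt w * \<rho>)) = 1 / (w ^ 3 * \<rho>\<^sup>2)"
        using w by (simp add: power2_eq_square power3_eq_cube mult_ac)
      finally have mm: "(m \<bullet> x) *\<^sub>R m = ((\<rho>\<^sup>2 * \<eta> - \<tau> * \<alpha>) / (w ^ 3 * \<rho>\<^sup>2)) *\<^sub>R (\<rho>\<^sup>2 *\<^sub>R e - \<tau> *\<^sub>R b)"
        by simp
      have G: "gmat q *v x = (1 / w) *\<^sub>R x - ((\<alpha> + \<tau> * \<eta>) / w ^ 3) *\<^sub>R (b + \<tau> *\<^sub>R e)"
        unfolding gmat_mult_vec w_def[symmetric] by (simp add: q inner_add_left \<alpha>_def \<eta>_def)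
      have w3: "w ^ 3 = w * (\<rho>\<^sup>2 + \<tau>\<^sup>2)" using w2 by (simp add: power3_eq_cube power2_eq_square)
      have pos: "\<rho>\<^sup>2 + \<tau>\<^sup>2 > 0" using \<rho> by (simp add: add_pos_nonneg)
      have 1: "- ((\<alpha> + \<tau> * \<eta>) / w ^ 3) = - (\<alpha> / (w * \<rho>\<^sup>2)) - (\<rho>\<^sup>2 * \<eta> - \<tau> * \<alpha>) / (w ^ 3 * \<rho>\<^sup>2) * \<tau>"
        unfolding w3 using w pos \<rho>(1) by (simp add: divide_simps) (simp add: algebra_simps power2_eq_square)
      have 2: "- ((\<alpha> + \<tau> * \<eta>) / w ^ 3) * \<tau> = - (\<eta> / w) + (\<rho>\<^sup>2 * \<eta> - \<tau> * \<alpha>) / (w ^ 3 * \<rho>\<^sup>2) * \<rho>\<^sup>2"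
        unfolding w3 using w pos \<rho>(1) by (simp add: divide_simps) (simp add: algebra_simps power2_eq_square)
      have "gmat q *v x = (1 / w) *\<^sub>R x + (- ((\<alpha> + \<tau> * \<eta>) / w ^ 3)) *\<^sub>R b + (- ((\<alpha> + \<tau> * \<eta>) / w ^ 3) * \<tau>) *\<^sub>R e"
        unfolding G by (simp add: algebra_simps)
      also have "\<dots> = (1 / w) *\<^sub>R f (f x) + (m \<bullet> x) *\<^sub>R m"
        unfolding 2 unfolding 1 mm ff \<alpha>_def[symmetric] \<eta>_def[symmetric] by (simp add: algebra_simps)
      finally show ?thesis .
    qed
    then show "\<exists>m. \<forall>x. gmat q *v x = (1 / slope q) *\<^sub>R ((N ** transpose N) *v x) + (m \<bullet> x) *\<^sub>R m"
      unfolding NN w_def by blast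
  qed
qed


section \<open>From the cone to the hyperplane\<close>

text \<open>Nonnegative multiples of the projection onto coordinate \<open>a\<close> lie in the
  cone, so adding them to \<open>A\<close> stays in the cone. \<open>esigma_del a j A\<close> is the
  slope of \<open>esigma (Suc j)\<close> along this ray and cannot be negative.\<close>

lemma esigma_rank_one_nonneg:
  fixes A :: "real^'n::finite^'n"
  assumes k: "k < CARD('n)" and A: "A \<in> garding_cone (Suc k)" and j: "j \<le> k"
  shows "esigma_del a j A \<ge> 0"
proof (rule ccontr)
  assume neg: "\<not> esigma_del a j A \<ge> 0"
  define E where "E s = ((\<chi> i j. if i = a \<and> j = a then s else 0) :: real^'n^'n)" for s
  have "esigma i (E s) \<ge> 0" if il: "i \<in> {1..Suc k}" "s \<ge> 0" for i s
  proof -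
    obtain l where i: "i = Suc l" using il(1) by (cases i) auto
    have minor0: "pminor I (0 :: real^'n^'n) = (if I = {} then 1 else 0)" for I
    proof (cases "I = {}")
      case False
      then obtain x where "x \<in> I" by auto
      have "pminor I (0 :: real^'n^'n) = pminor I (mscale 0 0)"
        by (rule pminor_cong) simp
      also have "\<dots> = 0" unfolding mscale_def pminor_scale using False by (simp add: power_0_left)
      finally show ?thesis using False by simp
    qed simp
    have "esigma (Suc l) (0 + E s) = esigma (Suc l) (0 :: real^'n^'n) + s * esigma_del a l (0 :: real^'n^'n)"
      unfolding E_def by (rule esigma_rank_one)
    also have "\<dots> \<ge> 0"
      using il by (auto simp: esigma_def esigma_del_def minor0 intro!: add_nonneg_nonneg mult_nonneg_nonneg sum_nonneg)
    finally show ?thesis by (simp add: i)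
  qed
  moreover have "transpose (E s) = E s" for s by (auto simp: E_def transpose_def vec_eq_iff)
  ultimately have E: "E s \<in> garding_cone (Suc k)" if "s \<ge> 0" for s
    using that by (simp add: garding_cone_def)
  \<comment> \<open>The multiple at which the affine function takes the value -1.\<close>
  define s where "s = (esigma (Suc j) A + 1) / - esigma_del a j A"
  have A0: "esigma (Suc j) A \<ge> 0" using A j by (simp add: garding_cone_def)
  then have "s \<ge> 0" using neg unfolding s_def by (intro divide_nonneg_nonneg) auto
  then have "A + E s \<in> garding_cone (Suc k)"
    using garding_cone_add[OF _ A E] k by simp
  then have "0 \<le> esigma (Suc j) (A + E s)" using j by (simp add: garding_cone_def)
  also have "\<dots> = esigma (Suc j) A + s * esigma_del a j A"
    unfolding E_def by (rule esigma_rank_one)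
  also have "\<dots> = -1" using neg unfolding s_def by (simp add: field_simps)
  finally show False by simp
qed

lemma esigma_zero_column:
  assumes "\<And>i. A $ i $ a = 0"
  shows "esigma k A = esigma_del a k A"
proof -
  have "pminor I A = 0" if "a \<in> I" for I
    unfolding pminor_def
  proof (intro sum.neutral ballI)
    fix p assume "p \<in> {p. p permutes I}"
    then have "a \<in> p ` I" using that by (simp add: permutes_image)
    then obtain i where "i \<in> I" "p i = a" by auto
    then have "(\<Prod>i\<in>I. A $ i $ p i) = 0" using assms by (intro prod_zero) auto
    then show "of_int (sign p) * (\<Prod>i\<in>I. A $ i $ p i) = 0" by simp
  qed
  then show ?thesis
    unfolding esigma_def esigma_del_def by (intro sum.mono_neutral_right) auto
qed

definition tensor :: "real^'n::finite \<Rightarrow> real^'n \<Rightarrow> real^'n^'n" where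
  "tensor x y = (\<chi> i j. x $ i * y $ j)"

lemma matrix_tensor: "A ** tensor x y = tensor (A *v x) y"
  by (simp add: tensor_def matrix_matrix_mult_def matrix_vector_mult_def vec_eq_iff sum_distrib_left sum_distrib_right mult_ac)

text \<open>Put \<open>m\<close> into the empty column \<open>a\<close> of N / sqrt w. The resulting
  \<open>M\<close> satisfies M M^T = gmat q, so \<open>gmat q ** r\<close> and the symmetric A = M^T
  r M have the same symmetric functions. As N^T annihilates \<open>\<xi>\<close>, M^T sends
  \<open>\<xi>\<close> to a multiple of the \<open>a\<close>-th basis vector, and the perturbation
  lands in the entry (a, a). Without row and column \<open>a\<close> there remains N^T r N / w,
  where \<open>N\<close> is chosen before \<open>q\<close> and hence serves the whole line.\<close>

lemma gmat_congruence:
  fixes p \<xi> :: "real^'n::finite" and a :: 'n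
  assumes "\<xi> \<noteq> 0"
  obtains N :: "real^'n^'n" where "\<And>i. N $ i $ a = 0"
    "\<And>q t r k. q = p + t *\<^sub>R \<xi> \<Longrightarrow> transpose r = r \<Longrightarrow> \<exists>A c. transpose A = A \<and>
      (\<forall>j. esigma j (gmat q ** r) = esigma j A) \<and>
      (\<forall>j s. esigma (Suc j) (gmat q ** r + s *\<^sub>R tensor (gmat q *v \<xi>) \<xi>) =
         esigma (Suc j) A + s * c\<^sup>2 * esigma_del a j A) \<and>
      (\<forall>j. esigma_del a j A = (1 / slope q) ^ j * esigma j (transpose N ** r ** N))"
proof -
  obtain N :: "real^'n^'n" where N: "\<And>i. N $ i $ a = 0" "transpose N *v \<xi> = 0"
    "\<And>q t. q = p + t *\<^sub>R \<xi> \<Longrightarrow>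
       \<exists>m. \<forall>x. gmat q *v x = (1 / slope q) *\<^sub>R ((N ** transpose N) *v x) + (m \<bullet> x) *\<^sub>R m"
    using gmat_factor_along_line[OF assms, where a = a and p = p] by metis
  show ?thesis
  proof
    show "N $ i $ a = 0" for i by (rule N)
  next
    fix q t and r :: "real^'n^'n" assume q: "q = p + t *\<^sub>R \<xi>" and r: "transpose r = r"
    obtain m where m: "\<And>x. gmat q *v x = (1 / slope q) *\<^sub>R ((N ** transpose N) *v x) + (m \<bullet> x) *\<^sub>R m"
      using N(3)[OF q] by blast
    define w where "w = slope q"
    have w: "w > 0" by (simp add: w_def)
    define M where "M = (\<chi> i j. if j = a then m $ i else N $ i $ j / sqrt w)"
    define c where "c = m \<bullet> \<xi>"
    define A where "A = transpose M ** r ** M"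
    have M_eq: "M $ i $ j = N $ i $ j / sqrt w + (if j = a then m $ i else 0)" for i j
      by (simp add: M_def N(1))
    have MT: "transpose M *v x = (1 / sqrt w) *\<^sub>R (transpose N *v x) + (m \<bullet> x) *\<^sub>R axis a 1" for x
    proof -
      have "(transpose M *v x) $ j = (\<Sum>i\<in>UNIV. N $ i $ j * x $ i / sqrt w + (if j = a then m $ i * x $ i else 0))" for j
        unfolding matrix_vector_mult_def by (simp add: transpose_def M_eq, intro sum.cong) (auto simp: algebra_simps)
      then show ?thesis
        by (simp add: vec_eq_iff sum.distrib matrix_vector_mult_def transpose_def inner_vec_def
            sum_divide_distrib[symmetric] axis_def)
    qed
    have Mv: "M *v x = (1 / sqrt w) *\<^sub>R (N *v x) + (x $ a) *\<^sub>R m" for x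
    proof -
      have "(M *v x) $ i = (\<Sum>j\<in>UNIV. N $ i $ j * x $ j / sqrt w + (if j = a then m $ i * x $ j else 0))" for i
        unfolding matrix_vector_mult_def by (simp add: M_eq, intro sum.cong) (auto simp: algebra_simps)
      then show ?thesis
        by (simp add: vec_eq_iff sum.distrib matrix_vector_mult_def sum_divide_distrib[symmetric])
    qed
    have Na: "N *v axis a 1 = 0"
      by (simp add: vec_eq_iff matrix_vector_mul_component inner_axis N(1))
    have NTa: "(transpose N *v x) $ a = 0" for x
      by (simp add: matrix_vector_mult_def transpose_def N(1))
    have MMT: "M ** transpose M = gmat q"
    proof -
      have "(M ** transpose M) *v x = gmat q *v x" for x
      proof -
        have "N *v (transpose M *v x) = (1 / sqrt w) *\<^sub>R (N *v (transpose N *v x))"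
          by (simp add: MT matrix_vector_right_distrib matrix_vector_mult_scaleR Na)
        moreover have "(transpose M *v x) $ a = m \<bullet> x"
          by (simp add: MT NTa)
        ultimately have "M *v (transpose M *v x) = (1 / sqrt w * (1 / sqrt w)) *\<^sub>R (N *v (transpose N *v x)) + (m \<bullet> x) *\<^sub>R m"
          by (simp add: Mv)
        also have "1 / sqrt w * (1 / sqrt w) = 1 / w" using w by (simp add: less_imp_le)
        finally show ?thesis by (simp add: m w_def matrix_vector_mul_assoc)
      qed
      then show ?thesis by (simp add: matrix_eq)
    qed
    have invM: "invertible M"
    proof -
      have "det (gmat q) = det M * det (transpose M)"
        by (metis MMT det_mul)
      moreover have "det (gmat q) \<noteq> 0"
        using gmat_invertible[of q] by (simp add: invertible_det_nz)
      ultimately show ?thesis by (simp add: invertible_det_nz)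
    qed
    have comm: "esigma j (gmat q ** X) = esigma j (transpose M ** X ** M)" for j X
      using esigma_mult_commute[OF invM, of j "transpose M ** X"]
      by (simp add: MMT[symmetric] matrix_mul_assoc)
    have 1: "transpose A = A" by (simp add: A_def matrix_transpose_mul r matrix_mul_assoc)
    have 2: "esigma j (gmat q ** r) = esigma j A" for j by (simp add: comm A_def)
    have MT\<xi>: "transpose M *v \<xi> = c *\<^sub>R axis a 1" by (simp add: MT N(2) c_def)
    have 3: "esigma (Suc j) (gmat q ** r + s *\<^sub>R tensor (gmat q *v \<xi>) \<xi>) =
         esigma (Suc j) A + s * c\<^sup>2 * esigma_del a j A" for j s
    proof -
      have "gmat q ** r + s *\<^sub>R tensor (gmat q *v \<xi>) \<xi> = gmat q ** (r + s *\<^sub>R tensor \<xi> \<xi>)"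
        by (simp add: matrix_tensor[symmetric] matrix_matrix_mult_def vec_eq_iff distrib_left sum.distrib sum_distrib_left mult_ac)
      then have "esigma (Suc j) (gmat q ** r + s *\<^sub>R tensor (gmat q *v \<xi>) \<xi>) =
          esigma (Suc j) (transpose M ** (r + s *\<^sub>R tensor \<xi> \<xi>) ** M)"
        by (simp add: comm)
      also have "transpose M ** (r + s *\<^sub>R tensor \<xi> \<xi>) ** M = A + (\<chi> i j. if i = a \<and> j = a then s * c\<^sup>2 else 0)"
      proof -
        have "tensor x y ** M = tensor x (transpose M *v y)" for x y
          by (simp add: tensor_def matrix_matrix_mult_def matrix_vector_mult_def transpose_def vec_eq_iff sum_distrib_left mult_ac)
        then have "transpose M ** tensor \<xi> \<xi> ** M = tensor (c *\<^sub>R axis a 1) (c *\<^sub>R axis a 1)"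
          by (simp add: matrix_tensor MT\<xi>)
        then have "s *\<^sub>R (transpose M ** tensor \<xi> \<xi> ** M) = (\<chi> i j. if i = a \<and> j = a then s * c\<^sup>2 else 0)"
          by (simp add: tensor_def vec_eq_iff axis_def power2_eq_square)
        moreover have "transpose M ** (r + s *\<^sub>R tensor \<xi> \<xi>) ** M = A + s *\<^sub>R (transpose M ** tensor \<xi> \<xi> ** M)"
          unfolding A_def
          by (simp add: matrix_matrix_mult_def vec_eq_iff distrib_left distrib_right sum.distrib sum_distrib_left sum_distrib_right mult_ac)
        ultimately show ?thesis by simp
      qed
      finally show ?thesis by (simp add: esigma_rank_one)
    qed
    have entry: "A $ i $ j = 1 / w * (transpose N ** r ** N) $ i $ j" if "i \<noteq> a" "j \<noteq> a" for i j
    proof -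
      have "A $ i $ j = 1 / (sqrt w * sqrt w) * (transpose N ** r ** N) $ i $ j"
        using that by (simp add: A_def matrix_matrix_mult_def transpose_def M_def sum_distrib_left sum_distrib_right sum_divide_distrib mult_ac)
      then show ?thesis using w by (simp add: less_imp_le)
    qed
    have 4: "esigma_del a j A = (1 / slope q) ^ j * esigma j (transpose N ** r ** N)" for j
    proof -
      have "pminor I A = (1 / w) ^ card I * pminor I (transpose N ** r ** N)" if "a \<notin> I" for I
        unfolding pminor_scale[symmetric]
        by (rule pminor_cong) (subst entry, use that in auto)
      then have "esigma_del a j A = (1 / w) ^ j * esigma_del a j (transpose N ** r ** N)"
        unfolding esigma_del_def sum_distrib_left by (intro sum.cong) auto
      moreover have "(transpose N ** r ** N) $ i $ a = 0" for i
        by (simp add: matrix_matrix_mult_def N(1))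
      ultimately show ?thesis using esigma_zero_column[of "transpose N ** r ** N" a j] by (simp add: w_def)
    qed
    show "\<exists>A c. transpose A = A \<and>
      (\<forall>j. esigma j (gmat q ** r) = esigma j A) \<and>
      (\<forall>j s. esigma (Suc j) (gmat q ** r + s *\<^sub>R tensor (gmat q *v \<xi>) \<xi>) =
         esigma (Suc j) A + s * c\<^sup>2 * esigma_del a j A) \<and>
      (\<forall>j. esigma_del a j A = (1 / slope q) ^ j * esigma j (transpose N ** r ** N))"
      using 1 2 3 4 by blast
  qed
qed

text \<open>Both endpoints are compared through the same \<open>N\<close>. The congruence N^T r N is
  affine in \<open>r\<close>, so convexity is used for these matrices, not for the products with
  \<open>gmat\<close>. The constant found is the square of a scalar times
  \<open>esigma_del\<close>.\<close>

lemma esigma_gmat_rank_one_interpolation: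
  fixes p \<xi> :: "real^'n::finite"
  assumes k: "0 < k" "k \<le> CARD('n)" and t: "t \<in> {0..1}"
    and sym: "transpose r0 = r0" "transpose r1 = r1"
    and nonneg0: "\<And>j. j \<in> {1..k} \<Longrightarrow> esigma j (gmat p ** r0) \<ge> 0"
    and nonneg1: "\<And>j. j \<in> {1..k} \<Longrightarrow> esigma j (gmat (p + \<xi>) ** r1) \<ge> 0"
  defines "q \<equiv> p + t *\<^sub>R \<xi>" and "r \<equiv> r0 + t *\<^sub>R (r1 - r0)"
  shows "\<exists>c\<ge>0. \<forall>s. esigma k (gmat q ** r + s *\<^sub>R tensor (gmat q *v \<xi>) \<xi>) = esigma k (gmat q ** r) + s * c"
proof (cases "\<xi> = 0")
  case True
  then have "tensor (gmat q *v \<xi>) \<xi> = 0" by (simp add: tensor_def vec_eq_iff)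
  then show ?thesis by auto
next
  case False
  obtain l where l: "k = Suc l" using k by (cases k) auto
  \<comment> \<open>Any index will do: it only names the coordinate that stands for the direction of
    \<open>\<xi>\<close>.\<close>
  define a where "a = (undefined :: 'n)"
  obtain N :: "real^'n^'n" where Na: "\<And>i. N $ i $ a = 0" and N:
    "\<And>q t r. q = p + t *\<^sub>R \<xi> \<Longrightarrow> transpose r = r \<Longrightarrow> \<exists>A c. transpose A = A \<and>
      (\<forall>j. esigma j (gmat q ** r) = esigma j A) \<and>
      (\<forall>j s. esigma (Suc j) (gmat q ** r + s *\<^sub>R tensor (gmat q *v \<xi>) \<xi>) =
         esigma (Suc j) A + s * c\<^sup>2 * esigma_del a j A) \<and>
      (\<forall>j. esigma_del a j A = (1 / slope q) ^ j * esigma j (transpose N ** r ** N))"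
    using gmat_congruence[OF False, where a = a and p = p] by metis
  \<comment> \<open>At an endpoint the full congruent matrix lies in the cone of order l + 1.
    Deleting coordinate \<open>a\<close> costs one order, and the positive power of 1 / slope can be
    divided out.\<close>
  have end_cone: "transpose N ** r' ** N \<in> garding_cone l"
    if q': "q' = p + t' *\<^sub>R \<xi>" and sym': "transpose r' = r'"
      and nonneg: "\<And>j. j \<in> {1..k} \<Longrightarrow> esigma j (gmat q' ** r') \<ge> 0" for q' t' r'
  proof -
    obtain A where A: "transpose A = A" "\<And>j. esigma j (gmat q' ** r') = esigma j A"
      "\<And>j. esigma_del a j A = (1 / slope q') ^ j * esigma j (transpose N ** r' ** N)"
      using N[OF q' sym'] by blast
    then have "A \<in> garding_cone (Suc l)" using nonneg l by (simp add: garding_cone_def)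
    then have "esigma_del a j A \<ge> 0" if "j \<le> l" for j
      using esigma_rank_one_nonneg[of l A j a] k l that by simp
    then have "esigma j (transpose N ** r' ** N) \<ge> 0" if "j \<le> l" for j
      using A(3)[of j] that by (metis slope_pos zero_le_mult_iff zero_less_power zero_less_divide_1_iff not_less)
    moreover have "transpose (transpose N ** r' ** N) = transpose N ** r' ** N"
      by (simp add: matrix_transpose_mul sym' matrix_mul_assoc)
    ultimately show ?thesis by (simp add: garding_cone_def)
  qed
  have scale: "s *\<^sub>R X \<in> garding_cone l" if "s \<ge> 0" "X \<in> garding_cone l" for s and X :: "real^'n^'n"
  proof -
    have "s *\<^sub>R X = mscale s X" by (simp add: vec_eq_iff)
    moreover have "transpose (s *\<^sub>R X) = s *\<^sub>R X"
      using that by (simp add: garding_cone_def transpose_def vec_eq_iff)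
    ultimately show ?thesis using that by (simp add: garding_cone_def esigma_mscale)
  qed
  have "transpose N ** r ** N = (1 - t) *\<^sub>R (transpose N ** r0 ** N) + t *\<^sub>R (transpose N ** r1 ** N)"
    unfolding r_def
    by (simp add: matrix_matrix_mult_def vec_eq_iff algebra_simps sum.distrib sum_subtractf sum_distrib_left sum_distrib_right)
  moreover have "transpose N ** r0 ** N \<in> garding_cone l"
    by (rule end_cone[of p 0]) (use sym nonneg0 in auto)
  moreover have "transpose N ** r1 ** N \<in> garding_cone l"
    by (rule end_cone[of "p + \<xi>" 1]) (use sym nonneg1 in auto)
  ultimately have "transpose N ** r ** N \<in> garding_cone l"
    using t k l by (auto intro!: garding_cone_add scale)
  \<comment> \<open>For l = 0 the cone gives no inequality, but then the value is
    \<open>esigma 0 = 1\<close>.\<close>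
  then have nn: "esigma l (transpose N ** r ** N) \<ge> 0"
    by (cases "l = 0") (auto simp: garding_cone_def)
  have symr: "transpose r = r" using sym by (simp add: r_def transpose_def vec_eq_iff)
  obtain A c where A: "\<And>j. esigma j (gmat q ** r) = esigma j A"
      "\<And>j s. esigma (Suc j) (gmat q ** r + s *\<^sub>R tensor (gmat q *v \<xi>) \<xi>) =
         esigma (Suc j) A + s * c\<^sup>2 * esigma_del a j A"
      "\<And>j. esigma_del a j A = (1 / slope q) ^ j * esigma j (transpose N ** r ** N)"
    using N[OF q_def[THEN meta_eq_to_obj_eq] symr] by blast
  have "c\<^sup>2 * esigma_del a l A \<ge> 0"
    unfolding A(3) using nn by (simp add: less_imp_le)
  then show ?thesis using A(1,2) by (auto simp: l mult.assoc)
qed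

section \<open>Derivatives\<close>

lemma slope_nonzero [simp]: "slope q \<noteq> 0"
  by (metis slope_pos less_irrefl)

lemma slope_altdef: "slope q = sqrt (1 + (\<Sum>l\<in>UNIV. (q $ l)\<^sup>2))"
  by (simp add: slope_def norm_vec_def L2_set_def sum_nonneg)

lemma continuous_on_if_const:
  "continuous_on S f \<Longrightarrow> continuous_on S (\<lambda>x. if b then f x else 0)"
  for f :: "'a::topological_space \<Rightarrow> real"
  by (cases b) auto

text \<open>The differential of \<open>esigma k\<close> at \<open>A\<close> applied to
  \<open>E\<close>. As an explicit sum it is visibly linear in \<open>E\<close> and continuous in
  both arguments. Its coefficients are the cofactors S^ij.\<close>

definition dsigma :: "nat \<Rightarrow> real^'n::finite^'n \<Rightarrow> real^'n^'n \<Rightarrow> real" where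
  "dsigma k A E = (\<Sum>I | card I = k. \<Sum>p | p permutes I.
     of_int (sign p) * (\<Sum>i\<in>I. E $ i $ p i * (\<Prod>l\<in>I - {i}. A $ l $ p l)))"

lemma has_derivative_esigma:
  assumes "\<And>i j. ((\<lambda>s. A s $ i $ j) has_real_derivative E $ i $ j) (at s0)"
  shows "((\<lambda>s. esigma k (A s)) has_real_derivative dsigma k (A s0) E) (at s0)"
  unfolding esigma_def pminor_def dsigma_def
  by (intro DERIV_sum DERIV_cmult has_field_derivative_prod assms)

lemma dsigma_add: "dsigma k A (E + F) = dsigma k A E + dsigma k A F"
  by (simp add: dsigma_def distrib_right distrib_left sum.distrib)

lemma dsigma_scale: "dsigma k A (c *\<^sub>R E) = c * dsigma k A E"
  by (simp add: dsigma_def sum_distrib_left mult_ac)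

lemma dsigma_eqI:
  assumes "\<And>s. esigma k (A + s *\<^sub>R E) = esigma k A + s * c"
  shows "dsigma k A E = c"
proof -
  have "((\<lambda>s. esigma k (A + s *\<^sub>R E)) has_real_derivative dsigma k (A + 0 *\<^sub>R E) E) (at 0)"
    by (rule has_derivative_esigma) (auto intro!: derivative_eq_intros)
  moreover have "((\<lambda>s. esigma k (A + s *\<^sub>R E)) has_real_derivative c) (at 0)"
    unfolding assms by (auto intro!: derivative_eq_intros)
  ultimately show ?thesis using DERIV_unique by fastforce
qed

text \<open>The derivative in the j-th coordinate of the j-th component of the field with components
  S^ij Y_i. \<open>B i l j\<close> stands for the j-th derivative of the entry (i, l) of
  \<open>A\<close>, and \<open>Z\<close> for the Jacobian of \<open>Y\<close>.\<close>

definition ddsigma :: "nat \<Rightarrow> 'n \<Rightarrow> real^'n::finite^'n \<Rightarrow> ('n \<Rightarrow> 'n \<Rightarrow> 'n \<Rightarrow> real) \<Rightarrow> real^'n \<Rightarrow> real^'n^'n \<Rightarrow> real" where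
  "ddsigma k j A B Y Z = (\<Sum>I | card I = k. \<Sum>p | p permutes I. of_int (sign p) * (\<Sum>i\<in>I.
     if p i = j then Z $ i $ j * (\<Prod>l\<in>I - {i}. A $ l $ p l) +
       Y $ i * (\<Sum>m\<in>I - {i}. B m (p m) j * (\<Prod>l\<in>I - {i} - {m}. A $ l $ p l)) else 0))"

lemma has_derivative_dsigma_tensor:
  assumes A: "\<And>i l. ((\<lambda>s. A s $ i $ l) has_real_derivative B i l j) (at s0)"
    and Y: "\<And>i. ((\<lambda>s. Y s $ i) has_real_derivative Z $ i $ j) (at s0)"
  shows "((\<lambda>s. dsigma k (A s) (tensor (Y s) (axis j 1))) has_real_derivative
    ddsigma k j (A s0) B (Y s0) Z) (at s0)"
proof -
  have "((\<lambda>s. tensor (Y s) (axis j 1) $ i $ p i * (\<Prod>l\<in>I - {i}. A s $ l $ p l)) has_real_derivative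
      (if p i = j then Z $ i $ j * (\<Prod>l\<in>I - {i}. A s0 $ l $ p l) +
       Y s0 $ i * (\<Sum>m\<in>I - {i}. B m (p m) j * (\<Prod>l\<in>I - {i} - {m}. A s0 $ l $ p l)) else 0)) (at s0)"
    for I i and p :: "'a \<Rightarrow> 'a"
  proof (cases "p i = j")
    case True
    have "((\<lambda>s. Y s $ i * (\<Prod>l\<in>I - {i}. A s $ l $ p l)) has_real_derivative
       Z $ i $ j * (\<Prod>l\<in>I - {i}. A s0 $ l $ p l) +
       (\<Sum>m\<in>I - {i}. B m (p m) j * (\<Prod>l\<in>I - {i} - {m}. A s0 $ l $ p l)) * Y s0 $ i) (at s0)"
      by (intro DERIV_mult has_field_derivative_prod A Y)
    then show ?thesis using True by (simp add: tensor_def axis_def mult.commute)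
  qed (auto simp: tensor_def axis_def)
  then show ?thesis
    unfolding dsigma_def ddsigma_def by (intro DERIV_sum DERIV_cmult)
qed

text \<open>
  The cofactors of a Jacobian are divergence-free: the second order terms cancel in pairs under
  composition of \<open>p\<close> with the transposition of \<open>i\<close> and \<open>m\<close>.
\<close>
lemma sum_ddsigma:
  fixes A Z :: "real^'n::finite^'n"
  assumes B: "\<And>i j l. B i j l = B i l j"
  shows "(\<Sum>j\<in>UNIV. ddsigma k j A B Y Z) = dsigma k A Z"
proof -
  have cancel: "(\<Sum>p | p permutes I. of_int (sign p) *
      (B m (p m) (p i) * (\<Prod>l\<in>I - {i} - {m}. A $ l $ p l))) = (0::real)"
    (is "?S = 0") if "i \<in> I" "m \<in> I" "i \<noteq> m" for I :: "'n set" and i m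
  proof -
    let ?t = "Transposition.transpose i m"
    have t: "?t permutes I" using that by (intro permutes_swap_id)
    have "?S = (\<Sum>p | p permutes I. - (of_int (sign p) *
      (B m (p m) (p i) * (\<Prod>l\<in>I - {i} - {m}. A $ l $ p l))))"
    proof (rule sum.reindex_bij_witness[where i = "\<lambda>p. p \<circ> ?t" and j = "\<lambda>p. p \<circ> ?t"])
      fix p assume "p \<in> {p. p permutes I}"
      then have p: "p permutes I" by simp
      then have "permutation p" "permutation ?t"
        using t finite[of I] unfolding permutation_permutes by blast+
      then have "sign (p \<circ> ?t) = - sign p"
        using that by (simp add: sign_compose sign_swap_id)
      moreover have "(\<Prod>l\<in>I - {i} - {m}. A $ l $ (p \<circ> ?t) l) = (\<Prod>l\<in>I - {i} - {m}. A $ l $ p l)"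
        by (intro prod.cong) (auto simp: transpose_apply_other)
      moreover have "(p \<circ> ?t) m = p i" "(p \<circ> ?t) i = p m" by auto
      ultimately show "- (of_int (sign (p \<circ> ?t)) * (B m ((p \<circ> ?t) m) ((p \<circ> ?t) i) *
          (\<Prod>l\<in>I - {i} - {m}. A $ l $ (p \<circ> ?t) l))) =
          of_int (sign p) * (B m (p m) (p i) * (\<Prod>l\<in>I - {i} - {m}. A $ l $ p l))"
        using B[of m "p m" "p i"] by simp
      show "p \<circ> ?t \<in> {p. p permutes I}" using p t by (simp add: permutes_compose)
      show "p \<circ> ?t \<circ> ?t = p" by (simp add: comp_assoc)
    qed (use t in \<open>auto simp: permutes_compose comp_assoc\<close>)
    then show ?thesis by (simp add: sum_negf)
  qed
  have "(\<Sum>j\<in>UNIV. ddsigma k j A B Y Z) = (\<Sum>I | card I = k. \<Sum>p | p permutes I. of_int (sign p) * (\<Sum>i\<in>I.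
      \<Sum>j\<in>UNIV. if p i = j then Z $ i $ j * (\<Prod>l\<in>I - {i}. A $ l $ p l) +
       Y $ i * (\<Sum>m\<in>I - {i}. B m (p m) j * (\<Prod>l\<in>I - {i} - {m}. A $ l $ p l)) else 0))"
    unfolding ddsigma_def sum_distrib_left
    by (rule trans[OF sum.swap], rule sum.cong[OF refl], rule trans[OF sum.swap],
        rule sum.cong[OF refl], rule sum.swap)
  also have "\<dots> = (\<Sum>I | card I = k. \<Sum>p | p permutes I. of_int (sign p) * (\<Sum>i\<in>I. Z $ i $ p i * (\<Prod>l\<in>I - {i}. A $ l $ p l))
     + (\<Sum>i\<in>I. \<Sum>m\<in>I - {i}. Y $ i * (of_int (sign p) * (B m (p m) (p i) * (\<Prod>l\<in>I - {i} - {m}. A $ l $ p l)))))"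
    by (intro sum.cong refl) (simp add: sum.distrib distrib_left sum_distrib_left mult_ac)
  also have "\<dots> = dsigma k A Z + (\<Sum>I | card I = k. \<Sum>i\<in>I. \<Sum>m\<in>I - {i}. Y $ i * (\<Sum>p | p permutes I.
      of_int (sign p) * (B m (p m) (p i) * (\<Prod>l\<in>I - {i} - {m}. A $ l $ p l))))"
    unfolding dsigma_def sum.distrib sum_distrib_left
    by (rule arg_cong2[of _ _ _ _ "(+)", OF refl], rule sum.cong[OF refl], rule trans[OF sum.swap],
        rule sum.cong[OF refl], rule sum.swap)
  also have "(\<Sum>I | card I = k. \<Sum>i\<in>I. \<Sum>m\<in>I - {i}. Y $ i * (\<Sum>p | p permutes I.
      of_int (sign p) * (B m (p m) (p i) * (\<Prod>l\<in>I - {i} - {m}. A $ l $ p l)))) = 0"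
  proof (intro sum.neutral ballI)
    fix I :: "'n set" and i m assume "i \<in> I" "m \<in> I - {i}"
    then have c: "(\<Sum>p | p permutes I. of_int (sign p) * (B m (p m) (p i) * (\<Prod>l\<in>I - {i} - {m}. A $ l $ p l))) = 0"
      by (intro cancel) auto
    show "Y $ i * (\<Sum>p | p permutes I. of_int (sign p) * (B m (p m) (p i) * (\<Prod>l\<in>I - {i} - {m}. A $ l $ p l))) = 0"
      unfolding c by simp
  qed
  finally show ?thesis by simp
qed

lemma continuous_on_dsigma:
  assumes "\<And>i j. continuous_on S (\<lambda>x. A x $ i $ j)" "\<And>i j. continuous_on S (\<lambda>x. E x $ i $ j)"
  shows "continuous_on S (\<lambda>x. dsigma k (A x) (E x))"
  unfolding dsigma_def by (intro continuous_intros assms)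

lemma continuous_on_ddsigma:
  assumes "\<And>i j. continuous_on S (\<lambda>x. A x $ i $ j)" "\<And>i j l. continuous_on S (\<lambda>x. B x i j l)"
    "\<And>i. continuous_on S (\<lambda>x. Y x $ i)" "\<And>i j. continuous_on S (\<lambda>x. Z x $ i $ j)"
  shows "continuous_on S (\<lambda>x. ddsigma k j (A x) (B x) (Y x) (Z x))"
  unfolding ddsigma_def
  by (intro continuous_on_sum continuous_on_mult continuous_on_const continuous_on_if_const
      continuous_on_add continuous_on_prod assms)

text \<open>The third derivatives of \<open>slope\<close>, whose Hessian is \<open>gmat\<close>;
  hence the symmetry in all three indices.\<close>

definition gmat_deriv :: "real^'n::finite \<Rightarrow> 'n \<Rightarrow> 'n \<Rightarrow> 'n \<Rightarrow> real" where
  "gmat_deriv q i j l = 3 * q $ i * q $ j * q $ l / slope q ^ 5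
     - ((if i = j then q $ l else 0) + (if i = l then q $ j else 0) + (if j = l then q $ i else 0)) / slope q ^ 3"

lemma gmat_deriv_commute: "gmat_deriv q i j l = gmat_deriv q i l j"
  unfolding gmat_deriv_def by auto

lemma has_derivative_slope:
  assumes "\<And>l. ((\<lambda>s. W s $ l) has_real_derivative W' $ l) (at s0)"
  shows "((\<lambda>s. slope (W s)) has_real_derivative (\<Sum>l\<in>UNIV. W s0 $ l * W' $ l) / slope (W s0)) (at s0)"
proof -
  have der: "((\<lambda>s. 1 + (\<Sum>l\<in>UNIV. (W s $ l)\<^sup>2)) has_real_derivative 2 * (\<Sum>l\<in>UNIV. W s0 $ l * W' $ l)) (at s0)"
    by (auto intro!: derivative_eq_intros assms simp: sum_distrib_left mult_ac)
  have pos: "1 + (\<Sum>l\<in>UNIV. (W s0 $ l)\<^sup>2) > 0" by (simp add: add_pos_nonneg sum_nonneg)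
  show ?thesis
    using DERIV_chain2[OF DERIV_real_sqrt[OF pos] der] unfolding slope_altdef by (simp add: field_simps)
qed

lemma has_derivative_normalized:
  assumes W: "\<And>l. ((\<lambda>s. W s $ l) has_real_derivative W' $ l) (at s0)"
  shows "((\<lambda>s. W s $ i / slope (W s)) has_real_derivative (gmat (W s0) *v W') $ i) (at s0)"
proof -
  define w where "w = slope (W s0)"
  have w: "w > 0" by (simp add: w_def)
  have "((\<lambda>s. W s $ i / slope (W s)) has_real_derivative
     (W' $ i * w - W s0 $ i * ((W s0 \<bullet> W') / w)) / (w * w)) (at s0)"
    using DERIV_divide[OF W has_derivative_slope[of W W' s0], of i] W
    by (simp add: inner_vec_def w_def)
  also have "(W' $ i * w - W s0 $ i * ((W s0 \<bullet> W') / w)) / (w * w) = (gmat (W s0) *v W') $ i"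
    unfolding gmat_mult_vec w_def[symmetric] using w by (simp add: field_simps power3_eq_cube)
  finally show ?thesis .
qed

lemma has_derivative_gmat:
  assumes W: "\<And>l. ((\<lambda>s. W s $ l) has_real_derivative W' $ l) (at s0)"
  shows "((\<lambda>s. gmat (W s) $ i $ j) has_real_derivative (\<Sum>l\<in>UNIV. gmat_deriv (W s0) i j l * W' $ l)) (at s0)"
proof -
  define q where "q = W s0"
  define w where "w = slope q"
  define d where "d = (\<Sum>l\<in>UNIV. q $ l * W' $ l)"
  have w: "w > 0" by (simp add: w_def)
  have S: "((\<lambda>s. slope (W s)) has_real_derivative d / w) (at s0)"
    unfolding d_def w_def q_def by (rule has_derivative_slope[OF W])
  have "((\<lambda>s. gmat (W s) $ i $ j) has_real_derivative
     ((if i = j then - (d / w) / w\<^sup>2 else 0)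
      - ((W' $ i * q $ j + q $ i * W' $ j) * w ^ 3 - q $ i * q $ j * (3 * w\<^sup>2 * (d / w))) / (w ^ 3 * w ^ 3))) (at s0)"
    unfolding gmat_def using w
    by (auto intro!: derivative_eq_intros S W simp: q_def[symmetric] w_def[symmetric] power2_eq_square mult_ac)
  also have "((if i = j then - (d / w) / w\<^sup>2 else 0)
      - ((W' $ i * q $ j + q $ i * W' $ j) * w ^ 3 - q $ i * q $ j * (3 * w\<^sup>2 * (d / w))) / (w ^ 3 * w ^ 3))
      = 3 * q $ i * q $ j / w ^ 5 * d - (if i = j then d / w ^ 3 else 0)
         - W' $ i * q $ j / w ^ 3 - W' $ j * q $ i / w ^ 3"
    using w by (simp add: field_simps eval_nat_numeral)
  also have "\<dots> = (\<Sum>l\<in>UNIV. gmat_deriv q i j l * W' $ l)"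
  proof -
    have "gmat_deriv q i j l * W' $ l = 3 * q $ i * q $ j / w ^ 5 * (q $ l * W' $ l)
        - (if i = j then 1 / w ^ 3 * (q $ l * W' $ l) else 0)
        - (if i = l then W' $ l * q $ j / w ^ 3 else 0) - (if j = l then W' $ l * q $ i / w ^ 3 else 0)" (is "_ = ?t l") for l
      using w unfolding gmat_deriv_def w_def[symmetric] by (simp add: field_simps)
    then have "(\<Sum>l\<in>UNIV. gmat_deriv q i j l * W' $ l) = (\<Sum>l\<in>UNIV. ?t l)" by simp
    moreover have "(\<Sum>l\<in>UNIV. c * (q $ l * W' $ l) / x) = c * d / x" for c x
      by (simp add: d_def sum_distrib_left sum_divide_distrib)
    moreover have "(\<Sum>l\<in>UNIV. q $ l * W' $ l / x) = d / x" for x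
      by (simp add: d_def sum_divide_distrib)
    ultimately show ?thesis
      by (cases "i = j") (simp_all add: sum_subtractf)
  qed
  finally show ?thesis by (simp add: q_def)
qed

lemma continuous_on_slope: "(\<And>l. continuous_on S (\<lambda>x. W x $ l)) \<Longrightarrow> continuous_on S (\<lambda>x. slope (W x))"
  unfolding slope_altdef
  by (intro continuous_on_real_sqrt continuous_on_add continuous_on_const continuous_on_power continuous_on_sum)

lemma continuous_on_gmat:
  "(\<And>l. continuous_on S (\<lambda>x. W x $ l)) \<Longrightarrow> continuous_on S (\<lambda>x. gmat (W x) $ i $ j)"
  unfolding gmat_def
  by simp (intro continuous_on_diff continuous_on_divide continuous_on_mult continuous_on_if_const
      continuous_on_const continuous_on_power continuous_on_slope; simp)

lemma continuous_on_gmat_deriv: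
  assumes "\<And>l. continuous_on S (\<lambda>x. W x $ l)"
  shows "continuous_on S (\<lambda>x. gmat_deriv (W x) i j l)"
  unfolding gmat_deriv_def
  by (intro continuous_on_diff continuous_on_divide continuous_on_mult continuous_on_add
      continuous_on_if_const assms continuous_on_const continuous_on_power continuous_on_slope) simp_all

section \<open>Symmetry of mixed derivatives\<close>

lemma DERIV_line_shift:
  fixes y e :: "'a::real_vector"
  assumes "((\<lambda>s. f ((y + s0 *\<^sub>R e) + s *\<^sub>R e)) has_real_derivative d) (at 0)"
  shows "((\<lambda>s. f (y + s *\<^sub>R e)) has_real_derivative d) (at s0)"
proof -
  have eq: "(y + s0 *\<^sub>R e) + s *\<^sub>R e = y + (s + s0) *\<^sub>R e" for s by (simp add: algebra_simps)
  have "((\<lambda>s. f (y + (s + s0) *\<^sub>R e)) has_real_derivative d) (at 0)"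
    using assms by (simp only: eq)
  then show ?thesis using DERIV_shift[of "\<lambda>s. f (y + s *\<^sub>R e)" d 0 s0] by simp
qed

text \<open>The mean value theorem in direction \<open>d\<close>, applied to the difference of
  \<open>f\<close> across the step in direction \<open>e\<close>, and then in direction
  \<open>e\<close>.\<close>

lemma second_difference:
  fixes f :: "'a::real_normed_vector \<Rightarrow> real"
  assumes fd: "\<And>y. y \<in> ball x r \<Longrightarrow> ((\<lambda>s. f (y + s *\<^sub>R d)) has_real_derivative fd y) (at 0)"
    and fde: "\<And>y. y \<in> ball x r \<Longrightarrow> ((\<lambda>s. fd (y + s *\<^sub>R e)) has_real_derivative fde y) (at 0)"
    and unit: "norm d = 1" "norm e = 1" and h: "0 < h" "2 * h < r"
  shows "\<exists>z\<in>ball x (2 * h). f (x + h *\<^sub>R d + h *\<^sub>R e) - f (x + h *\<^sub>R d) - f (x + h *\<^sub>R e) + f x = h * h * fde z"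
proof -
  have dist_add: "dist x (x + v) = norm v" for v by (simp add: dist_norm)
  have ball: "x + s *\<^sub>R d + t *\<^sub>R e \<in> ball x r" if "0 \<le> s" "s \<le> h" "0 \<le> t" "t \<le> h" for s t
  proof -
    have "norm (s *\<^sub>R d + t *\<^sub>R e) \<le> \<bar>s\<bar> + \<bar>t\<bar>"
      using norm_triangle_ineq[of "s *\<^sub>R d" "t *\<^sub>R e"] unit by simp
    then have "dist x (x + (s *\<^sub>R d + t *\<^sub>R e)) < r" using that h by (simp only: dist_add)
    then show ?thesis by (simp add: add.assoc)
  qed
  have shift: "((\<lambda>s. f (x + s *\<^sub>R d + t *\<^sub>R e)) has_real_derivative fd (x + s *\<^sub>R d + t *\<^sub>R e)) (at s)"
    if "0 \<le> s" "s \<le> h" "0 \<le> t" "t \<le> h" for s t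
  proof -
    have "((\<lambda>u. f ((x + t *\<^sub>R e) + u *\<^sub>R d)) has_real_derivative fd (x + s *\<^sub>R d + t *\<^sub>R e)) (at s)"
      by (rule DERIV_line_shift) (use fd[OF ball[OF that]] in \<open>simp add: algebra_simps\<close>)
    then show ?thesis by (simp add: algebra_simps)
  qed
  define \<phi> where "\<phi> s = f (x + s *\<^sub>R d + h *\<^sub>R e) - f (x + s *\<^sub>R d + 0 *\<^sub>R e)" for s
  have "\<exists>z>0. z < h \<and> \<phi> h - \<phi> 0 = (h - 0) * (fd (x + z *\<^sub>R d + h *\<^sub>R e) - fd (x + z *\<^sub>R d + 0 *\<^sub>R e))"
    unfolding \<phi>_def using h(1) by (intro MVT2 DERIV_diff shift) auto
  then obtain s where s: "0 < s" "s < h" "\<phi> h - \<phi> 0 = h * (fd (x + s *\<^sub>R d + h *\<^sub>R e) - fd (x + s *\<^sub>R d))"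
    by auto
  have "\<exists>z>0. z < h \<and> fd (x + s *\<^sub>R d + h *\<^sub>R e) - fd (x + s *\<^sub>R d + 0 *\<^sub>R e) = (h - 0) * fde (x + s *\<^sub>R d + z *\<^sub>R e)"
  proof (rule MVT2[OF h(1)])
    fix u assume u: "0 \<le> u" "u \<le> h"
    show "((\<lambda>u. fd (x + s *\<^sub>R d + u *\<^sub>R e)) has_real_derivative fde (x + s *\<^sub>R d + u *\<^sub>R e)) (at u)"
      by (rule DERIV_line_shift, rule fde, rule ball) (use s u in auto)
  qed
  then obtain t where t: "0 < t" "t < h" "fd (x + s *\<^sub>R d + h *\<^sub>R e) - fd (x + s *\<^sub>R d) = h * fde (x + s *\<^sub>R d + t *\<^sub>R e)"
    by auto
  have "norm (s *\<^sub>R d + t *\<^sub>R e) \<le> s + t"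
    using norm_triangle_ineq[of "s *\<^sub>R d" "t *\<^sub>R e"] unit s t by simp
  then have "x + s *\<^sub>R d + t *\<^sub>R e \<in> ball x (2 * h)"
    using s t dist_add[of "s *\<^sub>R d + t *\<^sub>R e"] by (simp add: add.assoc)
  moreover have "f (x + h *\<^sub>R d + h *\<^sub>R e) - f (x + h *\<^sub>R d) - f (x + h *\<^sub>R e) + f x = h * h * fde (x + s *\<^sub>R d + t *\<^sub>R e)"
    using s(3) t(3) by (simp add: \<phi>_def)
  ultimately show ?thesis by blast
qed

text \<open>The second difference is symmetric in the two directions, so values of the two mixed
  derivatives at points arbitrarily close to \<open>x\<close> agree.\<close>

lemma mixed_derivatives_commute:
  fixes f :: "'a::real_normed_vector \<Rightarrow> real"
  assumes S: "open S" "x \<in> S" and unit: "norm d = 1" "norm e = 1"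
    and fd: "\<And>y. y \<in> S \<Longrightarrow> ((\<lambda>s. f (y + s *\<^sub>R d)) has_real_derivative fd y) (at 0)"
    and fe: "\<And>y. y \<in> S \<Longrightarrow> ((\<lambda>s. f (y + s *\<^sub>R e)) has_real_derivative fe y) (at 0)"
    and fde: "\<And>y. y \<in> S \<Longrightarrow> ((\<lambda>s. fd (y + s *\<^sub>R e)) has_real_derivative fde y) (at 0)"
    and fed: "\<And>y. y \<in> S \<Longrightarrow> ((\<lambda>s. fe (y + s *\<^sub>R d)) has_real_derivative fed y) (at 0)"
    and cont: "continuous_on S fde" "continuous_on S fed"
  shows "fde x = fed x"
proof (rule ccontr)
  assume "fde x \<noteq> fed x"
  define \<epsilon> where "\<epsilon> = \<bar>fde x - fed x\<bar> / 2"
  have \<epsilon>: "\<epsilon> > 0" using \<open>fde x \<noteq> fed x\<close> by (simp add: \<epsilon>_def)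
  obtain r where r: "r > 0" "ball x r \<subseteq> S" using S by (meson openE)
  have "isCont fde x" "isCont fed x" using cont S by (auto simp: continuous_on_eq_continuous_at)
  then obtain r1 r2 where r1: "r1 > 0" "\<And>y. dist y x < r1 \<Longrightarrow> dist (fde y) (fde x) < \<epsilon>"
    and r2: "r2 > 0" "\<And>y. dist y x < r2 \<Longrightarrow> dist (fed y) (fed x) < \<epsilon>"
    using \<epsilon> unfolding continuous_at_eps_delta by metis
  define h where "h = min r (min r1 r2) / 4"
  have h: "0 < h" "2 * h < r" "2 * h < r1" "2 * h < r2" using r(1) r1(1) r2(1) by (auto simp: h_def)
  obtain z1 where z1: "z1 \<in> ball x (2 * h)"
    "f (x + h *\<^sub>R d + h *\<^sub>R e) - f (x + h *\<^sub>R d) - f (x + h *\<^sub>R e) + f x = h * h * fde z1"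
    using second_difference[of x r f d fd e fde h] fd fde unit h r by blast
  obtain z2 where z2: "z2 \<in> ball x (2 * h)"
    "f (x + h *\<^sub>R e + h *\<^sub>R d) - f (x + h *\<^sub>R e) - f (x + h *\<^sub>R d) + f x = h * h * fed z2"
    using second_difference[of x r f e fe d fed h] fe fed unit h r by blast
  have "h * h * fde z1 = h * h * fed z2" using z1 z2 by (simp add: algebra_simps)
  then have "fde z1 = fed z2" using h by simp
  moreover have "dist (fde z1) (fde x) < \<epsilon>" using r1(2)[of z1] z1 h by (simp add: dist_commute)
  moreover have "dist (fed z2) (fed x) < \<epsilon>" using r2(2)[of z2] z2 h by (simp add: dist_commute)
  ultimately have "\<bar>fde x - fed x\<bar> < 2 * \<epsilon>" by (simp add: dist_real_def)
  then show False by (simp add: \<epsilon>_def)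
qed

section \<open>Partial derivatives, the Hessian and the Jacobian of Du / w\<close>

lemma has_derivative_imp_directional:
  fixes f :: "'a::real_normed_vector \<Rightarrow> real"
  assumes "(f has_derivative D) (at x)"
  shows "((\<lambda>s. f (x + s *\<^sub>R e)) has_real_derivative D e) (at 0)"
proof -
  have line: "((\<lambda>s. x + s *\<^sub>R e) has_derivative (\<lambda>s. s *\<^sub>R e)) (at 0)"
    by (auto intro!: derivative_eq_intros)
  have "((\<lambda>s. f (x + s *\<^sub>R e)) has_derivative (\<lambda>s. D (s *\<^sub>R e))) (at 0)"
    using has_derivative_compose[OF line, of f D] assms by simp
  moreover have "D (s *\<^sub>R e) = D e * s" for s
    using has_derivative_linear[OF assms] by (simp add: linear_scale mult.commute)
  ultimately show ?thesis by (simp add: has_field_derivative_def)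
qed

lemma partials_directional_derivative:
  assumes "open S" "x \<in> S" "partials is f differentiable_on S"
  shows "((\<lambda>s. partials is f (x + s *\<^sub>R axis j 1)) has_real_derivative partials (j # is) f x) (at 0)"
proof -
  have "partials is f differentiable (at x)"
    using assms by (metis at_within_open differentiable_on_def)
  then have "(partials is f has_derivative frechet_derivative (partials is f) (at x)) (at x)"
    by (simp add: frechet_derivative_works)
  from has_derivative_imp_directional[OF this] show ?thesis by (simp add: partial_def)
qed

lemma partials_commute:
  assumes S: "open S" "x \<in> S" and f: "\<And>m. Ck_on m S f"
  shows "partials (i # j # is) f x = partials (j # i # is) f x"
proof -
  have d: "partials is f differentiable_on S" and c: "continuous_on S (partials is f)" for "is"
    using f[of "Suc (length is)"] by (auto simp: Ck_on_def)
  have dd: "((\<lambda>s. partials js f (y + s *\<^sub>R axis l 1)) has_real_derivative partials (l # js) f y) (at 0)"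
    if "y \<in> S" for js l y
    by (rule partials_directional_derivative[OF S(1) that d])
  show ?thesis
    by (rule mixed_derivatives_commute[OF S, of "axis j 1" "axis i 1" "partials is f" "partials (j # is) f" "partials (i # is) f"])
       (use c dd in \<open>auto simp del: partials.simps\<close>)
qed

text \<open>The head of the list is the outermost derivative, so row i is the gradient of the i-th
  partial derivative. With this order \<open>hess\<close> is the Jacobian of \<open>grad\<close>
  before symmetry is known.\<close>

definition hess :: "(real^'n::finite \<Rightarrow> real) \<Rightarrow> real^'n \<Rightarrow> real^'n^'n" where
  "hess f x = (\<chi> i j. partials [j, i] f x)"

lemma grad_nth: "grad f x $ i = partials [i] f x"
  by (simp add: grad_def)

lemma hess_nth: "hess f x $ i $ j = partials [j, i] f x"
  by (simp add: hess_def)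

lemma graph_grad_eq: "graph_grad f x = grad f x /\<^sub>R slope (grad f x)"
  by (simp add: graph_grad_def slope_def)

text \<open>Total differentiability is secured first, with an unspecified derivative; its entries
  can then be identified by directional derivatives along the axes.\<close>

lemma jacobian_graph_grad:
  assumes S: "open S" "x \<in> S" and f: "\<And>m. Ck_on m S f"
  shows "jacobian (graph_grad f) (at x) = gmat (grad f x) ** hess f x"
proof -
  have d: "partials is f differentiable_on S" for "is"
    using f[of "Suc (length is)"] by (auto simp: Ck_on_def)
  have "partials [i] f differentiable (at x)" for i
    using d S by (metis at_within_open differentiable_on_def)
  then have "grad f differentiable (at x)"
    unfolding differentiable_componentwise_within[of "grad f"]
    by (auto simp: Basis_vec_def inner_axis grad_nth simp del: partials.simps)
  then obtain D where D: "(grad f has_derivative D) (at x)" by (auto simp: differentiable_def)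
  have "\<exists>D'. ((\<lambda>y. grad f y /\<^sub>R sqrt (1 + grad f y \<bullet> grad f y)) has_derivative D') (at x)"
    by (rule exI) (auto intro!: derivative_eq_intros D simp: add_pos_nonneg add_nonneg_eq_0_iff)
  then obtain D' where D': "(graph_grad f has_derivative D') (at x)"
    unfolding graph_grad_def power2_norm_eq_inner by auto
  have "D' (axis j 1) $ i = (gmat (grad f x) ** hess f x) $ i $ j" for i j
  proof -
    have "((\<lambda>y. graph_grad f y $ i) has_derivative (\<lambda>h. D' h $ i)) (at x)"
      using bounded_linear.has_derivative[OF bounded_linear_vec_nth D'] .
    from has_derivative_imp_directional[OF this]
    have "((\<lambda>s. graph_grad f (x + s *\<^sub>R axis j 1) $ i) has_real_derivative D' (axis j 1) $ i) (at 0)" .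
    moreover have "((\<lambda>s. grad f (x + s *\<^sub>R axis j 1) $ l) has_real_derivative (\<chi> l. hess f x $ l $ j) $ l) (at 0)" for l
      using partials_directional_derivative[OF S d, of "[l]" j] by (simp add: grad_nth hess_nth del: partials.simps)
    from has_derivative_normalized[OF this]
    have "((\<lambda>s. graph_grad f (x + s *\<^sub>R axis j 1) $ i) has_real_derivative
        (gmat (grad f (x + 0 *\<^sub>R axis j 1)) *v (\<chi> l. hess f x $ l $ j)) $ i) (at 0)"
      by (simp add: graph_grad_eq divide_inverse mult.commute)
    ultimately have "D' (axis j 1) $ i = (gmat (grad f (x + 0 *\<^sub>R axis j 1)) *v (\<chi> l. hess f x $ l $ j)) $ i"
      by (rule DERIV_unique)
    then show ?thesis by (simp add: matrix_matrix_mult_def matrix_vector_mult_def)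
  qed
  moreover have "frechet_derivative (graph_grad f) (at x) = D'"
    using frechet_derivative_at[OF D'] by simp
  ultimately show ?thesis
    by (simp add: jacobian_def matrix_def vec_eq_iff)
qed

lemma H_curv_eq:
  assumes "open S" "x \<in> S" "\<And>m. Ck_on m S f"
  shows "H_curv k f x = esigma k (gmat (grad f x) ** hess f x)"
  by (simp add: H_curv_def sigma_mat_eq_esigma jacobian_graph_grad[OF assms])

lemma transpose_hess:
  assumes "open S" "x \<in> S" "\<And>m. Ck_on m S f"
  shows "transpose (hess f x) = hess f x"
  by (simp add: transpose_def vec_eq_iff hess_nth partials_commute[OF assms] del: partials.simps)

section \<open>Integration of compactly supported functions\<close>

lemma continuous_on_extend_zero:
  fixes f :: "'a::topological_space \<Rightarrow> 'b::real_normed_vector"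
  assumes "open S" "closed K" "K \<subseteq> S" "continuous_on S f" "\<And>x. x \<in> S - K \<Longrightarrow> f x = 0"
  shows "continuous_on UNIV (\<lambda>x. if x \<in> S then f x else 0)"
proof -
  have "continuous_on (S \<union> - K) (\<lambda>x. if x \<in> S then f x else 0)"
  proof (rule continuous_on_open_Un)
    show "continuous_on S (\<lambda>x. if x \<in> S then f x else 0)"
      using assms(4) by (rule continuous_on_eq) simp
    show "continuous_on (- K) (\<lambda>x. if x \<in> S then f x else 0)"
      by (rule continuous_on_eq[of _ "\<lambda>_. 0"]) (use assms(5) in auto)
  qed (use assms in auto)
  moreover have "S \<union> - K = UNIV" using assms(3) by auto
  ultimately show ?thesis by simp
qed

text \<open>\<open>S\<close> and the complement of \<open>K\<close> form an open cover, and the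
  extension is locally either the given function or zero.\<close>

lemma directional_derivative_extend_zero:
  fixes f f' :: "'a::real_normed_vector \<Rightarrow> real"
  assumes S: "open S" "closed K" "K \<subseteq> S" and zero: "\<And>x. x \<in> S - K \<Longrightarrow> f x = 0"
    and d: "\<And>x. x \<in> S \<Longrightarrow> ((\<lambda>s. f (x + s *\<^sub>R e)) has_real_derivative f' x) (at 0)"
    and zero': "\<And>x. x \<in> S - K \<Longrightarrow> f' x = 0"
  shows "((\<lambda>s. if x + s *\<^sub>R e \<in> S then f (x + s *\<^sub>R e) else 0) has_real_derivative (if x \<in> S then f' x else 0)) (at 0)"
proof -
  have ev: "eventually (\<lambda>s. x + s *\<^sub>R e \<in> T) (nhds 0)" if "open T" "x \<in> T" for T
  proof -
    have "((\<lambda>s. x + s *\<^sub>R e) \<longlongrightarrow> x + 0 *\<^sub>R e) (nhds 0)"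
      by (intro tendsto_intros filterlim_ident)
    then show ?thesis using that by (auto dest: topological_tendstoD)
  qed
  show ?thesis
  proof (cases "x \<in> S")
    case True
    have "eventually (\<lambda>s. (if x + s *\<^sub>R e \<in> S then f (x + s *\<^sub>R e) else 0) = f (x + s *\<^sub>R e)) (nhds 0)"
      using ev[OF S(1) True] by eventually_elim simp
    then show ?thesis using d[OF True] True DERIV_cong_ev[OF refl _ refl] by fastforce
  next
    case False
    then have "x \<in> - K" using S by auto
    then have "eventually (\<lambda>s. (if x + s *\<^sub>R e \<in> S then f (x + s *\<^sub>R e) else 0) = 0) (nhds 0)"
      using ev[OF open_Compl[OF S(2)]] by (auto elim!: eventually_mono intro: zero)
    then have "((\<lambda>s. if x + s *\<^sub>R e \<in> S then f (x + s *\<^sub>R e) else 0) has_real_derivative 0) (at 0)"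
      using DERIV_cong_ev[OF refl, of "\<lambda>s. if x + s *\<^sub>R e \<in> S then f (x + s *\<^sub>R e) else 0" "\<lambda>_. 0" 0 0 0] by simp
    then show ?thesis using False by simp
  qed
qed

lemma lborel_integral_eq_box:
  fixes f :: "'a::euclidean_space \<Rightarrow> real"
  assumes "continuous_on UNIV f" "\<And>x. x \<notin> cbox a b \<Longrightarrow> f x = 0"
  shows "integrable lborel f" "(LINT x|lborel. f x) = integral (cbox a b) f"
proof -
  have ind: "(\<lambda>x. indicator (cbox a b) x *\<^sub>R f x) = f"
    using assms(2) by (auto simp: indicator_def fun_eq_iff)
  have "integrable lborel (\<lambda>x. indicator (cbox a b) x *\<^sub>R f x)"
    by (rule borel_integrable_compact) (use assms(1) continuous_on_subset in auto)
  then have "set_integrable lborel (cbox a b) f" by (simp add: set_integrable_def)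
  from set_borel_integral_eq_integral(2)[OF this]
  show "(LINT x|lborel. f x) = integral (cbox a b) f"
    by (simp only: set_lebesgue_integral_def ind)
  show "integrable lborel f"
    using \<open>integrable lborel (\<lambda>x. indicator (cbox a b) x *\<^sub>R f x)\<close> by (simp only: ind)
qed

lemma has_derivative_lborel_integral:
  fixes F F' :: "real \<Rightarrow> 'a::euclidean_space \<Rightarrow> real"
  assumes d: "\<And>s x. s \<in> U \<Longrightarrow> ((\<lambda>s. F s x) has_real_derivative F' s x) (at s within U)"
    and F: "\<And>s. s \<in> U \<Longrightarrow> continuous_on UNIV (F s)"
    and F': "continuous_on (U \<times> UNIV) (\<lambda>(s, x). F' s x)"
    and zero: "\<And>s x. s \<in> U \<Longrightarrow> x \<notin> cbox a b \<Longrightarrow> F s x = 0" "\<And>s x. s \<in> U \<Longrightarrow> x \<notin> cbox a b \<Longrightarrow> F' s x = 0"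
    and U: "s0 \<in> U" "convex U"
  shows "((\<lambda>s. LINT x|lborel. F s x) has_real_derivative (LINT x|lborel. F' s0 x)) (at s0 within U)"
proof -
  have "((\<lambda>s. integral (cbox a b) (F s)) has_real_derivative integral (cbox a b) (F' s0)) (at s0 within U)"
  proof (rule leibniz_rule_field_derivative)
    show "F s integrable_on cbox a b" if "s \<in> U" for s
      using F[OF that] integrable_continuous continuous_on_subset by blast
    show "continuous_on (U \<times> cbox a b) (\<lambda>(s, x). F' s x)"
      using F' by (rule continuous_on_subset) auto
  qed (use d U in auto)
  moreover have "continuous_on UNIV (F' s0)"
  proof -
    have "continuous_on UNIV (\<lambda>x. (\<lambda>(s, x). F' s x) (s0, x))"
      by (rule continuous_on_compose2[OF F']) (use U in \<open>auto intro!: continuous_intros\<close>)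
    then show ?thesis by simp
  qed
  then have "(LINT x|lborel. F' s0 x) = integral (cbox a b) (F' s0)"
    by (rule lborel_integral_eq_box) (use zero U in auto)
  moreover have "(LINT x|lborel. F s x) = integral (cbox a b) (F s)" if "s \<in> U" for s
    by (rule lborel_integral_eq_box[OF F[OF that]]) (use zero that in auto)
  ultimately show ?thesis
    using has_field_derivative_transform_within[of "\<lambda>s. integral (cbox a b) (F s)" _ s0 U 1 "\<lambda>s. LINT x|lborel. F s x"] U(1)
    by simp
qed

text \<open>The integral of g (x + s e) does not depend on s by translation invariance.
  Differentiating under the integral sign gives the claim, which takes the place of the divergence
  theorem.\<close>

lemma lborel_integral_directional_derivative:
  fixes g g' :: "'a::euclidean_space \<Rightarrow> real"
  assumes g: "continuous_on UNIV g" and g': "continuous_on UNIV g'"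
    and d: "\<And>x. ((\<lambda>s. g (x + s *\<^sub>R e)) has_real_derivative g' x) (at 0)"
    and K: "bounded K" "\<And>x. x \<notin> K \<Longrightarrow> g x = 0" "\<And>x. x \<notin> K \<Longrightarrow> g' x = 0"
  shows "(LINT x|lborel. g' x) = 0"
proof -
  \<comment> \<open>A single box must contain the supports of all translates with |s| at most
    1.\<close>
  have "bounded ((\<lambda>(x, s). x - s *\<^sub>R e) ` (K \<times> {-1..1}))"
  proof -
    obtain B where B: "\<And>x. x \<in> K \<Longrightarrow> norm x \<le> B" using K(1) by (auto simp: bounded_iff)
    have "norm (x - s *\<^sub>R e) \<le> B + norm e" if "x \<in> K" "s \<in> {-1..1}" for x s
    proof -
      have "norm (x - s *\<^sub>R e) \<le> norm x + \<bar>s\<bar> * norm e"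
        using norm_triangle_ineq4[of x "s *\<^sub>R e"] by simp
      also have "\<bar>s\<bar> * norm e \<le> 1 * norm e" using that by (intro mult_right_mono) auto
      finally show ?thesis using B[OF that(1)] by simp
    qed
    then show ?thesis by (force simp: bounded_iff)
  qed
  then obtain a b where ab: "(\<lambda>(x, s). x - s *\<^sub>R e) ` (K \<times> {-1..1}) \<subseteq> cbox a b"
    using bounded_subset_cbox_symmetric by metis
  have notK: "x + s *\<^sub>R e \<notin> K" if "s \<in> {-1..1}" "x \<notin> cbox a b" for x s
    using ab that by (force simp: image_subset_iff)
  have "((\<lambda>s. LINT x|lborel. g (x + s *\<^sub>R e)) has_real_derivative (LINT x|lborel. g' (x + 0 *\<^sub>R e))) (at 0 within {-1..1})"
  proof (rule has_derivative_lborel_integral[where a = a and b = b])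
    show "((\<lambda>s. g (x + s *\<^sub>R e)) has_real_derivative g' (x + s *\<^sub>R e)) (at s within {-1..1})" for s x
      by (rule DERIV_subset[OF DERIV_line_shift[OF d]]) simp
    show "continuous_on UNIV (\<lambda>x. g (x + s *\<^sub>R e))" for s
      by (rule continuous_on_compose2[OF g]) (auto intro!: continuous_intros)
    show "continuous_on ({-1..1} \<times> UNIV) (\<lambda>(s, x). g' (x + s *\<^sub>R e))"
      unfolding case_prod_beta by (rule continuous_on_compose2[OF g']) (auto intro!: continuous_intros)
  qed (use notK K in auto)
  moreover have "(LINT x|lborel. g (x + s *\<^sub>R e)) = (LINT x|lborel. g x)" for s
  proof -
    have "(LINT x|lborel. g x) = (LINT x|distr lborel borel ((+) (s *\<^sub>R e)). g x)"
      by (simp add: lborel_distr_plus)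
    also have "\<dots> = (LINT x|lborel. g (s *\<^sub>R e + x))"
      using g by (intro integral_distr) (auto intro: borel_measurable_continuous_onI)
    finally show ?thesis by (simp add: add.commute)
  qed
  ultimately have "((\<lambda>s. LINT x|lborel. g x) has_real_derivative (LINT x|lborel. g' x)) (at 0 within {-1..1})"
    by simp
  moreover have "((\<lambda>s. LINT x|lborel. g x) has_real_derivative 0) (at 0 within {-1..1})" by simp
  moreover have "at 0 within {-1..1::real} = at 0" by (rule at_within_interior) simp
  ultimately show ?thesis by (metis DERIV_unique)
qed

section \<open>Interpolation between two graphs\<close>

locale graph_pair =
  fixes S :: "(real^'n::finite) set" and u v :: "real^'n \<Rightarrow> real"
  assumes open_S: "open S" and smooth_u: "\<And>m. Ck_on m S u" and smooth_v: "\<And>m. Ck_on m S v"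
begin

text \<open>Minus the gradient of psi; the sign reappears in front of \<open>\<theta>\<close> in the
  integration by parts.\<close>

definition dgrad :: "real^'n \<Rightarrow> real^'n" where
  "dgrad x = grad u x - grad v x"

definition dhess :: "real^'n \<Rightarrow> real^'n^'n" where
  "dhess x = hess u x - hess v x"

text \<open>The gradient of u_t; \<open>R t\<close> below is its Hessian, \<open>T t\<close> its
  third derivatives.\<close>

definition W :: "real \<Rightarrow> real^'n \<Rightarrow> real^'n" where
  "W t x = grad v x + t *\<^sub>R dgrad x"

definition R :: "real \<Rightarrow> real^'n \<Rightarrow> real^'n^'n" where
  "R t x = hess v x + t *\<^sub>R dhess x"

text \<open>The Jacobian of p = Du_t / w; \<open>B t\<close> below holds its derivatives in
  x.\<close>

definition A :: "real \<Rightarrow> real^'n \<Rightarrow> real^'n^'n" where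
  "A t x = gmat (W t x) ** R t x"

text \<open>The t-derivative of p.\<close>

definition V :: "real \<Rightarrow> real^'n \<Rightarrow> real^'n" where
  "V t x = gmat (W t x) *v dgrad x"

text \<open>Both the derivative of \<open>A\<close> in \<open>t\<close> and the Jacobian of \<open>V\<close> in \<open>x\<close>.\<close>
definition E :: "real \<Rightarrow> real^'n \<Rightarrow> real^'n^'n" where
  "E t x = (\<chi> i j. \<Sum>l\<in>UNIV. (\<Sum>m\<in>UNIV. gmat_deriv (W t x) i l m * dgrad x $ m) * R t x $ l $ j
     + gmat (W t x) $ i $ l * dhess x $ l $ j)"

definition T :: "real \<Rightarrow> real^'n \<Rightarrow> 'n \<Rightarrow> 'n \<Rightarrow> 'n \<Rightarrow> real" where
  "T t x l j m = partials [m, j, l] v x + t * (partials [m, j, l] u x - partials [m, j, l] v x)"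

definition B :: "real \<Rightarrow> real^'n \<Rightarrow> 'n \<Rightarrow> 'n \<Rightarrow> 'n \<Rightarrow> real" where
  "B t x i j m = (\<Sum>l\<in>UNIV. (\<Sum>r\<in>UNIV. gmat_deriv (W t x) i l r * R t x $ r $ m) * R t x $ l $ j
     + gmat (W t x) $ i $ l * T t x l j m)"

lemma differentiable_partials:
  "partials is u differentiable_on S" "partials is v differentiable_on S"
  using smooth_u[of "Suc (length is)"] smooth_v[of "Suc (length is)"] by (auto simp: Ck_on_def)

lemma continuous_partials:
  "continuous_on S (partials is u)" "continuous_on S (partials is v)"
  using smooth_u[of "length is"] smooth_v[of "length is"] by (auto simp: Ck_on_def)

lemma partials_deriv:
  assumes "x \<in> S"
  shows "((\<lambda>s. partials is u (x + s *\<^sub>R axis j 1)) has_real_derivative partials (j # is) u x) (at 0)"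
    "((\<lambda>s. partials is v (x + s *\<^sub>R axis j 1)) has_real_derivative partials (j # is) v x) (at 0)"
  by (rule partials_directional_derivative[OF open_S assms differentiable_partials(1)]
      partials_directional_derivative[OF open_S assms differentiable_partials(2)])+

lemma W_nth: "W t x $ i = partials [i] v x + t * (partials [i] u x - partials [i] v x)"
  by (simp add: W_def dgrad_def grad_nth del: partials.simps)

lemma R_nth: "R t x $ i $ j = partials [j, i] v x + t * (partials [j, i] u x - partials [j, i] v x)"
  by (simp add: R_def dhess_def hess_nth del: partials.simps)

lemma A_nth: "A t x $ i $ j = (\<Sum>l\<in>UNIV. gmat (W t x) $ i $ l * R t x $ l $ j)"
  by (simp add: A_def matrix_matrix_mult_def)

lemma V_nth: "V t x $ i = (\<Sum>l\<in>UNIV. gmat (W t x) $ i $ l * dgrad x $ l)"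
  by (simp add: V_def matrix_vector_mult_def)

lemma W_deriv:
  "x \<in> S \<Longrightarrow> ((\<lambda>s. W t (x + s *\<^sub>R axis m 1) $ l) has_real_derivative (\<chi> r. R t x $ r $ m) $ l) (at 0)"
  unfolding W_nth using partials_deriv[of x "[l]" m]
  by (auto intro!: derivative_eq_intros simp: R_nth simp del: partials.simps)

lemma R_deriv:
  "x \<in> S \<Longrightarrow> ((\<lambda>s. R t (x + s *\<^sub>R axis m 1) $ l $ j) has_real_derivative T t x l j m) (at 0)"
  unfolding R_nth T_def using partials_deriv[of x "[j, l]" m]
  by (auto intro!: derivative_eq_intros simp del: partials.simps)

lemma dgrad_deriv:
  "x \<in> S \<Longrightarrow> ((\<lambda>s. dgrad (x + s *\<^sub>R axis m 1) $ l) has_real_derivative dhess x $ l $ m) (at 0)"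
  unfolding dgrad_def dhess_def using partials_deriv[of x "[l]" m]
  by (auto intro!: derivative_eq_intros simp: grad_nth hess_nth simp del: partials.simps)

lemma gmat_W_deriv:
  assumes "x \<in> S"
  shows "((\<lambda>s. gmat (W t (x + s *\<^sub>R axis m 1)) $ i $ l) has_real_derivative
    (\<Sum>r\<in>UNIV. gmat_deriv (W t x) i l r * R t x $ r $ m)) (at 0)"
  using has_derivative_gmat[of "\<lambda>s. W t (x + s *\<^sub>R axis m 1)", OF W_deriv[OF assms]] by simp

lemma A_deriv:
  assumes "x \<in> S"
  shows "((\<lambda>s. A t (x + s *\<^sub>R axis m 1) $ i $ j) has_real_derivative B t x i j m) (at 0)"
  unfolding A_nth B_def
  using DERIV_sum[of UNIV, OF DERIV_mult[OF gmat_W_deriv[OF assms] R_deriv[OF assms]]]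
  by (simp add: mult.commute)

lemma V_deriv:
  assumes "x \<in> S"
  shows "((\<lambda>s. V t (x + s *\<^sub>R axis j 1) $ i) has_real_derivative E t x $ i $ j) (at 0)"
proof -
  have "((\<lambda>s. V t (x + s *\<^sub>R axis j 1) $ i) has_real_derivative
     (\<Sum>l\<in>UNIV. (\<Sum>r\<in>UNIV. gmat_deriv (W t x) i l r * R t x $ r $ j) * dgrad x $ l + dhess x $ l $ j * gmat (W t x) $ i $ l)) (at 0)"
    unfolding V_nth
    using DERIV_sum[of UNIV, OF DERIV_mult[OF gmat_W_deriv[OF assms] dgrad_deriv[OF assms]]] by simp
  \<comment> \<open>The symmetry of \<open>gmat_deriv\<close> in its last two indices exchanges the
    roles of Hessian and \<open>dgrad\<close>; this is the equality of the derivative of p in t and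
    x with that in x and t.\<close>
  moreover have "(\<Sum>l\<in>UNIV. (\<Sum>r\<in>UNIV. gmat_deriv (W t x) i l r * R t x $ r $ j) * dgrad x $ l) =
      (\<Sum>r\<in>UNIV. (\<Sum>l\<in>UNIV. gmat_deriv (W t x) i r l * dgrad x $ l) * R t x $ r $ j)"
    unfolding sum_distrib_right
    by (subst sum.swap, intro sum.cong refl) (subst gmat_deriv_commute, simp add: mult_ac)
  ultimately show ?thesis
    by (simp add: E_def sum.distrib mult.commute)
qed

lemma A_deriv_t: "((\<lambda>t. A t x $ i $ j) has_real_derivative E t x $ i $ j) (at t)"
proof -
  have "((\<lambda>t. W t x $ l) has_real_derivative dgrad x $ l) (at t)" for l
    unfolding W_def by (auto intro!: derivative_eq_intros)
  from has_derivative_gmat[OF this]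
  have g: "((\<lambda>t. gmat (W t x) $ i $ l) has_real_derivative (\<Sum>m\<in>UNIV. gmat_deriv (W t x) i l m * dgrad x $ m)) (at t)" for l .
  have r: "((\<lambda>t. R t x $ l $ j) has_real_derivative dhess x $ l $ j) (at t)" for l
    unfolding R_def by (auto intro!: derivative_eq_intros)
  show ?thesis
    unfolding A_nth E_def using DERIV_sum[of UNIV, OF DERIV_mult[OF g r]] by (simp add: mult.commute)
qed

text \<open>These are second derivatives of the i-th component of p. Their symmetry is the
  hypothesis under which the cofactors are divergence-free.\<close>

lemma B_sym: "x \<in> S \<Longrightarrow> B t x i j m = B t x i m j"
proof -
  assume x: "x \<in> S"
  have T: "T t x l j m = T t x l m j" for l
    using partials_commute[OF open_S x smooth_u, of j m "[l]"] partials_commute[OF open_S x smooth_v, of j m "[l]"]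
    by (simp add: T_def del: partials.simps)
  have "(\<Sum>l\<in>UNIV. (\<Sum>r\<in>UNIV. gmat_deriv (W t x) i l r * R t x $ r $ m) * R t x $ l $ j) =
     (\<Sum>l\<in>UNIV. (\<Sum>r\<in>UNIV. gmat_deriv (W t x) i l r * R t x $ r $ j) * R t x $ l $ m)"
    unfolding sum_distrib_right
    by (subst sum.swap, intro sum.cong refl) (subst gmat_deriv_commute, simp add: mult_ac)
  then show ?thesis by (simp add: B_def sum.distrib T)
qed

lemma continuous_on_W_R_T_dgrad_dhess:
  shows "continuous_on (UNIV \<times> S) (\<lambda>p. W (fst p) (snd p) $ i)"
    and "continuous_on (UNIV \<times> S) (\<lambda>p. R (fst p) (snd p) $ i $ j)"
    and "continuous_on (UNIV \<times> S) (\<lambda>p. T (fst p) (snd p) i j m)"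
    and "continuous_on (UNIV \<times> S) (\<lambda>p :: real \<times> (real^'n). dgrad (snd p) $ i)"
    and "continuous_on (UNIV \<times> S) (\<lambda>p :: real \<times> (real^'n). dhess (snd p) $ i $ j)"
proof -
  have c: "continuous_on (UNIV \<times> S) (\<lambda>p :: real \<times> (real^'n). partials is u (snd p))"
    "continuous_on (UNIV \<times> S) (\<lambda>p :: real \<times> (real^'n). partials is v (snd p))" for "is"
    by (rule continuous_on_compose2[OF continuous_partials(1)] continuous_on_compose2[OF continuous_partials(2)];
        auto intro: continuous_on_snd)+
  note intros = continuous_on_add continuous_on_diff continuous_on_mult c continuous_on_fst continuous_on_id
  show "continuous_on (UNIV \<times> S) (\<lambda>p. W (fst p) (snd p) $ i)"
    unfolding W_nth by (intro intros)
  show "continuous_on (UNIV \<times> S) (\<lambda>p. R (fst p) (snd p) $ i $ j)"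
    unfolding R_nth by (intro intros)
  show "continuous_on (UNIV \<times> S) (\<lambda>p. T (fst p) (snd p) i j m)"
    unfolding T_def by (intro intros)
  show "continuous_on (UNIV \<times> S) (\<lambda>p :: real \<times> (real^'n). dgrad (snd p) $ i)"
    by (simp add: dgrad_def grad_nth del: partials.simps) (intro intros)
  show "continuous_on (UNIV \<times> S) (\<lambda>p :: real \<times> (real^'n). dhess (snd p) $ i $ j)"
    by (simp add: dhess_def hess_nth del: partials.simps) (intro intros)
qed

lemma continuous_on_A_E_B_V:
  shows "continuous_on (UNIV \<times> S) (\<lambda>p. A (fst p) (snd p) $ i $ j)"
    and "continuous_on (UNIV \<times> S) (\<lambda>p. E (fst p) (snd p) $ i $ j)"
    and "continuous_on (UNIV \<times> S) (\<lambda>p. B (fst p) (snd p) i j m)"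
    and "continuous_on (UNIV \<times> S) (\<lambda>p. V (fst p) (snd p) $ i)"
proof -
  note intros = continuous_on_sum continuous_on_add continuous_on_mult continuous_on_W_R_T_dgrad_dhess
    continuous_on_gmat continuous_on_gmat_deriv
  show "continuous_on (UNIV \<times> S) (\<lambda>p. A (fst p) (snd p) $ i $ j)"
    unfolding A_nth by (intro intros)
  show "continuous_on (UNIV \<times> S) (\<lambda>p. E (fst p) (snd p) $ i $ j)"
    unfolding E_def vec_lambda_beta by (intro intros)
  show "continuous_on (UNIV \<times> S) (\<lambda>p. B (fst p) (snd p) i j m)"
    unfolding B_def by (intro intros)
  show "continuous_on (UNIV \<times> S) (\<lambda>p. V (fst p) (snd p) $ i)"
    unfolding V_nth by (intro intros)
qed

lemma continuous_on_slice:
  assumes "continuous_on (UNIV \<times> S) (\<lambda>p. f (fst p) (snd p))"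
  shows "continuous_on S (f t)"
proof -
  have "continuous_on S (\<lambda>x. (\<lambda>p. f (fst p) (snd p)) (t, x))"
    by (rule continuous_on_compose2[OF assms]) (auto intro!: continuous_intros)
  then show ?thesis by simp
qed

text \<open>The sign of the factor that meets the gradient of the cutoff. The line of gradients
  starts at that of \<open>v\<close> and has direction \<open>dgrad\<close>.\<close>

lemma dsigma_boundary_term_nonneg:
  assumes k: "0 < k" "k \<le> CARD('n)" and t: "t \<in> {0..1}" and x: "x \<in> S"
    and u: "\<And>j. j \<in> {1..k} \<Longrightarrow> H_curv j u x \<ge> 0" and v: "\<And>j. j \<in> {1..k} \<Longrightarrow> H_curv j v x \<ge> 0"
  shows "dsigma k (A t x) (tensor (V t x) (dgrad x)) \<ge> 0"
proof -
  have "\<exists>c\<ge>0. \<forall>s. esigma k (gmat (grad v x + t *\<^sub>R dgrad x) ** (hess v x + t *\<^sub>R (hess u x - hess v x))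
      + s *\<^sub>R tensor (gmat (grad v x + t *\<^sub>R dgrad x) *v dgrad x) (dgrad x))
    = esigma k (gmat (grad v x + t *\<^sub>R dgrad x) ** (hess v x + t *\<^sub>R (hess u x - hess v x))) + s * c"
  proof (rule esigma_gmat_rank_one_interpolation[OF k t])
    show "transpose (hess v x) = hess v x" "transpose (hess u x) = hess u x"
      using transpose_hess[OF open_S x] smooth_u smooth_v by blast+
    show "0 \<le> esigma j (gmat (grad v x) ** hess v x)" if "j \<in> {1..k}" for j
      using v[OF that] H_curv_eq[OF open_S x smooth_v] by simp
    show "0 \<le> esigma j (gmat (grad v x + dgrad x) ** hess u x)" if "j \<in> {1..k}" for j
      using u[OF that] H_curv_eq[OF open_S x smooth_u] by (simp add: dgrad_def)
  qed
  then obtain c where "c \<ge> 0" "\<And>s. esigma k (A t x + s *\<^sub>R tensor (V t x) (dgrad x)) = esigma k (A t x) + s * c"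
    unfolding A_def V_def W_def R_def dhess_def by blast
  then show ?thesis using dsigma_eqI[of k "A t x" "tensor (V t x) (dgrad x)" c] by simp
qed

text \<open>The divergence of \<zeta> S^ij V_i has integral zero. It splits into \<zeta> times the
  t-derivative of \<open>esigma k (A t x)\<close> and -\<open>\<theta>\<close> times the nonnegative
  term above, so the t-derivative of the integral is nonnegative on [0, 1].\<close>

lemma integral_esigma_mono:
  fixes \<zeta> \<theta> :: "real^'n \<Rightarrow> real"
  assumes k: "0 < k" "k \<le> CARD('n)"
    and H: "\<And>j x. j \<in> {1..k} \<Longrightarrow> x \<in> S \<Longrightarrow> H_curv j u x \<ge> 0"
      "\<And>j x. j \<in> {1..k} \<Longrightarrow> x \<in> S \<Longrightarrow> H_curv j v x \<ge> 0"
    and K: "compact K" "K \<subseteq> S"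
    and \<zeta>: "continuous_on S \<zeta>" "\<And>x. x \<in> S - K \<Longrightarrow> \<zeta> x = 0"
    and \<zeta>': "\<And>x j. x \<in> S \<Longrightarrow> ((\<lambda>s. \<zeta> (x + s *\<^sub>R axis j 1)) has_real_derivative - \<theta> x * dgrad x $ j) (at 0)"
    and \<theta>: "continuous_on S \<theta>" "\<And>x. x \<in> S - K \<Longrightarrow> \<theta> x = 0" "\<And>x. x \<in> S \<Longrightarrow> \<theta> x \<ge> 0"
  shows "(LINT x|lborel. (if x \<in> S then \<zeta> x * esigma k (A 0 x) else 0))
       \<le> (LINT x|lborel. (if x \<in> S then \<zeta> x * esigma k (A 1 x) else 0))"
proof -
  have closedK: "closed K" using K by (simp add: compact_imp_closed)
  obtain a b where ab: "K \<subseteq> cbox a b"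
    using compact_imp_bounded[OF K(1)] bounded_subset_cbox_symmetric by metis
  have cs: "continuous_on UNIV (\<lambda>x. if x \<in> S then f x else 0)"
    if "continuous_on S f" "\<And>x. x \<in> S - K \<Longrightarrow> f x = 0" for f :: "real^'n \<Rightarrow> real"
    by (rule continuous_on_extend_zero[OF open_S closedK K(2) that])
  have integr: "integrable lborel (\<lambda>x. if x \<in> S then f x else 0)"
    if "continuous_on S f" "\<And>x. x \<in> S - K \<Longrightarrow> f x = 0" for f :: "real^'n \<Rightarrow> real"
    by (rule lborel_integral_eq_box(1)[OF cs[OF that], of a b]) (use that ab in auto)
  have cont_A: "continuous_on S (\<lambda>x. A t x $ i $ j)" for t i j
    by (rule continuous_on_slice[OF continuous_on_A_E_B_V(1)])
  have cont_E: "continuous_on S (\<lambda>x. E t x $ i $ j)" for t i j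
    by (rule continuous_on_slice[OF continuous_on_A_E_B_V(2)])
  have cont_B: "continuous_on S (\<lambda>x. B t x i j m)" for t i j m
    by (rule continuous_on_slice[OF continuous_on_A_E_B_V(3)])
  have cont_V: "continuous_on S (\<lambda>x. V t x $ i)" for t i
    by (rule continuous_on_slice[OF continuous_on_A_E_B_V(4)])
  have cont_d: "continuous_on S (\<lambda>x. dgrad x $ i)" for i
    by (rule continuous_on_slice[OF continuous_on_W_R_T_dgrad_dhess(4)])

  have nonneg: "(LINT x|lborel. (if x \<in> S then \<zeta> x * dsigma k (A t x) (E t x) else 0)) \<ge> 0"
    if t: "t \<in> {0..1}" for t
  proof -
    \<comment> \<open>The cutoff is absorbed into the field; by the product rule \<open>Z\<close> is
      the Jacobian of \<open>Y\<close>.\<close>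
    define Y where "Y x = \<zeta> x *\<^sub>R V t x" for x
    define Z where "Z x = (- \<theta> x) *\<^sub>R tensor (V t x) (dgrad x) + \<zeta> x *\<^sub>R E t x" for x
    have Y_deriv: "((\<lambda>s. Y (x + s *\<^sub>R axis j 1) $ i) has_real_derivative Z x $ i $ j) (at 0)" if "x \<in> S" for x i j
      using DERIV_mult[OF \<zeta>'[OF that, of j] V_deriv[OF that, of t j i]]
      by (simp add: Y_def Z_def tensor_def algebra_simps)
    have cont_Y: "continuous_on S (\<lambda>x. Y x $ i)" for i
      unfolding Y_def by (simp, intro continuous_on_mult \<zeta> cont_V)
    have cont_Z: "continuous_on S (\<lambda>x. Z x $ i $ j)" for i j
      unfolding Z_def by (simp add: tensor_def)
        (intro continuous_on_diff continuous_on_add continuous_on_minus continuous_on_mult \<zeta> \<theta> cont_V cont_d cont_E)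
    have zeroY: "Y x = 0" and zeroZ: "Z x = 0" if "x \<in> S - K" for x
      using \<zeta>(2)[OF that] \<theta>(2)[OF that] by (simp_all add: Y_def Z_def)
    \<comment> \<open>Inserting the tensor product with the j-th basis vector into
      \<open>dsigma\<close> extracts the j-th component of the field S^ij Y_i.\<close>
    define g where "g j x = dsigma k (A t x) (tensor (Y x) (axis j 1))" for j x
    define g' where "g' j x = ddsigma k j (A t x) (B t x) (Y x) (Z x)" for j x
    have cont_g: "continuous_on S (g j)" for j
      unfolding g_def by (intro continuous_on_dsigma cont_A)
        (simp add: tensor_def, intro continuous_on_mult cont_Y continuous_on_const)
    have cont_g': "continuous_on S (g' j)" for j
      unfolding g'_def by (intro continuous_on_ddsigma cont_A cont_B cont_Y cont_Z)
    have zero_g: "g j x = 0" and zero_g': "g' j x = 0" if "x \<in> S - K" for j x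
      using zeroY[OF that] zeroZ[OF that] by (auto simp: g_def g'_def dsigma_def ddsigma_def tensor_def intro!: sum.neutral)
    have deriv_g: "((\<lambda>s. g j (x + s *\<^sub>R axis j 1)) has_real_derivative g' j x) (at 0)" if "x \<in> S" for j x
      using has_derivative_dsigma_tensor[of "\<lambda>s. A t (x + s *\<^sub>R axis j 1)" "B t x" j 0 "\<lambda>s. Y (x + s *\<^sub>R axis j 1)" "Z x" k]
        A_deriv[OF that] Y_deriv[OF that] by (simp add: g_def g'_def)
    have "(LINT x|lborel. (if x \<in> S then g' j x else 0)) = 0" for j
    proof (rule lborel_integral_directional_derivative[where K = K and e = "axis j 1" and g = "\<lambda>x. if x \<in> S then g j x else 0"])
      show "continuous_on UNIV (\<lambda>x. if x \<in> S then g j x else 0)" by (rule cs[OF cont_g zero_g])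
      show "continuous_on UNIV (\<lambda>x. if x \<in> S then g' j x else 0)" by (rule cs[OF cont_g' zero_g'])
      show "((\<lambda>s. if x + s *\<^sub>R axis j 1 \<in> S then g j (x + s *\<^sub>R axis j 1) else 0) has_real_derivative
          (if x \<in> S then g' j x else 0)) (at 0)" for x
        by (rule directional_derivative_extend_zero[OF open_S closedK K(2) zero_g deriv_g zero_g'])
      show "bounded K" by (rule compact_imp_bounded[OF K(1)])
    qed (use zero_g zero_g' in auto)
    then have "0 = (\<Sum>j\<in>UNIV. LINT x|lborel. (if x \<in> S then g' j x else 0))" by simp
    also have "\<dots> = (LINT x|lborel. (\<Sum>j\<in>UNIV. if x \<in> S then g' j x else 0))"
      by (rule Bochner_Integration.integral_sum[symmetric]) (rule integr[OF cont_g' zero_g'])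
    also have "(\<lambda>x. \<Sum>j\<in>UNIV. if x \<in> S then g' j x else 0) =
       (\<lambda>x. (if x \<in> S then \<zeta> x * dsigma k (A t x) (E t x) else 0)
         - (if x \<in> S then \<theta> x * dsigma k (A t x) (tensor (V t x) (dgrad x)) else 0))"
    proof
      fix x
      show "(\<Sum>j\<in>UNIV. if x \<in> S then g' j x else 0) =
        (if x \<in> S then \<zeta> x * dsigma k (A t x) (E t x) else 0)
         - (if x \<in> S then \<theta> x * dsigma k (A t x) (tensor (V t x) (dgrad x)) else 0)"
      proof (cases "x \<in> S")
        case True
        then have "(\<Sum>j\<in>UNIV. g' j x) = dsigma k (A t x) (Z x)"
          unfolding g'_def by (intro sum_ddsigma B_sym)
        also have "\<dots> = - \<theta> x * dsigma k (A t x) (tensor (V t x) (dgrad x)) + \<zeta> x * dsigma k (A t x) (E t x)"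
          unfolding Z_def dsigma_add dsigma_scale ..
        finally show ?thesis using True by simp
      qed simp
    qed
    also have "(LINT x|lborel. (if x \<in> S then \<zeta> x * dsigma k (A t x) (E t x) else 0)
         - (if x \<in> S then \<theta> x * dsigma k (A t x) (tensor (V t x) (dgrad x)) else 0)) =
        (LINT x|lborel. (if x \<in> S then \<zeta> x * dsigma k (A t x) (E t x) else 0))
        - (LINT x|lborel. (if x \<in> S then \<theta> x * dsigma k (A t x) (tensor (V t x) (dgrad x)) else 0))"
    proof (rule Bochner_Integration.integral_diff)
      show "integrable lborel (\<lambda>x. if x \<in> S then \<zeta> x * dsigma k (A t x) (E t x) else 0)"
        by (rule integr) (use \<zeta> cont_A cont_E in \<open>auto intro!: continuous_on_mult continuous_on_dsigma\<close>)
      show "integrable lborel (\<lambda>x. if x \<in> S then \<theta> x * dsigma k (A t x) (tensor (V t x) (dgrad x)) else 0)"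
      proof (rule integr)
        have "continuous_on S (\<lambda>x. tensor (V t x) (dgrad x) $ i $ j)" for i j
          by (simp add: tensor_def) (intro continuous_on_mult cont_V cont_d)
        then show "continuous_on S (\<lambda>x. \<theta> x * dsigma k (A t x) (tensor (V t x) (dgrad x)))"
          by (intro continuous_on_mult continuous_on_dsigma cont_A \<theta>)
      qed (use \<theta> in auto)
    qed
    finally have "(LINT x|lborel. (if x \<in> S then \<zeta> x * dsigma k (A t x) (E t x) else 0)) =
        (LINT x|lborel. (if x \<in> S then \<theta> x * dsigma k (A t x) (tensor (V t x) (dgrad x)) else 0))" by simp
    also have "\<dots> \<ge> 0"
      by (rule Bochner_Integration.integral_nonneg)
         (use \<theta>(3) H dsigma_boundary_term_nonneg[OF k t] in auto)
    finally show ?thesis .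
  qed

  define F where "F t x = (if x \<in> S then \<zeta> x * esigma k (A t x) else 0)" for t x
  define F' where "F' t x = (if x \<in> S then \<zeta> x * dsigma k (A t x) (E t x) else 0)" for t x
  have deriv: "((\<lambda>t. LINT x|lborel. F t x) has_real_derivative (LINT x|lborel. F' t x)) (at t)" for t
  proof (rule has_derivative_lborel_integral[where U = UNIV and a = a and b = b])
    fix t x
    have "((\<lambda>t. esigma k (A t x)) has_real_derivative dsigma k (A t x) (E t x)) (at t)"
      by (rule has_derivative_esigma[OF A_deriv_t])
    then have "((\<lambda>t. \<zeta> x * esigma k (A t x)) has_real_derivative \<zeta> x * dsigma k (A t x) (E t x)) (at t)"
      by (rule DERIV_cmult)
    then show "((\<lambda>t. F t x) has_real_derivative F' t x) (at t)"
      by (simp add: F_def F'_def)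
  next
    fix t
    show "continuous_on UNIV (F t)"
      unfolding F_def by (rule cs) (use \<zeta> cont_A in \<open>auto intro!: continuous_on_mult continuous_on_esigma\<close>)
  next
    have \<zeta>c: "continuous_on (UNIV \<times> S) (\<lambda>p :: real \<times> (real^'n). \<zeta> (snd p))"
      by (rule continuous_on_compose2[OF \<zeta>(1)]) (auto intro: continuous_on_snd)
    have "continuous_on UNIV (\<lambda>p. if p \<in> UNIV \<times> S then \<zeta> (snd p) * dsigma k (A (fst p) (snd p)) (E (fst p) (snd p)) else 0)"
    proof (rule continuous_on_extend_zero)
      show "open (UNIV \<times> S)" by (intro open_Times open_S) simp
      show "closed (UNIV \<times> K :: (real \<times> (real^'n)) set)" by (intro closed_Times closedK) simp
      show "continuous_on (UNIV \<times> S) (\<lambda>p. \<zeta> (snd p) * dsigma k (A (fst p) (snd p)) (E (fst p) (snd p)))"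
        by (intro continuous_on_mult \<zeta>c continuous_on_dsigma continuous_on_A_E_B_V)
      show "\<zeta> (snd p) * dsigma k (A (fst p) (snd p)) (E (fst p) (snd p)) = 0"
        if "p \<in> UNIV \<times> S - UNIV \<times> K" for p
        using that \<zeta>(2)[of "snd p"] by (auto simp: mem_Times_iff)
    qed (use K in auto)
    then show "continuous_on (UNIV \<times> UNIV) (\<lambda>(t, x). F' t x)"
      by (simp add: F'_def case_prod_beta mem_Times_iff)
  qed (use ab \<zeta>(2) in \<open>auto simp: F_def F'_def\<close>)
  have "(LINT x|lborel. F 0 x) \<le> (LINT x|lborel. F 1 x)"
    by (rule DERIV_nonneg_imp_nondecreasing) (use deriv nonneg in \<open>auto simp: F'_def\<close>)
  then show ?thesis by (simp add: F_def)
qed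

lemma esigma_A_endpoints:
  assumes "x \<in> S"
  shows "esigma k (A 0 x) = H_curv k v x" "esigma k (A 1 x) = H_curv k u x"
  by (simp_all add: A_def W_def R_def dgrad_def dhess_def
      H_curv_eq[OF open_S assms smooth_u] H_curv_eq[OF open_S assms smooth_v])

end

section \<open>Behaviour near the boundary\<close>

lemma grad_directional_derivative:
  assumes "open S" "x \<in> S" "f differentiable_on S"
  shows "((\<lambda>s. f (x + s *\<^sub>R e)) has_real_derivative grad f x \<bullet> e) (at 0)"
proof -
  have "f differentiable (at x)"
    using assms by (metis at_within_open differentiable_on_def)
  then have D: "(f has_derivative frechet_derivative f (at x)) (at x)"
    by (simp add: frechet_derivative_works)
  let ?D = "frechet_derivative f (at x)"
  have "linear ?D" using D by (rule has_derivative_linear)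
  have "?D e = ?D (\<Sum>i\<in>UNIV. e $ i *\<^sub>R axis i 1)"
    using basis_expansion[of e] by (simp add: scalar_mult_eq_scaleR)
  also have "\<dots> = (\<Sum>i\<in>UNIV. e $ i * ?D (axis i 1))"
    using \<open>linear ?D\<close> by (simp add: linear_sum linear_scale)
  also have "\<dots> = grad f x \<bullet> e"
    by (simp add: grad_def partial_def inner_vec_def mult.commute)
  finally show ?thesis using has_derivative_imp_directional[OF D, of e] by simp
qed

text \<open>By the mean value theorem, difference quotients at the boundary point are directional
  derivatives at interior points of the segment, and these converge by continuity of the extended
  gradient.\<close>

lemma outward_deriv_eq:
  assumes S: "open S" and f: "f differentiable_on S" "continuous_on (closure S) f"
    and g: "continuous_on (closure S) g" "\<And>y. y \<in> S \<Longrightarrow> g y = grad f y"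
    and x: "x \<in> closure S" and \<delta>: "\<delta> > 0" "\<And>t. - \<delta> < t \<Longrightarrow> t < 0 \<Longrightarrow> x + t *\<^sub>R \<nu> \<in> S"
  shows "outward_deriv f \<nu> x = g x \<bullet> \<nu>"
proof -
  define \<phi> where "\<phi> t = f (x + t *\<^sub>R \<nu>)" for t
  have deriv: "(\<phi> has_real_derivative g (x + t *\<^sub>R \<nu>) \<bullet> \<nu>) (at t)" if "- \<delta> < t" "t < 0" for t
    unfolding \<phi>_def g(2)[OF \<delta>(2)[OF that]]
    by (rule DERIV_line_shift, rule grad_directional_derivative[OF S \<delta>(2)[OF that] f(1)])
  have clos: "x + t *\<^sub>R \<nu> \<in> closure S" if "- \<delta> < t" "t \<le> 0" for t
    using \<delta>(2)[of t] that x closure_subset by (cases "t = 0") auto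
  have cont: "continuous_on {a..0} \<phi>" if "- \<delta> < a" for a
    unfolding \<phi>_def by (rule continuous_on_compose2[OF f(2)]) (use clos that in \<open>auto intro!: continuous_intros\<close>)
  have cont': "continuous_on {- \<delta> <..0} (\<lambda>t. g (x + t *\<^sub>R \<nu>) \<bullet> \<nu>)"
    by (intro continuous_on_inner continuous_on_const continuous_on_compose2[OF g(1)])
       (use clos in \<open>auto intro!: continuous_intros\<close>)
  have "(\<phi> has_real_derivative g x \<bullet> \<nu>) (at_left 0)"
    unfolding has_field_derivative_iff
  proof (rule tendstoI)
    fix \<epsilon> :: real assume "\<epsilon> > 0"
    then obtain \<eta> where \<eta>: "\<eta> > 0" "\<And>t. t \<in> {- \<delta> <..0} \<Longrightarrow> dist t 0 < \<eta> \<Longrightarrow>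
        dist (g (x + t *\<^sub>R \<nu>) \<bullet> \<nu>) (g (x + 0 *\<^sub>R \<nu>) \<bullet> \<nu>) < \<epsilon>"
      using cont' \<delta>(1) unfolding continuous_on_iff by (metis greaterThanAtMost_iff neg_less_0_iff_less order_refl)
    have "dist ((\<phi> t - \<phi> 0) / (t - 0)) (g x \<bullet> \<nu>) < \<epsilon>" if t: "- \<delta> < t" "- \<eta> < t" "t < 0" for t
    proof -
      have "\<exists>l z. t < z \<and> z < 0 \<and> DERIV \<phi> z :> l \<and> \<phi> 0 - \<phi> t = (0 - t) * l"
      proof (rule MVT)
        show "\<phi> differentiable (at z)" if "t < z" "z < 0" for z
          using deriv[of z] t that by (auto simp: real_differentiable_def)
      qed (use t cont in auto)
      then obtain l z where z: "t < z" "z < 0" "DERIV \<phi> z :> l" "\<phi> 0 - \<phi> t = (0 - t) * l" by blast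
      have "DERIV \<phi> z :> g (x + z *\<^sub>R \<nu>) \<bullet> \<nu>" by (rule deriv) (use z t in auto)
      then have "l = g (x + z *\<^sub>R \<nu>) \<bullet> \<nu>" using z(3) DERIV_unique by blast
      moreover have "(\<phi> t - \<phi> 0) / (t - 0) = l" using z(4) t by (simp add: field_simps)
      ultimately show ?thesis using \<eta>(2)[of z] z t by (simp add: dist_real_def)
    qed
    then have "eventually (\<lambda>t. dist ((\<phi> t - \<phi> 0) / (t - 0)) (g x \<bullet> \<nu>) < \<epsilon>) (at_left 0)"
      using \<delta>(1) \<eta>(1) by (intro eventually_at_leftI[of "- min \<delta> \<eta>"]) (auto simp: min_def split: if_splits)
    then show "eventually (\<lambda>t. dist ((\<phi> t - \<phi> 0) / (t - 0)) (g x \<bullet> \<nu>) < \<epsilon>) (at_left 0)" .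
  qed
  then have "(\<phi> has_vector_derivative g x \<bullet> \<nu>) (at_left 0)"
    by (simp add: has_real_derivative_iff_has_vector_derivative)
  then have "vector_derivative \<phi> (at_left 0) = g x \<bullet> \<nu>"
    by (intro vector_derivative_within) auto
  then show ?thesis by (simp add: outward_deriv_def \<phi>_def[abs_def])
qed

text \<open>The parameters in [0, s1] that lead outside \<open>S\<close> form a compact set; take
  its minimum.\<close>

lemma first_exit:
  fixes y \<nu> :: "'a::real_normed_vector"
  assumes S: "open S" "y \<in> S" and s1: "s1 > 0" "y + s1 *\<^sub>R \<nu> \<notin> S"
  obtains s where "0 < s" "s \<le> s1" "y + s *\<^sub>R \<nu> \<in> frontier S" "\<And>r. 0 \<le> r \<Longrightarrow> r < s \<Longrightarrow> y + r *\<^sub>R \<nu> \<in> S"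
proof -
  define C where "C = {0..s1} \<inter> (\<lambda>s. y + s *\<^sub>R \<nu>) -` (- S)"
  have "closed C"
    unfolding C_def by (intro continuous_closed_preimage continuous_intros) (use S in auto)
  then have "compact C" by (auto simp: C_def compact_eq_bounded_closed intro: bounded_subset[of "{0..s1}"])
  moreover have "s1 \<in> C" using s1 by (simp add: C_def)
  then have "C \<noteq> {}" by auto
  ultimately obtain s where s: "s \<in> C" "\<And>r. r \<in> C \<Longrightarrow> s \<le> r"
    using compact_attains_inf[of C] by metis
  have "s \<noteq> 0" using s(1) S(2) by (auto simp: C_def)
  then have pos: "0 < s" "s \<le> s1" using s(1) by (auto simp: C_def)
  have before: "y + r *\<^sub>R \<nu> \<in> S" if "0 \<le> r" "r < s" for r
    using s(2)[of r] that pos by (auto simp: C_def not_le)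
  have "((\<lambda>r. y + r *\<^sub>R \<nu>) \<longlongrightarrow> y + s *\<^sub>R \<nu>) (at_left s)"
    by (intro tendsto_intros)
  moreover have "eventually (\<lambda>r. y + r *\<^sub>R \<nu> \<in> closure S) (at_left s)"
    using pos before closure_subset by (intro eventually_at_leftI[of 0]) force+
  ultimately have "y + s *\<^sub>R \<nu> \<in> closure S"
    by (intro Lim_in_closed_set[of "closure S" _ "at_left s"]) auto
  moreover have "y + s *\<^sub>R \<nu> \<notin> S" using s(1) by (simp add: C_def)
  ultimately have "y + s *\<^sub>R \<nu> \<in> frontier S" using S(1) by (simp add: frontier_def interior_open)
  then show thesis using that pos before by blast
qed

lemma smooth_on_closure_extension:
  assumes "smooth_on_closure S f"
  obtains g h where "continuous_on (closure S) g" "\<And>x. x \<in> S \<Longrightarrow> g x = grad f x"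
    "\<And>i j. continuous_on (closure S) (\<lambda>x. h x $ i $ j)" "\<And>x. x \<in> S \<Longrightarrow> h x = hess f x"
proof -
  obtain e where e: "\<And>is. continuous_on (closure S) (e is)" "\<And>is x. x \<in> S \<Longrightarrow> e is x = partials is f x"
    using assms unfolding smooth_on_closure_def by metis
  show thesis
  proof
    show "continuous_on (closure S) (\<lambda>x. \<chi> i. e [i] x)" by (intro continuous_on_vec_lambda e)
    show "continuous_on (closure S) (\<lambda>x. (\<chi> i j. e [j, i] x) $ i $ j)" for i j by (simp add: e)
  qed (simp_all add: e grad_nth hess_nth vec_eq_iff del: partials.simps)
qed

text \<open>
  Moving from a point near the boundary in the outward direction, one leaves \<open>\<Omega>\<close> through a boundary
  point, where \<open>u = v\<close>, and \<open>u - v\<close> increases on the way.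
\<close>
lemma less_near_frontier_point:
  fixes \<Omega> :: "(real^'n::finite) set"
  assumes \<Omega>: "open \<Omega>" and normal: "unit_outer_normal \<Omega> \<gamma>"
    and u: "smooth_on_closure \<Omega> u" and v: "smooth_on_closure \<Omega> v"
    and eq: "\<forall>x\<in>frontier \<Omega>. u x = v x"
    and od: "outward_deriv u (\<gamma> x0) x0 > outward_deriv v (\<gamma> x0) x0"
    and x0: "x0 \<in> frontier \<Omega>" and def: "defining_function \<Omega> x0 U \<rho>"
  shows "\<exists>r>0. \<forall>y\<in>ball x0 r \<inter> \<Omega>. u y < v y"
proof -
  have du: "u differentiable_on \<Omega>" "v differentiable_on \<Omega>"
    using u v unfolding smooth_on_closure_def Ck_on_def by (metis partials.simps(1) list.size(3) zero_less_one)+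
  have cu: "continuous_on (closure \<Omega>) u" "continuous_on (closure \<Omega>) v"
    using u v by (auto simp: smooth_on_closure_def)
  obtain gu where gu: "continuous_on (closure \<Omega>) gu" "\<And>x. x \<in> \<Omega> \<Longrightarrow> gu x = grad u x"
    using smooth_on_closure_extension[OF u] by metis
  obtain gv where gv: "continuous_on (closure \<Omega>) gv" "\<And>x. x \<in> \<Omega> \<Longrightarrow> gv x = grad v x"
    using smooth_on_closure_extension[OF v] by metis
  have U: "open U" "x0 \<in> U" and \<rho>: "Ck_on 1 U \<rho>" and g\<rho>: "grad \<rho> x0 \<noteq> 0"
    and \<rho>neg: "\<And>y. y \<in> U \<Longrightarrow> y \<in> \<Omega> \<longleftrightarrow> \<rho> y < 0" and \<rho>0: "\<rho> x0 = 0"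
    using def x0 by (auto simp: defining_function_def)
  have d\<rho>: "\<rho> differentiable_on U"
    using \<rho> unfolding Ck_on_def by (metis partials.simps(1) list.size(3) zero_less_one)
  have "continuous_on U (partials [i] \<rho>)" for i
    using \<rho> by (auto simp: Ck_on_def simp del: partials.simps)
  then have cg\<rho>: "continuous_on U (grad \<rho>)"
    by (simp add: grad_def continuous_on_vec_lambda)
  define \<nu> where "\<nu> = \<gamma> x0"
  have \<nu>: "\<nu> = grad \<rho> x0 /\<^sub>R norm (grad \<rho> x0)"
    using normal x0 def by (auto simp: unit_outer_normal_def \<nu>_def)
  then have norm\<nu>: "norm \<nu> = 1" using g\<rho> by simp
  define c where "c = norm (grad \<rho> x0) / 2"
  have c: "c > 0" using g\<rho> by (simp add: c_def)
  have "grad \<rho> x0 \<bullet> \<nu> = 2 * c"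
    unfolding \<nu> c_def using g\<rho> by (simp add: power2_norm_eq_inner[symmetric] power2_eq_square)
  moreover have "isCont (\<lambda>y. grad \<rho> y \<bullet> \<nu>) x0"
    using continuous_on_inner[OF cg\<rho> continuous_on_const] U by (auto simp: continuous_on_eq_continuous_at)
  ultimately have "eventually (\<lambda>y. grad \<rho> y \<bullet> \<nu> > c) (nhds x0)"
    using c by (intro order_tendstoD) (auto simp: isCont_def tendsto_nhds_iff)
  moreover have "eventually (\<lambda>y. y \<in> U) (nhds x0)" using U by (simp add: eventually_nhds_in_open)
  ultimately have "eventually (\<lambda>y. y \<in> U \<and> grad \<rho> y \<bullet> \<nu> > c) (nhds x0)" by eventually_elim simp
  then obtain R where R: "R > 0" "\<And>y. dist y x0 < R \<Longrightarrow> y \<in> U \<and> grad \<rho> y \<bullet> \<nu> > c"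
    by (auto simp: eventually_nhds_metric)
  have deriv\<rho>: "((\<lambda>s. \<rho> (y + s *\<^sub>R \<nu>)) has_real_derivative grad \<rho> (y + s *\<^sub>R \<nu>) \<bullet> \<nu>) (at s)"
    if "dist (y + s *\<^sub>R \<nu>) x0 < R" for y s
    by (rule DERIV_line_shift, rule grad_directional_derivative[OF U(1) _ d\<rho>]) (use R(2)[OF that] in auto)
  have grow: "\<rho> (y + s *\<^sub>R \<nu>) \<ge> \<rho> y + c * s" if "0 < s" "dist y x0 + s < R" for y s
  proof -
    have near: "dist (y + r *\<^sub>R \<nu>) x0 < R" if "0 \<le> r" "r \<le> s" for r
    proof -
      have "dist (y + r *\<^sub>R \<nu>) x0 \<le> dist (y + r *\<^sub>R \<nu>) y + dist y x0" by (rule dist_triangle)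
      also have "dist (y + r *\<^sub>R \<nu>) y = r" using that norm\<nu> by (simp add: dist_norm)
      finally show ?thesis using that \<open>dist y x0 + s < R\<close> by simp
    qed
    have "\<exists>z>0. z < s \<and> \<rho> (y + s *\<^sub>R \<nu>) - \<rho> (y + 0 *\<^sub>R \<nu>) = (s - 0) * (grad \<rho> (y + z *\<^sub>R \<nu>) \<bullet> \<nu>)"
      by (rule MVT2[OF that(1)]) (use deriv\<rho> near in auto)
    then obtain z where z: "0 < z" "z < s" "\<rho> (y + s *\<^sub>R \<nu>) - \<rho> y = s * (grad \<rho> (y + z *\<^sub>R \<nu>) \<bullet> \<nu>)" by auto
    have "c * s \<le> s * (grad \<rho> (y + z *\<^sub>R \<nu>) \<bullet> \<nu>)"
      using R(2)[OF near[of z]] z that by simp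
    then show ?thesis using z(3) by linarith
  qed
  have inside: "x0 + t *\<^sub>R \<nu> \<in> \<Omega>" if t: "- (R / 2) < t" "t < 0" for t
  proof -
    have d: "dist (x0 + t *\<^sub>R \<nu>) x0 = - t" using t norm\<nu> by (simp add: dist_norm)
    have "\<rho> (x0 + t *\<^sub>R \<nu>) + c * (- t) \<le> \<rho> ((x0 + t *\<^sub>R \<nu>) + (- t) *\<^sub>R \<nu>)"
      by (rule grow) (use t d in auto)
    then have "\<rho> (x0 + t *\<^sub>R \<nu>) \<le> c * t" using \<rho>0 by simp
    also have "\<dots> < 0" using c t by (simp add: mult_pos_neg)
    finally show ?thesis using \<rho>neg R(2)[of "x0 + t *\<^sub>R \<nu>"] d t by simp
  qed
  have x0c: "x0 \<in> closure \<Omega>" using x0 by (simp add: frontier_def)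
  have R2: "R / 2 > 0" using R by simp
  have "gv x0 \<bullet> \<nu> < gu x0 \<bullet> \<nu>"
    using od outward_deriv_eq[OF \<Omega> du(1) cu(1) gu x0c R2 inside] outward_deriv_eq[OF \<Omega> du(2) cu(2) gv x0c R2 inside]
    by (simp add: \<nu>_def)
  then have pos: "(gu x0 - gv x0) \<bullet> \<nu> > 0" by (simp add: inner_diff_left)
  have "continuous_on (closure \<Omega>) (\<lambda>y. (gu y - gv y) \<bullet> \<nu>)"
    by (intro continuous_on_inner continuous_on_diff gu gv continuous_on_const)
  then have "((\<lambda>y. (gu y - gv y) \<bullet> \<nu>) \<longlongrightarrow> (gu x0 - gv x0) \<bullet> \<nu>) (at x0 within closure \<Omega>)"
    using x0c by (simp add: continuous_on_def)
  from order_tendstoD(1)[OF this pos]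
  obtain R1 where R1: "R1 > 0" "\<And>y. y \<in> closure \<Omega> \<Longrightarrow> y \<noteq> x0 \<Longrightarrow> dist y x0 < R1 \<Longrightarrow> (gu y - gv y) \<bullet> \<nu> > 0"
    by (auto simp: eventually_at)
  \<comment> \<open>A walk of length at most \<open>s1\<close> from a point within \<open>s1\<close>
    of \<open>x0\<close> stays within 2 \<open>s1\<close>, inside both radii.\<close>
  define s1 where "s1 = min R R1 / 4"
  have s1: "s1 > 0" using R R1 by (simp add: s1_def)
  have s1R: "4 * s1 \<le> R" "4 * s1 \<le> R1" by (simp_all add: s1_def)
  have "isCont \<rho> x0"
    using d\<rho> U by (metis continuous_on_eq_continuous_at differentiable_imp_continuous_on)
  \<comment> \<open>Over length \<open>s1\<close> the function \<open>\<rho>\<close> gains at least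
    c s1, so a walk that starts above -c s1 ends with \<open>\<rho>\<close> positive, outside the
    domain.\<close>
  then have "eventually (\<lambda>y. \<rho> y > - (c * s1)) (nhds x0)"
    using c s1 \<rho>0 by (intro order_tendstoD(1)[of \<rho> 0]) (auto simp: isCont_def tendsto_nhds_iff)
  then obtain r where r: "r > 0" "\<And>y. dist y x0 < r \<Longrightarrow> \<rho> y > - (c * s1)"
    by (auto simp: eventually_nhds_metric)
  show ?thesis
  proof (intro exI[of _ "min r s1"] conjI ballI)
    show "min r s1 > 0" using r s1 by simp
  next
    fix y assume "y \<in> ball x0 (min r s1) \<inter> \<Omega>"
    then have y: "dist y x0 < r" "dist y x0 < s1" "y \<in> \<Omega>" by (auto simp: dist_commute)
    have near: "dist (y + s *\<^sub>R \<nu>) x0 < 2 * s1" if "0 \<le> s" "s \<le> s1" for s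
    proof -
      have "dist (y + s *\<^sub>R \<nu>) x0 \<le> dist (y + s *\<^sub>R \<nu>) y + dist y x0" by (rule dist_triangle)
      also have "dist (y + s *\<^sub>R \<nu>) y = s" using that norm\<nu> by (simp add: dist_norm)
      finally show ?thesis using that y by simp
    qed
    have "\<rho> (y + s1 *\<^sub>R \<nu>) \<ge> \<rho> y + c * s1"
      by (rule grow[OF s1]) (use y s1 s1R in linarith)
    then have "\<rho> (y + s1 *\<^sub>R \<nu>) > 0" using r(2)[OF y(1)] by simp
    moreover have "y + s1 *\<^sub>R \<nu> \<in> U" using R(2)[of "y + s1 *\<^sub>R \<nu>"] near[of s1] s1 s1R by simp
    ultimately have "y + s1 *\<^sub>R \<nu> \<notin> \<Omega>" using \<rho>neg by auto
    then obtain s where s: "0 < s" "s \<le> s1" "y + s *\<^sub>R \<nu> \<in> frontier \<Omega>"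
      "\<And>r. 0 \<le> r \<Longrightarrow> r < s \<Longrightarrow> y + r *\<^sub>R \<nu> \<in> \<Omega>"
      using first_exit[OF \<Omega> y(3) s1] by metis
    have clos: "y + r *\<^sub>R \<nu> \<in> closure \<Omega>" if "0 \<le> r" "r \<le> s" for r
    proof (cases "r = s")
      case True
      then show ?thesis using s(3) by (simp add: frontier_def)
    next
      case False
      then show ?thesis using s(4)[of r] that closure_subset by auto
    qed
    have "u (y + 0 *\<^sub>R \<nu>) - v (y + 0 *\<^sub>R \<nu>) < u (y + s *\<^sub>R \<nu>) - v (y + s *\<^sub>R \<nu>)"
    proof (rule DERIV_pos_imp_increasing_open[OF s(1)])
      show "continuous_on {0..s} (\<lambda>r. u (y + r *\<^sub>R \<nu>) - v (y + r *\<^sub>R \<nu>))"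
        by (intro continuous_on_diff continuous_on_compose2[OF cu(1)] continuous_on_compose2[OF cu(2)])
           (use clos in \<open>auto intro!: continuous_intros\<close>)
    next
      fix q assume q: "0 < q" "q < s"
      then have mem: "y + q *\<^sub>R \<nu> \<in> \<Omega>" using s(4) by simp
      have "((\<lambda>r. u (y + r *\<^sub>R \<nu>) - v (y + r *\<^sub>R \<nu>)) has_real_derivative
          grad u (y + q *\<^sub>R \<nu>) \<bullet> \<nu> - grad v (y + q *\<^sub>R \<nu>) \<bullet> \<nu>) (at q)"
        by (intro DERIV_diff; rule DERIV_line_shift, rule grad_directional_derivative[OF \<Omega> mem]) (use du in auto)
      moreover have "y + q *\<^sub>R \<nu> \<noteq> x0" using mem x0 \<Omega> by (auto simp: frontier_def interior_open)
      then have "(gu (y + q *\<^sub>R \<nu>) - gv (y + q *\<^sub>R \<nu>)) \<bullet> \<nu> > 0"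
        using near[of q] q s s1 s1R clos[of q] by (intro R1(2)) auto
      then have "grad u (y + q *\<^sub>R \<nu>) \<bullet> \<nu> - grad v (y + q *\<^sub>R \<nu>) \<bullet> \<nu> > 0"
        using gu(2)[OF mem] gv(2)[OF mem] by (simp add: inner_diff_left)
      ultimately show "\<exists>d. ((\<lambda>r. u (y + r *\<^sub>R \<nu>) - v (y + r *\<^sub>R \<nu>)) has_real_derivative d) (at q) \<and> 0 < d"
        by blast
    qed
    then show "u y < v y" using eq s(3) by simp
  qed
qed

section \<open>Cutoff functions near the boundary\<close>

text \<open>On [0, 1] this is 1 - (1 - y^2)^2, whose derivative vanishes at both ends. Composing the
  C^1 function (max 0 y)^2 with itself joins the pieces, and C^1 suffices because the cutoff is
  differentiated once.\<close>

definition smoothstep :: "real \<Rightarrow> real" where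
  "smoothstep y = 1 - (max 0 (1 - (max 0 y)\<^sup>2))\<^sup>2"

definition smoothstep' :: "real \<Rightarrow> real" where
  "smoothstep' y = 4 * max 0 (1 - (max 0 y)\<^sup>2) * max 0 y"

lemma has_derivative_max0_squared: "((\<lambda>y. (max 0 y)\<^sup>2) has_real_derivative 2 * max 0 y) (at y)"
proof -
  consider "y < 0" | "y = 0" | "y > 0" by linarith
  then show ?thesis
  proof cases
    case 1
    then have "eventually (\<lambda>x. (max 0 x)\<^sup>2 = 0) (nhds y)"
      using eventually_nhds_in_open[of "{..<0}" y] by (auto elim!: eventually_mono simp: max_def)
    then show ?thesis using DERIV_cong_ev[OF refl, of "\<lambda>x. (max 0 x)\<^sup>2" "\<lambda>_. 0" y 0 0] 1 by (simp add: max_def)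
  next
    case 2
    have "((\<lambda>h. ((max 0 h)\<^sup>2 - (max 0 0)\<^sup>2) / (h - 0)) \<longlongrightarrow> (0::real)) (at 0)"
    proof (rule Lim_null_comparison)
      show "eventually (\<lambda>h::real. norm (((max 0 h)\<^sup>2 - (max 0 0)\<^sup>2) / (h - 0)) \<le> \<bar>h\<bar>) (at 0)"
        by (intro always_eventually) (auto simp: max_def power2_eq_square)
      show "((\<lambda>h::real. \<bar>h\<bar>) \<longlongrightarrow> 0) (at 0)"
        by (rule tendsto_eq_intros refl | simp)+
    qed
    then show ?thesis using 2 by (simp add: has_field_derivative_iff)
  next
    case 3
    then have "eventually (\<lambda>x. (max 0 x)\<^sup>2 = x\<^sup>2) (nhds y)"
      using eventually_nhds_in_open[of "{0<..}" y] by (auto elim!: eventually_mono simp: max_def)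
    moreover have "((\<lambda>x. x\<^sup>2) has_real_derivative 2 * y) (at y)"
      by (auto intro!: derivative_eq_intros)
    ultimately show ?thesis using DERIV_cong_ev[OF refl, of "\<lambda>x. (max 0 x)\<^sup>2" "\<lambda>x. x\<^sup>2" y "2 * y" "2 * y"] 3 by simp
  qed
qed

lemma smoothstep_deriv: "(smoothstep has_real_derivative smoothstep' y) (at y)"
proof -
  have "((\<lambda>y. 1 - (max 0 y)\<^sup>2) has_real_derivative 0 - 2 * max 0 y) (at y)"
    by (intro DERIV_diff DERIV_const has_derivative_max0_squared)
  from DERIV_chain2[OF has_derivative_max0_squared this]
  have "((\<lambda>y. 1 - (max 0 (1 - (max 0 y)\<^sup>2))\<^sup>2) has_real_derivative
     0 - 2 * max 0 (1 - (max 0 y)\<^sup>2) * (0 - 2 * max 0 y)) (at y)"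
    by (intro DERIV_diff DERIV_const)
  then show ?thesis by (simp add: smoothstep_def[abs_def] smoothstep'_def mult_ac)
qed

lemma smoothstep_simps:
  "y \<le> 0 \<Longrightarrow> smoothstep y = 0" "1 \<le> y \<Longrightarrow> smoothstep y = 1"
  "y \<le> 0 \<Longrightarrow> smoothstep' y = 0" "1 \<le> y \<Longrightarrow> smoothstep' y = 0"
  "0 \<le> smoothstep' y" "0 \<le> smoothstep y" "smoothstep y \<le> 1"
proof -
  have "y * y \<ge> 1" if "1 \<le> y" using mult_mono[of 1 y 1 y] that by simp
  then show "1 \<le> y \<Longrightarrow> smoothstep y = 1" "1 \<le> y \<Longrightarrow> smoothstep' y = 0"
    by (simp_all add: smoothstep_def smoothstep'_def max_def power2_eq_square)
  have "(max 0 (1 - (max 0 y)\<^sup>2))\<^sup>2 \<le> 1" by (intro power_le_one) auto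
  then show "0 \<le> smoothstep y" by (simp add: smoothstep_def)
qed (simp_all add: smoothstep_def smoothstep'_def max_def)

lemma continuous_on_smoothstep: "continuous_on T smoothstep" "continuous_on T smoothstep'"
  unfolding smoothstep_def[abs_def] smoothstep'_def[abs_def]
  by (intro continuous_intros)+

lemma compact_superlevel:
  fixes \<Omega> :: "'a::euclidean_space set" and \<psi> :: "'a \<Rightarrow> real"
  assumes "open \<Omega>" "bounded \<Omega>" "continuous_on (closure \<Omega>) \<psi>" "\<And>x. x \<in> frontier \<Omega> \<Longrightarrow> \<psi> x = 0" "\<epsilon> > 0"
  shows "compact {x \<in> closure \<Omega>. \<epsilon> \<le> \<psi> x}" "{x \<in> closure \<Omega>. \<epsilon> \<le> \<psi> x} \<subseteq> \<Omega>"
proof -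
  have "closed {x \<in> closure \<Omega>. \<epsilon> \<le> \<psi> x}"
    using continuous_closed_preimage[OF assms(3), of "{\<epsilon>..}"] by (simp add: vimage_def Int_def)
  then have "compact (closure \<Omega> \<inter> {x \<in> closure \<Omega>. \<epsilon> \<le> \<psi> x})"
    using assms(2) by (intro compact_Int_closed) (auto simp: compact_closure)
  moreover have "closure \<Omega> \<inter> {x \<in> closure \<Omega>. \<epsilon> \<le> \<psi> x} = {x \<in> closure \<Omega>. \<epsilon> \<le> \<psi> x}" by auto
  ultimately show "compact {x \<in> closure \<Omega>. \<epsilon> \<le> \<psi> x}" by simp
  show "{x \<in> closure \<Omega>. \<epsilon> \<le> \<psi> x} \<subseteq> \<Omega>"
  proof
    fix x assume x: "x \<in> {x \<in> closure \<Omega>. \<epsilon> \<le> \<psi> x}"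
    then have "x \<notin> frontier \<Omega>" using assms(4,5) by force
    then show "x \<in> \<Omega>" using x assms(1) by (simp add: frontier_def interior_open)
  qed
qed

text \<open>
  The sign of \<open>\<psi>\<close> is known only near the boundary, so \<open>\<zeta>\<close> is glued from \<open>smoothstep (\<psi> / \<epsilon> - 1)\<close>
  and the constant 1 in the region \<open>f < 2\<close>; they agree on the overlap because \<open>\<psi> \<ge> 2 \<epsilon>\<close> there.
\<close>
lemma collar_cutoff_functions:
  fixes \<Omega> :: "'a::euclidean_space set" and \<psi> :: "'a \<Rightarrow> real" and \<psi>' :: "'i \<Rightarrow> 'a \<Rightarrow> real" and e :: "'i \<Rightarrow> 'a"
  assumes \<Omega>: "open \<Omega>" "bounded \<Omega>" "\<Omega> \<noteq> {}" and \<psi>: "continuous_on (closure \<Omega>) \<psi>"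
    and zero: "\<And>x. x \<in> frontier \<Omega> \<Longrightarrow> \<psi> x = 0"
    and near: "\<And>x. x \<in> frontier \<Omega> \<Longrightarrow> \<exists>r>0. \<forall>y\<in>ball x r \<inter> \<Omega>. \<psi> y > 0"
    and \<psi>': "\<And>x j. x \<in> \<Omega> \<Longrightarrow> ((\<lambda>s. \<psi> (x + s *\<^sub>R e j)) has_real_derivative \<psi>' j x) (at 0)"
  obtains \<zeta> \<theta> :: "nat \<Rightarrow> 'a \<Rightarrow> real" and K :: "nat \<Rightarrow> 'a set" where
    "\<And>n. compact (K n)" "\<And>n. K n \<subseteq> \<Omega>"
    "\<And>n. continuous_on \<Omega> (\<zeta> n)" "\<And>n. continuous_on \<Omega> (\<theta> n)"
    "\<And>n x. x \<in> \<Omega> - K n \<Longrightarrow> \<zeta> n x = 0" "\<And>n x. x \<in> \<Omega> - K n \<Longrightarrow> \<theta> n x = 0"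
    "\<And>n x. \<theta> n x \<ge> 0" "\<And>n x. 0 \<le> \<zeta> n x" "\<And>n x. \<zeta> n x \<le> 1"
    "\<And>n x j. x \<in> \<Omega> \<Longrightarrow> ((\<lambda>s. \<zeta> n (x + s *\<^sub>R e j)) has_real_derivative \<theta> n x * \<psi>' j x) (at 0)"
    "\<And>x. x \<in> \<Omega> \<Longrightarrow> (\<lambda>n. \<zeta> n x) \<longlonglongrightarrow> 1"
proof -
  obtain r where r: "\<And>x. x \<in> frontier \<Omega> \<Longrightarrow> r x > 0 \<and> (\<forall>y\<in>ball x (r x) \<inter> \<Omega>. \<psi> y > 0)"
    using near by metis
  define N where "N = (\<Union>x\<in>frontier \<Omega>. ball x (r x))"
  have "open N" by (auto simp: N_def)
  have frN: "frontier \<Omega> \<subseteq> N" using r by (force simp: N_def)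
  have posN: "\<psi> y > 0" if "y \<in> N" "y \<in> \<Omega>" for y using that r by (auto simp: N_def)
  obtain p where p: "p \<in> \<Omega>" using \<Omega> by auto
  \<comment> \<open>The point \<open>p\<close> makes \<open>K0\<close> nonempty, so that the
    distance to it is attained.\<close>
  define K0 where "K0 = insert p (closure \<Omega> - N)"
  have cK0: "compact K0"
    unfolding K0_def using \<Omega> \<open>open N\<close> by (intro compact_insert compact_diff) (auto simp: compact_closure)
  have clos: "closure \<Omega> = \<Omega> \<union> frontier \<Omega>" using \<Omega>(1) by (auto simp: frontier_def interior_open closure_subset[THEN subsetD])
  have K0\<Omega>: "K0 \<subseteq> \<Omega>" using p frN clos by (auto simp: K0_def)
  have neK0: "K0 \<noteq> {}" by (simp add: K0_def)
  obtain \<delta> where \<delta>: "\<delta> > 0" "(\<Union>x\<in>K0. cball x \<delta>) \<subseteq> \<Omega>"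
    using compact_subset_open_imp_cball_epsilon_subset[OF cK0 \<Omega>(1) K0\<Omega>] by blast
  \<comment> \<open>Scaled so that f <= 2 means distance at most \<open>\<delta>\<close> from
    \<open>K0\<close>, which forces membership in the domain; f > 0 means outside \<open>K0\<close>,
    where \<psi> is positive.\<close>
  define f where "f x = infdist x K0 / (\<delta> / 2)" for x
  have contf: "continuous_on T f" for T unfolding f_def using \<delta> by (intro continuous_intros) auto
  have f\<Omega>: "x \<in> \<Omega>" if "f x \<le> 2" for x
  proof -
    obtain y where "y \<in> K0" "infdist x K0 = dist x y"
      using infdist_attains_inf[OF compact_imp_closed[OF cK0] neK0] by blast
    moreover have "infdist x K0 \<le> \<delta>" using that \<delta>(1) by (simp add: f_def field_simps)
    ultimately have "x \<in> (\<Union>x\<in>K0. cball x \<delta>)" by (auto simp: dist_commute)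
    then show ?thesis using \<delta>(2) by blast
  qed
  have pos: "\<psi> x > 0" if "x \<in> \<Omega>" "f x > 0" for x
  proof -
    have "x \<notin> K0" using that by (auto simp: f_def)
    then have "x \<in> N" using that closure_subset by (auto simp: K0_def)
    then show ?thesis using posN that by blast
  qed
  have closed_f: "closed {x. f x \<le> 2}" "closed {x. 1 \<le> f x}"
    by (intro closed_Collect_le contf continuous_on_const)+
  have open_f: "open {x. f x < 2}" "open {x. 1 < f x}"
    by (intro open_Collect_less contf continuous_on_const)+
  have "bounded {x. f x \<le> 2}" by (rule bounded_subset[OF \<Omega>(2)]) (use f\<Omega> in auto)
  then have comp2: "compact {x. f x \<le> 2}" using closed_f by (simp add: compact_eq_bounded_closed)
  have cont\<psi>: "continuous_on \<Omega> \<psi>" using \<psi> closure_subset continuous_on_subset by blast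
  \<comment> \<open>A positive lower bound for \<psi> on the compact band 1 <= f <= 2; any positive
    number serves if the band is empty.\<close>
  obtain m where m: "m > 0" "\<And>x. 1 \<le> f x \<Longrightarrow> f x \<le> 2 \<Longrightarrow> m \<le> \<psi> x"
  proof (cases "{x. f x \<le> 2} \<inter> {x. 1 \<le> f x} = {}")
    case True
    then show thesis using that[of 1] by auto
  next
    case False
    have "compact ({x. f x \<le> 2} \<inter> {x. 1 \<le> f x})" by (rule compact_Int_closed[OF comp2 closed_f(2)])
    moreover have "continuous_on ({x. f x \<le> 2} \<inter> {x. 1 \<le> f x}) \<psi>"
      using cont\<psi> f\<Omega> by (auto intro: continuous_on_subset)
    ultimately obtain z where z: "f z \<le> 2" "1 \<le> f z" "\<And>x. f x \<le> 2 \<Longrightarrow> 1 \<le> f x \<Longrightarrow> \<psi> z \<le> \<psi> x"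
      using continuous_attains_inf[of "{x. f x \<le> 2} \<inter> {x. 1 \<le> f x}" \<psi>] False by auto
    have "\<psi> z > 0" using pos[of z] f\<Omega>[of z] z by simp
    then show thesis using that[of "\<psi> z"] z by auto
  qed
  \<comment> \<open>At most m / 2, so that \<psi> >= 2 \<epsilon> on the band, and tending to 0, so
    that every point is eventually in the region where the cutoff is 1.\<close>
  define \<epsilon> where "\<epsilon> n = m / (2 * (real n + 1))" for n :: nat
  have \<epsilon>: "\<epsilon> n > 0" "2 * \<epsilon> n \<le> m" for n using m(1) by (auto simp: \<epsilon>_def field_simps)
  define \<zeta> where "\<zeta> n x = (if f x < 2 then 1 else smoothstep (\<psi> x / \<epsilon> n - 1))" for n x
  define \<theta> where "\<theta> n x = (if f x < 2 then 0 else smoothstep' (\<psi> x / \<epsilon> n - 1) / \<epsilon> n)" for n x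
  \<comment> \<open>Outside the core, the cutoff and its derivative vanish where \<psi> <
    \<epsilon>. The superlevel set is compact inside the domain because \<psi> = 0 on the
    frontier.\<close>
  define K where "K n = {x. f x \<le> 2} \<union> {x \<in> closure \<Omega>. \<epsilon> n \<le> \<psi> x}" for n
  have big: "\<psi> x / \<epsilon> n - 1 \<ge> 1" if "1 < f x" "f x < 2" for x n
    using m(2)[of x] \<epsilon>[of n] that by (simp add: field_simps)
  have \<zeta>_out: "\<zeta> n x = smoothstep (\<psi> x / \<epsilon> n - 1)" "\<theta> n x = smoothstep' (\<psi> x / \<epsilon> n - 1) / \<epsilon> n"
    if "1 < f x" for n x
    using big[OF that, of n] by (auto simp: \<zeta>_def \<theta>_def smoothstep_simps)
  have \<zeta>_in: "\<zeta> n x = 1" "\<theta> n x = 0" if "f x < 2" for n x using that by (simp_all add: \<zeta>_def \<theta>_def)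
  have cover: "\<Omega> = (\<Omega> \<inter> {x. f x < 2}) \<union> (\<Omega> \<inter> {x. 1 < f x})" by auto
  have cont_arg: "continuous_on (\<Omega> \<inter> {x. 1 < f x}) (\<lambda>x. \<psi> x / \<epsilon> n - 1)" for n
    using \<epsilon>(1)[of n] by (intro continuous_intros continuous_on_subset[OF cont\<psi>]) auto
  show thesis
  proof
    show "compact (K n)" "K n \<subseteq> \<Omega>" for n
      using compact_superlevel[OF \<Omega>(1,2) \<psi> zero \<epsilon>(1)] comp2 f\<Omega> by (auto simp: K_def)
    show "continuous_on \<Omega> (\<zeta> n)" for n
    proof (subst cover, rule continuous_on_open_Un)
      show "continuous_on (\<Omega> \<inter> {x. f x < 2}) (\<zeta> n)"
        by (rule continuous_on_eq[of _ "\<lambda>_. 1"]) (auto simp: \<zeta>_in)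
      show "continuous_on (\<Omega> \<inter> {x. 1 < f x}) (\<zeta> n)"
        by (rule continuous_on_eq[OF continuous_on_compose2[OF continuous_on_smoothstep(1)[of UNIV] cont_arg]])
           (auto simp: \<zeta>_out)
    qed (use open_f \<Omega> in auto)
    show "continuous_on \<Omega> (\<theta> n)" for n
    proof (subst cover, rule continuous_on_open_Un)
      show "continuous_on (\<Omega> \<inter> {x. f x < 2}) (\<theta> n)"
        by (rule continuous_on_eq[of _ "\<lambda>_. 0"]) (auto simp: \<zeta>_in)
      have "continuous_on (\<Omega> \<inter> {x. 1 < f x}) (\<lambda>x. smoothstep' (\<psi> x / \<epsilon> n - 1) / \<epsilon> n)"
        using \<epsilon>(1)[of n]
        by (intro continuous_on_divide continuous_on_const continuous_on_compose2[OF continuous_on_smoothstep(2)[of UNIV] cont_arg]) auto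
      then show "continuous_on (\<Omega> \<inter> {x. 1 < f x}) (\<theta> n)"
        by (rule continuous_on_eq) (auto simp: \<zeta>_out)
    qed (use open_f \<Omega> in auto)
    show "\<zeta> n x = 0" "\<theta> n x = 0" if "x \<in> \<Omega> - K n" for n x
    proof -
      have "f x > 2" "\<psi> x < \<epsilon> n" using that closure_subset by (auto simp: K_def)
      then have "\<psi> x / \<epsilon> n - 1 \<le> 0" "\<not> f x < 2" using \<epsilon>(1)[of n] by (auto simp: field_simps)
      then show "\<zeta> n x = 0" "\<theta> n x = 0" by (auto simp: \<zeta>_def \<theta>_def smoothstep_simps)
    qed
    show "\<theta> n x \<ge> 0" "0 \<le> \<zeta> n x" "\<zeta> n x \<le> 1" for n x
      using \<epsilon>(1)[of n] by (auto simp: \<zeta>_def \<theta>_def smoothstep_simps)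
    show "((\<lambda>s. \<zeta> n (x + s *\<^sub>R e j)) has_real_derivative \<theta> n x * \<psi>' j x) (at 0)" if x: "x \<in> \<Omega>" for n x j
    proof -
      have ev: "eventually (\<lambda>s. x + s *\<^sub>R e j \<in> T) (nhds 0)" if "open T" "x \<in> T" for T
      proof -
        have "((\<lambda>s. x + s *\<^sub>R e j) \<longlongrightarrow> x + 0 *\<^sub>R e j) (nhds 0)"
          by (intro tendsto_intros filterlim_ident)
        then show ?thesis using that by (auto dest: topological_tendstoD)
      qed
      show ?thesis
      proof (cases "f x < 2")
        case True
        have "eventually (\<lambda>s. \<zeta> n (x + s *\<^sub>R e j) = 1) (nhds 0)"
          using ev[OF open_f(1)] True by (auto elim!: eventually_mono simp: \<zeta>_in)
        then show ?thesis
          using DERIV_cong_ev[OF refl, of "\<lambda>s. \<zeta> n (x + s *\<^sub>R e j)" "\<lambda>_. 1" 0 0 0] True by (simp add: \<zeta>_in)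
      next
        case False
        have "eventually (\<lambda>s. \<zeta> n (x + s *\<^sub>R e j) = smoothstep (\<psi> (x + s *\<^sub>R e j) / \<epsilon> n - 1)) (nhds 0)"
          using ev[OF open_f(2)] False by (auto elim!: eventually_mono simp: \<zeta>_out)
        moreover have "((\<lambda>s. smoothstep (\<psi> (x + s *\<^sub>R e j) / \<epsilon> n - 1)) has_real_derivative \<theta> n x * \<psi>' j x) (at 0)"
        proof -
          have "((\<lambda>s. \<psi> (x + s *\<^sub>R e j) / \<epsilon> n - 1) has_real_derivative \<psi>' j x / \<epsilon> n - 0) (at 0)"
            by (intro DERIV_diff DERIV_cdivide \<psi>'[OF x] DERIV_const)
          from DERIV_chain2[OF smoothstep_deriv this]
          show ?thesis using False by (simp add: \<zeta>_out)
        qed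
        ultimately show ?thesis
          using DERIV_cong_ev[OF refl, of "\<lambda>s. \<zeta> n (x + s *\<^sub>R e j)" _ 0 "\<theta> n x * \<psi>' j x" "\<theta> n x * \<psi>' j x"] by simp
      qed
    qed
    show "(\<lambda>n. \<zeta> n x) \<longlonglongrightarrow> 1" if x: "x \<in> \<Omega>" for x
    proof (cases "f x < 2")
      case True
      then show ?thesis by (simp add: \<zeta>_in)
    next
      case False
      then have px: "\<psi> x > 0" using pos[OF x] by simp
      obtain n0 where n0: "real n0 \<ge> m / \<psi> x" using real_arch_simple by blast
      have "\<zeta> n x = 1" if "n \<ge> n0" for n
      proof -
        have "real n0 \<le> real n" using that by simp
        with n0 have "m / \<psi> x \<le> real n + 1" by linarith
        then have "2 * \<epsilon> n \<le> \<psi> x" using px m(1) by (simp add: \<epsilon>_def field_simps)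
        then have "\<psi> x / \<epsilon> n - 1 \<ge> 1" using \<epsilon>(1)[of n] by (simp add: field_simps)
        then show ?thesis by (simp add: \<zeta>_def smoothstep_simps)
      qed
      then have "eventually (\<lambda>n. \<zeta> n x = 1) sequentially" by (auto simp: eventually_sequentially)
      then show ?thesis by (rule tendsto_eventually)
    qed
  qed
qed

section \<open>Removing the cutoff\<close>

text \<open>Gradient and Hessian extend continuously to the compact closure, and the curvature is a
  continuous expression in them. The bound supplies the dominating function for the limit of the
  cutoff integrals.\<close>

lemma H_curv_bounded:
  assumes \<Omega>: "open \<Omega>" "bounded \<Omega>" and u: "smooth_on_closure \<Omega> u"
  obtains C where "\<And>x. x \<in> \<Omega> \<Longrightarrow> \<bar>H_curv k u x\<bar> \<le> C"
proof -
  obtain g h where g: "continuous_on (closure \<Omega>) g" "\<And>x. x \<in> \<Omega> \<Longrightarrow> g x = grad u x"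
    and h: "\<And>i j. continuous_on (closure \<Omega>) (\<lambda>x. h x $ i $ j)" "\<And>x. x \<in> \<Omega> \<Longrightarrow> h x = hess u x"
    using smooth_on_closure_extension[OF u] by metis
  have "continuous_on (closure \<Omega>) (\<lambda>x. (gmat (g x) ** h x) $ i $ j)" for i j
    unfolding matrix_matrix_mult_def vec_lambda_beta
    by (intro continuous_on_sum continuous_on_mult h continuous_on_gmat continuous_on_component g)
  then have "continuous_on (closure \<Omega>) (\<lambda>x. esigma k (gmat (g x) ** h x))"
    by (rule continuous_on_esigma)
  moreover have "compact (closure \<Omega>)" using \<Omega> by (simp add: compact_closure)
  ultimately have "bounded ((\<lambda>x. esigma k (gmat (g x) ** h x)) ` closure \<Omega>)"
    by (intro compact_imp_bounded compact_continuous_image)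
  then obtain C where C: "\<And>x. x \<in> closure \<Omega> \<Longrightarrow> \<bar>esigma k (gmat (g x) ** h x)\<bar> \<le> C"
    by (auto simp: bounded_iff)
  have "\<bar>H_curv k u x\<bar> \<le> C" if "x \<in> \<Omega>" for x
    using C[of x] that closure_subset g(2)[OF that] h(2)[OF that] H_curv_eq[OF \<Omega>(1) that, of u k] u
    by (auto simp: smooth_on_closure_def)
  then show thesis by (rule that)
qed

lemma integral_cutoff_tendsto:
  fixes H :: "'a::euclidean_space \<Rightarrow> real" and \<zeta> :: "nat \<Rightarrow> 'a \<Rightarrow> real"
  assumes \<Omega>: "open \<Omega>" "bounded \<Omega>" and H: "continuous_on \<Omega> H" "\<And>x. x \<in> \<Omega> \<Longrightarrow> \<bar>H x\<bar> \<le> C"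
    and \<zeta>: "\<And>n. continuous_on \<Omega> (\<zeta> n)" "\<And>n x. 0 \<le> \<zeta> n x" "\<And>n x. \<zeta> n x \<le> 1"
      "\<And>x. x \<in> \<Omega> \<Longrightarrow> (\<lambda>n. \<zeta> n x) \<longlonglongrightarrow> 1"
  shows "(\<lambda>n. LINT x|lborel. (if x \<in> \<Omega> then \<zeta> n x * H x else 0)) \<longlonglongrightarrow> (LINT x:\<Omega>|lborel. H x)"
proof -
  have meas: "(\<lambda>x. if x \<in> \<Omega> then f x else 0) \<in> borel_measurable lborel" if "continuous_on \<Omega> f" for f :: "'a \<Rightarrow> real"
  proof -
    have "(\<lambda>x. indicator \<Omega> x *\<^sub>R f x) \<in> borel_measurable borel"
      using \<Omega>(1) that by (intro borel_measurable_continuous_on_indicator) auto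
    moreover have "(\<lambda>x. indicator \<Omega> x *\<^sub>R f x) = (\<lambda>x. if x \<in> \<Omega> then f x else 0)"
      by (auto simp: indicator_def)
    ultimately show ?thesis by simp
  qed
  have "(\<lambda>n. LINT x|lborel. (if x \<in> \<Omega> then \<zeta> n x * H x else 0)) \<longlonglongrightarrow> (LINT x|lborel. (if x \<in> \<Omega> then H x else 0))"
  proof (rule integral_dominated_convergence[where w = "\<lambda>x. C * indicator \<Omega> x"])
    show "(\<lambda>x. if x \<in> \<Omega> then H x else 0) \<in> borel_measurable lborel" by (rule meas[OF H(1)])
    show "(\<lambda>x. if x \<in> \<Omega> then \<zeta> n x * H x else 0) \<in> borel_measurable lborel" for n
      by (rule meas) (intro continuous_on_mult \<zeta> H)
    have "emeasure lborel \<Omega> < \<infinity>" using \<Omega>(2) by (rule emeasure_bounded_finite)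
    then show "integrable lborel (\<lambda>x. C * indicator \<Omega> x)"
      using \<Omega>(1) by (intro integrable_mult_right integrable_real_indicator) auto
    have "(\<lambda>n. if x \<in> \<Omega> then \<zeta> n x * H x else 0) \<longlonglongrightarrow> (if x \<in> \<Omega> then H x else 0)" for x
      using tendsto_mult_right[OF \<zeta>(4), of x "H x"] by auto
    then show "AE x in lborel. (\<lambda>n. if x \<in> \<Omega> then \<zeta> n x * H x else 0) \<longlonglongrightarrow> (if x \<in> \<Omega> then H x else 0)" by simp
    have "norm (if x \<in> \<Omega> then \<zeta> n x * H x else 0) \<le> C * indicator \<Omega> x" for n x
    proof (cases "x \<in> \<Omega>")
      case True
      have "\<bar>\<zeta> n x\<bar> * \<bar>H x\<bar> \<le> 1 * \<bar>H x\<bar>" using \<zeta>(2,3)[of n x] by (intro mult_right_mono) auto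
      then show ?thesis using H(2)[OF True] True by (simp add: abs_mult)
    qed simp
    then show "AE x in lborel. norm (if x \<in> \<Omega> then \<zeta> n x * H x else 0) \<le> C * indicator \<Omega> x" for n by simp
  qed
  moreover have "(LINT x:\<Omega>|lborel. H x) = (LINT x|lborel. (if x \<in> \<Omega> then H x else 0))"
    unfolding set_lebesgue_integral_def by (intro Bochner_Integration.integral_cong) auto
  ultimately show ?thesis by simp
qed

theorem lemma2p3:
  fixes \<Omega> :: "(real^'n::finite) set"
    and \<gamma> :: "real^'n \<Rightarrow> real^'n"
    and u v :: "real^'n \<Rightarrow> real"
    and k :: nat
  assumes "1 < k" and "k < CARD('n)"
    and "domain \<Omega>" and "bounded \<Omega>"
    and "C1_boundary \<Omega>" and "unit_outer_normal \<Omega> \<gamma>"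
    and "smooth_on_closure \<Omega> u" and "smooth_on_closure \<Omega> v"
    and "H_subharmonic_on k \<Omega> u" and "H_subharmonic_on k \<Omega> v"
    and "\<forall>x\<in>frontier \<Omega>. u x = v x"
    and "\<forall>x\<in>frontier \<Omega>. outward_deriv u (\<gamma> x) x > outward_deriv v (\<gamma> x) x"
  shows "(LINT x:\<Omega>|lborel. H_curv k u x) \<ge> (LINT x:\<Omega>|lborel. H_curv k v x)"
proof -
  have \<Omega>: "open \<Omega>" "bounded \<Omega>" "\<Omega> \<noteq> {}" using assms(3,4) by (auto simp: domain_def)
  have smooth: "Ck_on m \<Omega> u" "Ck_on m \<Omega> v" for m
    using assms(7,8) by (auto simp: smooth_on_closure_def)
  \<comment> \<open>With this order t = 0 belongs to \<open>v\<close> and t = 1 to \<open>u\<close>,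
    so monotonicity in t gives the inequality in the required direction.\<close>
  interpret graph_pair \<Omega> u v by unfold_locales (use \<Omega> smooth in auto)
  have near: "\<exists>r>0. \<forall>y\<in>ball x r \<inter> \<Omega>. 0 < v y - u y" if x: "x \<in> frontier \<Omega>" for x
  proof -
    obtain U \<rho> where def: "defining_function \<Omega> x U \<rho>" using assms(5) x by (auto simp: C1_boundary_def)
    show ?thesis
      using less_near_frontier_point[OF \<Omega>(1) assms(6-8,11) _ x def] assms(12) x by auto
  qed
  have cont: "continuous_on (closure \<Omega>) (\<lambda>x. v x - u x)"
    using assms(7,8) by (intro continuous_on_diff) (auto simp: smooth_on_closure_def)
  have \<psi>': "((\<lambda>s. v (x + s *\<^sub>R axis j 1) - u (x + s *\<^sub>R axis j 1)) has_real_derivative - dgrad x $ j) (at 0)"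
    if "x \<in> \<Omega>" for x j
    using DERIV_diff[OF partials_deriv(2)[OF that, of "[]" j] partials_deriv(1)[OF that, of "[]" j]]
    by (simp add: dgrad_def grad_def)
  have eq0: "v x - u x = 0" if "x \<in> frontier \<Omega>" for x using assms(11) that by simp
  obtain \<zeta> \<theta> :: "nat \<Rightarrow> real^'n \<Rightarrow> real" and K :: "nat \<Rightarrow> (real^'n) set" where
    K: "\<And>n. compact (K n)" "\<And>n. K n \<subseteq> \<Omega>"
    and \<zeta>: "\<And>n. continuous_on \<Omega> (\<zeta> n)" "\<And>n. continuous_on \<Omega> (\<theta> n)"
    "\<And>n x. x \<in> \<Omega> - K n \<Longrightarrow> \<zeta> n x = 0" "\<And>n x. x \<in> \<Omega> - K n \<Longrightarrow> \<theta> n x = 0"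
    "\<And>n x. \<theta> n x \<ge> 0" "\<And>n x. 0 \<le> \<zeta> n x" "\<And>n x. \<zeta> n x \<le> 1"
    "\<And>n x j. x \<in> \<Omega> \<Longrightarrow> ((\<lambda>s. \<zeta> n (x + s *\<^sub>R axis j 1)) has_real_derivative \<theta> n x * - dgrad x $ j) (at 0)"
    "\<And>x. x \<in> \<Omega> \<Longrightarrow> (\<lambda>n. \<zeta> n x) \<longlonglongrightarrow> 1"
    by (rule collar_cutoff_functions[where e = "\<lambda>j. axis j 1" and \<psi>' = "\<lambda>j x. - dgrad x $ j",
        OF \<Omega> cont eq0 near \<psi>']) (assumption | (rule that; assumption))+
  have mono: "(LINT x|lborel. (if x \<in> \<Omega> then \<zeta> n x * esigma k (A 0 x) else 0))
      \<le> (LINT x|lborel. (if x \<in> \<Omega> then \<zeta> n x * esigma k (A 1 x) else 0))" for n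
  proof (rule integral_esigma_mono[OF _ _ _ _ K(1)[of n] K(2)[of n] \<zeta>(1)[of n] \<zeta>(3) _ \<zeta>(2)[of n] \<zeta>(4)])
    show "((\<lambda>s. \<zeta> n (x + s *\<^sub>R axis j 1)) has_real_derivative - \<theta> n x * dgrad x $ j) (at 0)" if "x \<in> \<Omega>" for x j
      using \<zeta>(8)[OF that, of n j] by simp
  qed (use assms(1,2,9,10) \<zeta>(5) in \<open>auto simp: H_subharmonic_on_def\<close>)
  have cont_H: "continuous_on \<Omega> (\<lambda>x. esigma k (A t x))" for t
    by (intro continuous_on_esigma continuous_on_slice[OF continuous_on_A_E_B_V(1)])
  have lim: "(\<lambda>n. LINT x|lborel. (if x \<in> \<Omega> then \<zeta> n x * H x else 0)) \<longlonglongrightarrow> (LINT x:\<Omega>|lborel. H_curv k f x)"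
    if f: "smooth_on_closure \<Omega> f" and H: "continuous_on \<Omega> H" "\<And>x. x \<in> \<Omega> \<Longrightarrow> H x = H_curv k f x" for f H
  proof -
    obtain C where C: "\<And>x. x \<in> \<Omega> \<Longrightarrow> \<bar>H_curv k f x\<bar> \<le> C" using H_curv_bounded[OF \<Omega>(1,2) f] by blast
    have "(\<lambda>n. LINT x|lborel. (if x \<in> \<Omega> then \<zeta> n x * H x else 0)) \<longlonglongrightarrow> (LINT x:\<Omega>|lborel. H x)"
      by (rule integral_cutoff_tendsto[OF \<Omega>(1,2) H(1) _ \<zeta>(1) \<zeta>(6) \<zeta>(7) \<zeta>(9)]) (use C H(2) in auto)
    moreover have "(LINT x:\<Omega>|lborel. H x) = (LINT x:\<Omega>|lborel. H_curv k f x)"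
      unfolding set_lebesgue_integral_def
      by (intro Bochner_Integration.integral_cong) (auto simp: indicator_def H(2))
    ultimately show ?thesis by simp
  qed
  \<comment> \<open>The inequality holds for every cutoff and passes to the limit on both
    sides.\<close>
  show ?thesis
    by (rule LIMSEQ_le[OF lim[OF assms(8) cont_H[of 0]] lim[OF assms(7) cont_H[of 1]]])
       (use mono esigma_A_endpoints in auto)
qed

end
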